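(* Let $Y_0\in F$ and let $Y\in C^1([0,T],F)$ be the short-time solution of the system $Y_t=G(Y)$ with $Y(0)=Y_0$. The spaces $F^e$ and $F^\alpha$ ($\alpha>1$) are preserved by the flow of this system. More precisely: (i) If $Y_0\in F^e$, then $\sup_{t\in[0,T]}\|Y(t,\cdot)\|_{F^e}\le C$ for a constant $C$ which depends only on $T$ and $\|Y_0\|_{F^e}$. (ii) If $Y_0\in F^\alpha$, then $\sup_{t\in[0,T]}\|Y(t,\cdot)\|_{F^\alpha}\le C$ for a constant $C$ which depends only on $T$ and $\|Y_0\|_{F^\alpha}$.
   Context: Fix $\gamma\in\mathbb{R}$. All function spaces are over $\mathbb{R}$ (variable $\xi$). $F=L^\infty\times(L^\infty\cap L^2)\times L^\infty\times L^2\times L^2\times L^2$ is the Banach space of elements $Y=(\zeta,U,H,v,w,h)$ with norm $\|Y\|_F=\|\zeta\|_{L^\infty}+\|U\|_{L^2}+\|U\|_{L^\infty}+\|H\|_{L^\infty}+\|v\|_{L^2}+\|w\|_{L^2}+\|h\|_{L^2}$. One always writes $y(\xi)=\xi+\zeta(\xi)$ and $q=1+v$. For $Y\in F$, $P(\xi)=\frac12\int_{\mathbb{R}}e^{-\mathrm{sgn}(\xi-\eta)(y(\xi)-y(\eta))}\left(\frac{3-2\gamma}{2}U^2q+\frac{\gamma}{2}h\right)(\eta)\,d\eta$, $Q(\xi)=-\frac12\int_{\mathbb{R}}\mathrm{sgn}(\xi-\eta)e^{-\mathrm{sgn}(\xi-\eta)(y(\xi)-y(\eta))}\left(\frac{3-2\gamma}{2}U^2q+\frac{\gamma}{2}h\right)(\eta)\,d\eta$.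 The system $Y_t=G(Y)$ is: $\zeta_t=\gamma U$, $U_t=-Q$, $H_t=U^3-2PU$, $v_t=q_t=\gamma w$, $w_t=\frac{\gamma}{2}h+\left(\frac{3-2\gamma}{2}U^2-P\right)q$, $h_t=-2QUq+(3U^2-2P)w$. For each $Y_0\in F$ it has a unique solution in $C^1([0,T],F)$ for some $T>0$ depending only on $\|Y_0\|_F$ (the short-time solution). $F^e=\{Y\in F: q,w,h\in L^\infty,\ e^{|\xi|/2}U\in L^2,\ e^{|\xi|/2}w\in L^2,\ e^{|\xi|}h\in L^1\}$ with norm $\|Y\|_{F^e}=\|Y\|_F+\|q\|_{L^\infty}+\|w\|_{L^\infty}+\|h\|_{L^\infty}+\|e^{|\xi|/2}U\|_{L^2}+\|e^{|\xi|/2}w\|_{L^2}+\|e^{|\xi|}h\|_{L^1}$. For $\alpha>1$, $F^\alpha=\{Y\in F: q,w,h\in L^\infty,\ (1+|\xi|)^{\alpha/2}U\in L^2,\ (1+|\xi|)^{\alpha/2}w\in L^2,\ (1+|\xi|)^\alpha h\in L^1\}$ with norm $\|Y\|_{F^\alpha}=\|Y\|_F+\|q\|_{L^\infty}+\|w\|_{L^\infty}+\|h\|_{L^\infty}+\|(1+|\xi|)^{\alpha/2}U\|_{L^2}+\|(1+|\xi|)^{\alpha/2}w\|_{L^2}+\|(1+|\xi|)^\alpha h\|_{L^1}$. *)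

theory Defs
  imports "HOL-Probability.Essential_Supremum"
begin

text \<open>
  Elements of the Lebesgue spaces are represented by Borel functions on the line (every class
  of Lebesgue measurable functions has a Borel representative). Nothing below depends on the
  choice of representatives up to almost everywhere equality.
\<close>

definition L1 :: "(real \<Rightarrow> real) set" where
  "L1 = {f. integrable lborel f}"

definition L2 :: "(real \<Rightarrow> real) set" where
  "L2 = {f. f \<in> borel_measurable lborel \<and> integrable lborel (\<lambda>\<xi>. (f \<xi>)\<^sup>2)}"

definition Linf :: "(real \<Rightarrow> real) set" where
  "Linf = {f. f \<in> borel_measurable lborel \<and> esssup lborel (\<lambda>\<xi>. ennreal \<bar>f \<xi>\<bar>) < \<infinity>}"

definition L1_norm :: "(real \<Rightarrow> real) \<Rightarrow> real" where
  "L1_norm f = (LINT \<xi>|lborel. \<bar>f \<xi>\<bar>)"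

definition L2_norm :: "(real \<Rightarrow> real) \<Rightarrow> real" where
  "L2_norm f = sqrt (LINT \<xi>|lborel. (f \<xi>)\<^sup>2)"

definition Linf_norm :: "(real \<Rightarrow> real) \<Rightarrow> real" where
  "Linf_norm f = enn2real (esssup lborel (\<lambda>\<xi>. ennreal \<bar>f \<xi>\<bar>))"

record state =
  zeta_of :: "real \<Rightarrow> real"
  U_of :: "real \<Rightarrow> real"
  H_of :: "real \<Rightarrow> real"
  v_of :: "real \<Rightarrow> real"
  w_of :: "real \<Rightarrow> real"
  h_of :: "real \<Rightarrow> real"

definition y_of :: "state \<Rightarrow> real \<Rightarrow> real" where
  "y_of Y \<xi> = \<xi> + zeta_of Y \<xi>"

definition q_of :: "state \<Rightarrow> real \<Rightarrow> real" where
  "q_of Y \<xi> = 1 + v_of Y \<xi>"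


definition F :: "state set" where
  "F = {Y. zeta_of Y \<in> Linf \<and> U_of Y \<in> Linf \<inter> L2 \<and> H_of Y \<in> Linf \<and>
           v_of Y \<in> L2 \<and> w_of Y \<in> L2 \<and> h_of Y \<in> L2}"

definition F_norm :: "state \<Rightarrow> real" where
  "F_norm Y = Linf_norm (zeta_of Y) + L2_norm (U_of Y) + Linf_norm (U_of Y) + Linf_norm (H_of Y)
     + L2_norm (v_of Y) + L2_norm (w_of Y) + L2_norm (h_of Y)"

definition F_minus :: "state \<Rightarrow> state \<Rightarrow> state" where
  "F_minus X Y =
     \<lparr>zeta_of = (\<lambda>\<xi>. zeta_of X \<xi> - zeta_of Y \<xi>),
      U_of = (\<lambda>\<xi>. U_of X \<xi> - U_of Y \<xi>),
      H_of = (\<lambda>\<xi>. H_of X \<xi> - H_of Y \<xi>),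
      v_of = (\<lambda>\<xi>. v_of X \<xi> - v_of Y \<xi>),
      w_of = (\<lambda>\<xi>. w_of X \<xi> - w_of Y \<xi>),
      h_of = (\<lambda>\<xi>. h_of X \<xi> - h_of Y \<xi>)\<rparr>"

definition F_scale :: "real \<Rightarrow> state \<Rightarrow> state" where
  "F_scale c Y =
     \<lparr>zeta_of = (\<lambda>\<xi>. c * zeta_of Y \<xi>),
      U_of = (\<lambda>\<xi>. c * U_of Y \<xi>),
      H_of = (\<lambda>\<xi>. c * H_of Y \<xi>),
      v_of = (\<lambda>\<xi>. c * v_of Y \<xi>),
      w_of = (\<lambda>\<xi>. c * w_of Y \<xi>),
      h_of = (\<lambda>\<xi>. c * h_of Y \<xi>)\<rparr>"

definition Fe :: "state set" where
  "Fe = {Y \<in> F. q_of Y \<in> Linf \<and> w_of Y \<in> Linf \<and> h_of Y \<in> Linf \<and>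
           (\<lambda>\<xi>. exp (\<bar>\<xi>\<bar> / 2) * U_of Y \<xi>) \<in> L2 \<and>
           (\<lambda>\<xi>. exp (\<bar>\<xi>\<bar> / 2) * w_of Y \<xi>) \<in> L2 \<and>
           (\<lambda>\<xi>. exp \<bar>\<xi>\<bar> * h_of Y \<xi>) \<in> L1}"

definition Fe_norm :: "state \<Rightarrow> real" where
  "Fe_norm Y = F_norm Y + Linf_norm (q_of Y) + Linf_norm (w_of Y) + Linf_norm (h_of Y)
     + L2_norm (\<lambda>\<xi>. exp (\<bar>\<xi>\<bar> / 2) * U_of Y \<xi>)
     + L2_norm (\<lambda>\<xi>. exp (\<bar>\<xi>\<bar> / 2) * w_of Y \<xi>)
     + L1_norm (\<lambda>\<xi>. exp \<bar>\<xi>\<bar> * h_of Y \<xi>)"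

definition Falpha :: "real \<Rightarrow> state set" where
  "Falpha \<alpha> = {Y \<in> F. q_of Y \<in> Linf \<and> w_of Y \<in> Linf \<and> h_of Y \<in> Linf \<and>
           (\<lambda>\<xi>. (1 + \<bar>\<xi>\<bar>) powr (\<alpha> / 2) * U_of Y \<xi>) \<in> L2 \<and>
           (\<lambda>\<xi>. (1 + \<bar>\<xi>\<bar>) powr (\<alpha> / 2) * w_of Y \<xi>) \<in> L2 \<and>
           (\<lambda>\<xi>. (1 + \<bar>\<xi>\<bar>) powr \<alpha> * h_of Y \<xi>) \<in> L1}"

definition Falpha_norm :: "real \<Rightarrow> state \<Rightarrow> real" where
  "Falpha_norm \<alpha> Y = F_norm Y + Linf_norm (q_of Y) + Linf_norm (w_of Y) + Linf_norm (h_of Y)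
     + L2_norm (\<lambda>\<xi>. (1 + \<bar>\<xi>\<bar>) powr (\<alpha> / 2) * U_of Y \<xi>)
     + L2_norm (\<lambda>\<xi>. (1 + \<bar>\<xi>\<bar>) powr (\<alpha> / 2) * w_of Y \<xi>)
     + L1_norm (\<lambda>\<xi>. (1 + \<bar>\<xi>\<bar>) powr \<alpha> * h_of Y \<xi>)"


definition P :: "real \<Rightarrow> state \<Rightarrow> real \<Rightarrow> real" where
  "P \<gamma> Y \<xi> = 1/2 * (LINT \<eta>|lborel.
      exp (- (sgn (\<xi> - \<eta>) * (y_of Y \<xi> - y_of Y \<eta>))) *
      ((3 - 2 * \<gamma>) / 2 * (U_of Y \<eta>)\<^sup>2 * q_of Y \<eta> + \<gamma> / 2 * h_of Y \<eta>))"

definition Q :: "real \<Rightarrow> state \<Rightarrow> real \<Rightarrow> real" where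
  "Q \<gamma> Y \<xi> = - (1/2) * (LINT \<eta>|lborel.
      sgn (\<xi> - \<eta>) * exp (- (sgn (\<xi> - \<eta>) * (y_of Y \<xi> - y_of Y \<eta>))) *
      ((3 - 2 * \<gamma>) / 2 * (U_of Y \<eta>)\<^sup>2 * q_of Y \<eta> + \<gamma> / 2 * h_of Y \<eta>))"

definition G :: "real \<Rightarrow> state \<Rightarrow> state" where
  "G \<gamma> Y =
     \<lparr>zeta_of = (\<lambda>\<xi>. \<gamma> * U_of Y \<xi>),
      U_of = (\<lambda>\<xi>. - Q \<gamma> Y \<xi>),
      H_of = (\<lambda>\<xi>. (U_of Y \<xi>) ^ 3 - 2 * P \<gamma> Y \<xi> * U_of Y \<xi>),
      v_of = (\<lambda>\<xi>. \<gamma> * w_of Y \<xi>),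
      w_of = (\<lambda>\<xi>. \<gamma> / 2 * h_of Y \<xi> + ((3 - 2 * \<gamma>) / 2 * (U_of Y \<xi>)\<^sup>2 - P \<gamma> Y \<xi>) * q_of Y \<xi>),
      h_of = (\<lambda>\<xi>. - 2 * Q \<gamma> Y \<xi> * U_of Y \<xi> * q_of Y \<xi>
                   + (3 * (U_of Y \<xi>)\<^sup>2 - 2 * P \<gamma> Y \<xi>) * w_of Y \<xi>)\<rparr>"

text \<open>Continuous differentiability of curves in the normed space F; the derivative is
  one-sided at the end points.\<close>

definition C1_F :: "real \<Rightarrow> (real \<Rightarrow> state) \<Rightarrow> (real \<Rightarrow> state) \<Rightarrow> bool" where
  "C1_F T Y Y' \<longleftrightarrow>
     (\<forall>t\<in>{0..T}. Y t \<in> F \<and> Y' t \<in> F \<and>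
        ((\<lambda>s. F_norm (F_minus (F_scale (1 / (s - t)) (F_minus (Y s) (Y t))) (Y' t))) \<longlongrightarrow> 0)
          (at t within {0..T}) \<and>
        ((\<lambda>s. F_norm (F_minus (Y' s) (Y' t))) \<longlongrightarrow> 0) (at t within {0..T}))"

definition solution :: "real \<Rightarrow> real \<Rightarrow> state \<Rightarrow> (real \<Rightarrow> state) \<Rightarrow> bool" where
  "solution \<gamma> T Y0 Y \<longleftrightarrow> C1_F T Y (\<lambda>t. G \<gamma> (Y t)) \<and> Y 0 = Y0"

text \<open>
  A short existence time depending only on the norm of the initial data, as it is produced by
  the contraction argument: up to that time, solutions issued from a bounded set of initial
  data stay in a bounded subset of F. The quantification over all smaller intervals
  matters: together with the blow-up alternative (G is locally Lipschitz on F, uniformly on bounded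
  sets) it says that the solution exists on the whole interval. Mere existence up to time
  \<open>\<tau> (F_norm Y0)\<close> would not suffice, since solutions that blow up shortly after that time
  are not controlled by the norm of their initial data.
\<close>

definition short_time :: "real \<Rightarrow> (real \<Rightarrow> real) \<Rightarrow> bool" where
  "short_time \<gamma> \<tau> \<longleftrightarrow>
     (\<forall>r\<ge>0. 0 < \<tau> r) \<and>
     (\<forall>R. \<exists>M. \<forall>Y0 T Y. Y0 \<in> F \<and> F_norm Y0 \<le> R \<and> 0 < T \<and> T \<le> \<tau> (F_norm Y0) \<and>
        solution \<gamma> T Y0 Y \<longrightarrow> (\<forall>t\<in>{0..T}. F_norm (Y t) \<le> M))"

end

theory Submission
  imports Defs
begin

text \<open>Every quantity to be estimated is a seminorm \<open>p\<close> of components of the state, dominated by a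
  multiple of the \<open>F\<close> norm. Along a \<open>C\<^sup>1\<close> curve in \<open>F\<close> such a seminorm changes at most at the
  rate \<open>p (Y')\<close>; an inequality \<open>p (G Y) \<le> C p Y + D\<close> therefore gives exponential bounds
  (\<open>controlled_Gronwall\<close>). Differentiability in \<open>F\<close> says nothing about \<open>t \<mapsto> Y t \<xi>\<close> at a
  single point \<open>\<xi>\<close>, and this argument does not ask for it. It remains to estimate \<open>G\<close> in suitable
  seminorms, on bounded subsets of \<open>F\<close>.

  The nonlocal terms are controlled by the convolution of \<open>exp (-\<bar>\<cdot>\<bar>)\<close> with the source
  \<open>(3 - 2\<gamma>)/2 U\<^sup>2 q + \<gamma>/2 h\<close>, because \<open>y\<close> differs from the identity by a bounded function.
  Young's inequality then makes \<open>P\<close> and \<open>Q\<close> bounded and square integrable, with bounds that depend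
  on the \<open>F\<close> norm alone. So \<open>G\<close> is bounded on bounded sets, and a solution needs a definite time
  to leave a ball: this yields a short existence time (\<open>short_time_exists\<close>).

  Both weighted spaces are instances of one: the weight \<open>\<rho>\<close> is \<open>exp (\<bar>\<xi>\<bar>/2)\<close> or
  \<open>(1 + \<bar>\<xi>\<bar>) powr (\<alpha>/2)\<close>, it multiplies \<open>U\<close> and \<open>w\<close>, and its square multiplies \<open>h\<close>. The property of
  \<open>\<rho>\<close> that matters is \<open>\<rho> x \<le> K \<rho> y exp (\<bar>x - y\<bar>/2)\<close>. It lets \<open>\<rho>\<close> pass through the
  convolution at the price of half the decay of the kernel (\<open>exp_conv_weighted\<close>), and it is
  inherited by the bounded truncations \<open>min \<rho> n\<close>.

  The estimates must be made in a certain order. Given \<open>U\<close>, \<open>P\<close>, \<open>Q\<close> as bounded coefficients,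
  \<open>(q, w, h)\<close> solves a linear system without nonlocal terms; the Gronwall inequality on every set
  of finite measure shows that \<open>q\<close>, \<open>w\<close>, \<open>h\<close> stay bounded (\<open>qwh_bounded\<close>). With \<open>q\<close> bounded, the
  source is linear in \<open>(U, h)\<close> with bounded coefficients, and the weighted \<open>L\<^sup>2\<close> norms of
  \<open>(U, w, h)\<close> satisfy a linear inequality (\<open>weighted_L2_propagation\<close>). The weighted \<open>L\<^sup>2\<close> norm of \<open>h\<close> is
  finite at time 0, since \<open>(\<rho> h)\<^sup>2 \<le> \<parallel>h\<parallel> \<rho>\<^sup>2 \<bar>h\<bar>\<close>. Finally \<open>\<rho>\<^sup>2 h\<close> grows in \<open>L\<^sup>1\<close> at a
  bounded rate, because every term of \<open>h\<^sub>t\<close> contains a product of two functions that lie in the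
  weighted \<open>L\<^sup>2\<close> space (\<open>weighted_L1_propagation\<close>).\<close>

section \<open>Lebesgue spaces and seminorms\<close>

lemma L2_measurable [measurable_dest]: "f \<in> L2 \<Longrightarrow> f \<in> borel_measurable borel"
  by (simp add: L2_def)

lemma Linf_measurable [measurable_dest]: "f \<in> Linf \<Longrightarrow> f \<in> borel_measurable borel"
  by (simp add: Linf_def)

lemma L1_norm_nonneg [simp]: "0 \<le> L1_norm f"
  by (simp add: L1_norm_def)

lemma L2_norm_nonneg [simp]: "0 \<le> L2_norm f"
  by (simp add: L2_norm_def)

lemma Linf_norm_nonneg [simp]: "0 \<le> Linf_norm f"
  by (simp add: Linf_norm_def)

lemma AE_le_Linf_norm:
  assumes "f \<in> Linf"
  shows "AE x in lborel. \<bar>f x\<bar> \<le> Linf_norm f"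
proof -
  have fin: "esssup lborel (\<lambda>\<xi>. ennreal \<bar>f \<xi>\<bar>) < \<infinity>" using assms by (simp add: Linf_def)
  have "AE x in lborel. ennreal \<bar>f x\<bar> \<le> esssup lborel (\<lambda>\<xi>. ennreal \<bar>f \<xi>\<bar>)"
    by (rule esssup_AE)
  then show ?thesis
  proof eventually_elim
    case (elim x)
    then have "enn2real (ennreal \<bar>f x\<bar>) \<le> Linf_norm f"
      unfolding Linf_norm_def using fin by (intro enn2real_mono) auto
    then show ?case by simp
  qed
qed

lemma Linf_boundI:
  assumes [measurable]: "f \<in> borel_measurable borel" and "AE x in lborel. \<bar>f x\<bar> \<le> c" and "0 \<le> c"
  shows "f \<in> Linf" "Linf_norm f \<le> c"
proof -
  have le: "esssup lborel (\<lambda>\<xi>. ennreal \<bar>f \<xi>\<bar>) \<le> ennreal c"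
    using assms(2) by (intro esssup_I) (auto intro: ennreal_leI elim!: eventually_mono)
  then show "f \<in> Linf" by (auto simp: Linf_def intro: le_less_trans)
  show "Linf_norm f \<le> c"
    unfolding Linf_norm_def using enn2real_mono[OF le] \<open>0 \<le> c\<close> by simp
qed

lemma L2_nn_integral:
  assumes "f \<in> L2"
  shows "(\<integral>\<^sup>+x. ennreal ((f x)\<^sup>2) \<partial>lborel) = ennreal ((L2_norm f)\<^sup>2)"
  using assms by (simp add: L2_def L2_norm_def nn_integral_eq_integral)

lemma L2_boundI:
  assumes "f \<in> borel_measurable borel" and "(\<integral>\<^sup>+x. ennreal ((f x)\<^sup>2) \<partial>lborel) \<le> ennreal (c\<^sup>2)" and "0 \<le> c"
  shows "f \<in> L2" "L2_norm f \<le> c"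
proof -
  have [measurable]: "f \<in> borel_measurable borel" by fact
  have int: "integrable lborel (\<lambda>x. (f x)\<^sup>2)"
    by (rule integrableI_nonneg) (use assms(2) in \<open>auto intro: le_less_trans\<close>)
  then show "f \<in> L2" by (simp add: L2_def)
  then have "ennreal ((L2_norm f)\<^sup>2) \<le> ennreal (c\<^sup>2)"
    using assms(2) by (simp add: L2_nn_integral)
  then show "L2_norm f \<le> c"
    using \<open>0 \<le> c\<close> by (simp add: ennreal_le_iff power2_le_iff_abs_le)
qed

lemma L1_boundI:
  assumes "f \<in> borel_measurable borel" and "(\<integral>\<^sup>+x. ennreal \<bar>f x\<bar> \<partial>lborel) \<le> ennreal c" and "0 \<le> c"
  shows "f \<in> L1" "L1_norm f \<le> c"
proof -
  have [measurable]: "f \<in> borel_measurable borel" by fact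
  have int: "integrable lborel f"
    unfolding integrable_iff_bounded using assms(2) by (auto intro: le_less_trans)
  then show "f \<in> L1" by (simp add: L1_def)
  have "ennreal (L1_norm f) \<le> ennreal c"
    unfolding L1_norm_def using assms(2) int by (simp add: nn_integral_eq_integral[symmetric])
  then show "L1_norm f \<le> c" using \<open>0 \<le> c\<close> by (simp add: ennreal_le_iff)
qed

lemma L2_Cauchy_Schwarz:
  assumes f: "f \<in> L2" and g: "g \<in> L2"
  shows "(\<lambda>x. f x * g x) \<in> L1" "L1_norm (\<lambda>x. f x * g x) \<le> L2_norm f * L2_norm g"
proof -
  note [measurable] = L2_measurable[OF f] L2_measurable[OF g]
  have "(\<integral>\<^sup>+x. ennreal \<bar>f x * g x\<bar> \<partial>lborel)\<^sup>2
      = (\<integral>\<^sup>+x. ennreal \<bar>f x\<bar> * ennreal \<bar>g x\<bar> \<partial>lborel)\<^sup>2"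
    by (simp add: abs_mult ennreal_mult)
  also have "\<dots> \<le> (\<integral>\<^sup>+x. ennreal \<bar>f x\<bar> ^ 2 \<partial>lborel) * (\<integral>\<^sup>+x. ennreal \<bar>g x\<bar> ^ 2 \<partial>lborel)"
    by (rule Cauchy_Schwarz_nn_integral) auto
  also have "\<dots> = (ennreal (L2_norm f * L2_norm g))\<^sup>2"
    by (simp add: ennreal_power L2_nn_integral[OF f] L2_nn_integral[OF g]
        ennreal_mult[symmetric] power_mult_distrib)
  finally have sq: "(\<integral>\<^sup>+x. ennreal \<bar>f x * g x\<bar> \<partial>lborel)\<^sup>2 \<le> (ennreal (L2_norm f * L2_norm g))\<^sup>2" .
  have "(\<integral>\<^sup>+x. ennreal \<bar>f x * g x\<bar> \<partial>lborel) \<le> ennreal (L2_norm f * L2_norm g)"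
  proof (cases "\<integral>\<^sup>+x. ennreal \<bar>f x * g x\<bar> \<partial>lborel")
    case (real r)
    with sq have "r\<^sup>2 \<le> (L2_norm f * L2_norm g)\<^sup>2" by (simp add: ennreal_power)
    then show ?thesis using real by (auto intro!: ennreal_leI intro: power2_le_imp_le)
  next
    case top
    with sq show ?thesis by (simp add: power2_eq_square top_unique ennreal_mult_eq_top_iff)
  qed
  then show "(\<lambda>x. f x * g x) \<in> L1" "L1_norm (\<lambda>x. f x * g x) \<le> L2_norm f * L2_norm g"
    by (auto intro!: L1_boundI)
qed

lemma L2_add:
  assumes f: "f \<in> L2" and g: "g \<in> L2"
  shows "(\<lambda>x. f x + g x) \<in> L2" "L2_norm (\<lambda>x. f x + g x) \<le> L2_norm f + L2_norm g"
proof -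
  note [measurable] = L2_measurable[OF f] L2_measurable[OF g]
  have If: "integrable lborel (\<lambda>x. (f x)\<^sup>2)" and Ig: "integrable lborel (\<lambda>x. (g x)\<^sup>2)"
    using f g by (auto simp: L2_def)
  have Ifg: "integrable lborel (\<lambda>x. f x * g x)"
    using L2_Cauchy_Schwarz(1)[OF f g] by (simp add: L1_def)
  have eq: "(\<lambda>x. (f x + g x)\<^sup>2) = (\<lambda>x. (f x)\<^sup>2 + 2 * (f x * g x) + (g x)\<^sup>2)"
    by (auto simp: power2_sum fun_eq_iff)
  have int: "integrable lborel (\<lambda>x. (f x + g x)\<^sup>2)"
    unfolding eq using If Ig Ifg by auto
  then show "(\<lambda>x. f x + g x) \<in> L2" by (simp add: L2_def)
  have "(LINT x|lborel. f x * g x) \<le> L1_norm (\<lambda>x. f x * g x)"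
    unfolding L1_norm_def using Ifg by (intro integral_mono) auto
  also have "\<dots> \<le> L2_norm f * L2_norm g" by (rule L2_Cauchy_Schwarz(2)[OF f g])
  finally have "(LINT x|lborel. (f x + g x)\<^sup>2) \<le> (L2_norm f + L2_norm g)\<^sup>2"
    unfolding eq using If Ig Ifg by (simp add: power2_sum) (simp add: L2_norm_def)
  then show "L2_norm (\<lambda>x. f x + g x) \<le> L2_norm f + L2_norm g"
    by (simp add: L2_norm_def real_le_lsqrt)
qed

lemma L2_scale:
  assumes f: "f \<in> L2"
  shows "(\<lambda>x. c * f x) \<in> L2" "L2_norm (\<lambda>x. c * f x) = \<bar>c\<bar> * L2_norm f"
  using assms by (auto simp: L2_def L2_norm_def power_mult_distrib real_sqrt_mult)

lemma L2_dominated: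
  assumes f: "f \<in> L2" and g: "g \<in> borel_measurable borel" and le: "AE x in lborel. \<bar>g x\<bar> \<le> \<bar>f x\<bar>"
  shows "g \<in> L2" "L2_norm g \<le> L2_norm f"
proof -
  have "(\<integral>\<^sup>+x. ennreal ((g x)\<^sup>2) \<partial>lborel) \<le> (\<integral>\<^sup>+x. ennreal ((f x)\<^sup>2) \<partial>lborel)"
    using le by (intro nn_integral_mono_AE) (auto simp: abs_le_square_iff elim!: eventually_mono)
  then have "(\<integral>\<^sup>+x. ennreal ((g x)\<^sup>2) \<partial>lborel) \<le> ennreal ((L2_norm f)\<^sup>2)"
    by (simp add: L2_nn_integral[OF f])
  with L2_boundI[OF g] show "g \<in> L2" "L2_norm g \<le> L2_norm f" by auto
qed

lemma L2_abs:
  assumes "f \<in> L2" shows "(\<lambda>x. \<bar>f x\<bar>) \<in> L2" "L2_norm (\<lambda>x. \<bar>f x\<bar>) = L2_norm f"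
  using assms by (auto simp: L2_def L2_norm_def)

text \<open>Three terms suffice for every rate of change below; for shorter sums a coefficient is 0.\<close>

lemma L2_dominated_sum:
  assumes f: "f1 \<in> L2" "f2 \<in> L2" "f3 \<in> L2"
    and g: "g \<in> borel_measurable borel"
    and le: "AE x in lborel. \<bar>g x\<bar> \<le> a * \<bar>f1 x\<bar> + b * \<bar>f2 x\<bar> + c * \<bar>f3 x\<bar>"
    and pos: "0 \<le> a" "0 \<le> b" "0 \<le> c"
  shows "g \<in> L2" "L2_norm g \<le> a * L2_norm f1 + b * L2_norm f2 + c * L2_norm f3"
proof -
  have s: "(\<lambda>x. d * \<bar>f x\<bar>) \<in> L2" "L2_norm (\<lambda>x. d * \<bar>f x\<bar>) = d * L2_norm f" if "f \<in> L2" "0 \<le> d" for f d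
    using L2_scale[OF L2_abs(1), of f d] L2_abs(2)[of f] that by auto
  let ?F = "\<lambda>x. a * \<bar>f1 x\<bar> + b * \<bar>f2 x\<bar> + c * \<bar>f3 x\<bar>"
  have F: "?F \<in> L2" using f pos by (intro L2_add s)
  have "L2_norm ?F \<le> L2_norm (\<lambda>x. a * \<bar>f1 x\<bar> + b * \<bar>f2 x\<bar>) + L2_norm (\<lambda>x. c * \<bar>f3 x\<bar>)"
    using f pos by (intro L2_add s)
  also have "L2_norm (\<lambda>x. a * \<bar>f1 x\<bar> + b * \<bar>f2 x\<bar>) \<le> L2_norm (\<lambda>x. a * \<bar>f1 x\<bar>) + L2_norm (\<lambda>x. b * \<bar>f2 x\<bar>)"
    using f pos by (intro L2_add s)
  finally have F_le: "L2_norm ?F \<le> a * L2_norm f1 + b * L2_norm f2 + c * L2_norm f3"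
    using s f pos by simp
  have "AE x in lborel. \<bar>g x\<bar> \<le> \<bar>?F x\<bar>" using le pos by auto
  note dom = L2_dominated[OF F g this]
  show "g \<in> L2" by (rule dom)
  show "L2_norm g \<le> a * L2_norm f1 + b * L2_norm f2 + c * L2_norm f3"
    using dom(2) F_le by linarith
qed

text \<open>The estimates use many seminorms of one real function: plain, weighted or localised. What the
  Gronwall argument needs from them is collected here once.\<close>

locale function_seminorm =
  fixes V :: "(real \<Rightarrow> real) set" and p :: "(real \<Rightarrow> real) \<Rightarrow> real"
  assumes add_mem: "f \<in> V \<Longrightarrow> g \<in> V \<Longrightarrow> (\<lambda>x. f x + g x) \<in> V"
    and scale_mem: "f \<in> V \<Longrightarrow> (\<lambda>x. c * f x) \<in> V"
    and triangle: "f \<in> V \<Longrightarrow> g \<in> V \<Longrightarrow> p (\<lambda>x. f x + g x) \<le> p f + p g"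
    and homogeneous: "f \<in> V \<Longrightarrow> p (\<lambda>x. c * f x) = \<bar>c\<bar> * p f"
begin

lemma diff_mem: "f \<in> V \<Longrightarrow> g \<in> V \<Longrightarrow> (\<lambda>x. f x - g x) \<in> V"
  using add_mem[of f "\<lambda>x. -1 * g x"] scale_mem[of g "-1"] by simp

text \<open>The step \<open>f - g\<close> is written as \<open>c (z + e)\<close>, where \<open>z\<close> is a candidate derivative and \<open>e\<close> the
  error of the difference quotient.\<close>

lemma increment_le:
  assumes f: "f \<in> V" and g: "g \<in> V" and z: "z \<in> V" and c: "c \<noteq> 0"
  shows "\<bar>p f - p g\<bar> \<le> \<bar>c\<bar> * (p z + p (\<lambda>x. 1 / c * (f x - g x) - z x))"
proof -
  let ?e = "\<lambda>x. 1 / c * (f x - g x) - z x"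
  have e: "?e \<in> V" using f g z by (intro diff_mem scale_mem)
  have D: "p (\<lambda>x. d * (z x + ?e x)) \<le> \<bar>d\<bar> * (p z + p ?e)" "(\<lambda>x. d * (z x + ?e x)) \<in> V" for d
    using triangle[OF z e] homogeneous[OF add_mem[OF z e], of d] scale_mem[OF add_mem[OF z e]]
    by (auto intro: mult_left_mono)
  have "f = (\<lambda>x. g x + c * (z x + ?e x))" "g = (\<lambda>x. f x + (- c) * (z x + ?e x))"
    using c by (auto simp: fun_eq_iff field_simps)
  then have "p f \<le> p g + p (\<lambda>x. c * (z x + ?e x))" "p g \<le> p f + p (\<lambda>x. (- c) * (z x + ?e x))"
    using triangle[OF g D(2)[of c]] triangle[OF f D(2)[of "-c"]] by (metis (no_types, lifting))+
  moreover have "p (\<lambda>x. c * (z x + ?e x)) \<le> \<bar>c\<bar> * (p z + p ?e)"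
    "p (\<lambda>x. (- c) * (z x + ?e x)) \<le> \<bar>c\<bar> * (p z + p ?e)"
    using D(1)[of c] D(1)[of "-c"] by simp_all
  ultimately show ?thesis unfolding abs_le_iff by (smt (verit))
qed

end

lemma L2_weighted_seminorm:
  "function_seminorm {f. (\<lambda>x. \<phi> x * f x) \<in> L2} (\<lambda>f. L2_norm (\<lambda>x. \<phi> x * f x))"
proof
  fix f g :: "real \<Rightarrow> real" and c :: real
  assume f: "f \<in> {f. (\<lambda>x. \<phi> x * f x) \<in> L2}"
  have eq: "(\<lambda>x. \<phi> x * (c * f x)) = (\<lambda>x. c * (\<phi> x * f x))" by auto
  show "(\<lambda>x. c * f x) \<in> {f. (\<lambda>x. \<phi> x * f x) \<in> L2}"
    "L2_norm (\<lambda>x. \<phi> x * (c * f x)) = \<bar>c\<bar> * L2_norm (\<lambda>x. \<phi> x * f x)"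
    using f L2_scale[of "\<lambda>x. \<phi> x * f x" c] unfolding mem_Collect_eq eq by auto
  assume g: "g \<in> {f. (\<lambda>x. \<phi> x * f x) \<in> L2}"
  show "(\<lambda>x. f x + g x) \<in> {f. (\<lambda>x. \<phi> x * f x) \<in> L2}"
    "L2_norm (\<lambda>x. \<phi> x * (f x + g x)) \<le> L2_norm (\<lambda>x. \<phi> x * f x) + L2_norm (\<lambda>x. \<phi> x * g x)"
    using f g L2_add[of "\<lambda>x. \<phi> x * f x" "\<lambda>x. \<phi> x * g x"] by (auto simp: distrib_left)
qed

lemma L2_seminorm: "function_seminorm L2 L2_norm"
  using L2_weighted_seminorm[of "\<lambda>_. 1"] by simp

lemma L1_weighted_seminorm:
  assumes "\<phi> \<in> L2"
  shows "function_seminorm L2 (\<lambda>f. L1_norm (\<lambda>x. \<phi> x * f x))"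
proof -
  interpret function_seminorm L2 L2_norm by (rule L2_seminorm)
  show ?thesis
  proof (rule function_seminorm.intro)
    fix f g :: "real \<Rightarrow> real" and c :: real
    assume f: "f \<in> L2"
    show "(\<lambda>x. c * f x) \<in> L2" using f by (rule scale_mem)
    show "L1_norm (\<lambda>x. \<phi> x * (c * f x)) = \<bar>c\<bar> * L1_norm (\<lambda>x. \<phi> x * f x)"
      by (simp add: L1_norm_def abs_mult mult.left_commute)
    assume g: "g \<in> L2"
    show "(\<lambda>x. f x + g x) \<in> L2" using f g by (rule add_mem)
    have "integrable lborel (\<lambda>x. \<phi> x * f x)" "integrable lborel (\<lambda>x. \<phi> x * g x)"
      using L2_Cauchy_Schwarz(1)[OF assms] f g by (auto simp: L1_def)
    then show "L1_norm (\<lambda>x. \<phi> x * (f x + g x)) \<le> L1_norm (\<lambda>x. \<phi> x * f x) + L1_norm (\<lambda>x. \<phi> x * g x)"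
      unfolding L1_norm_def
      by (subst Bochner_Integration.integral_add[symmetric])
         (auto intro!: integral_mono simp: distrib_left simp del: Bochner_Integration.integral_add)
  qed
qed

lemma Linf_seminorm: "function_seminorm Linf Linf_norm"
proof
  fix f g :: "real \<Rightarrow> real" and c :: real
  assume f: "f \<in> Linf"
  note [measurable] = Linf_measurable[OF f]
  have scale: "(\<lambda>x. c * f x) \<in> Linf" "Linf_norm (\<lambda>x. c * f x) \<le> \<bar>c\<bar> * Linf_norm f" if f: "f \<in> Linf" for f c
    using AE_le_Linf_norm[OF f] Linf_measurable[OF f]
    by (auto intro!: Linf_boundI[where c = "\<bar>c\<bar> * Linf_norm f"] simp: abs_mult mult_left_mono elim!: eventually_mono)
  show "(\<lambda>x. c * f x) \<in> Linf" by (rule scale[OF f])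
  show "Linf_norm (\<lambda>x. c * f x) = \<bar>c\<bar> * Linf_norm f"
  proof (cases "c = 0")
    case True
    then show ?thesis using scale(2)[OF f, of c] by (intro antisym) simp_all
  next
    case False
    have "Linf_norm f \<le> \<bar>1 / c\<bar> * Linf_norm (\<lambda>x. c * f x)"
      using scale(2)[OF scale(1)[OF f, of c], of "1 / c"] False by simp
    then show ?thesis using scale(2)[OF f, of c] False by (simp add: field_simps)
  qed
  assume g: "g \<in> Linf"
  note [measurable] = Linf_measurable[OF g]
  have "AE x in lborel. \<bar>f x + g x\<bar> \<le> Linf_norm f + Linf_norm g"
    using AE_le_Linf_norm[OF f] AE_le_Linf_norm[OF g] by eventually_elim auto
  then show "(\<lambda>x. f x + g x) \<in> Linf" "Linf_norm (\<lambda>x. f x + g x) \<le> Linf_norm f + Linf_norm g"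
    by (auto intro!: Linf_boundI)
qed

section \<open>A Gronwall inequality for seminorms along curves\<close>

text \<open>At the last time \<open>s\<close> before \<open>t\<close> at which \<open>N \<le> b\<close>, the hypothesis \<open>push\<close> would extend the
  inequality a little further to the right, against the choice of \<open>s\<close>.\<close>

lemma barrier:
  fixes N b :: "real \<Rightarrow> real"
  assumes N: "continuous_on {0..T} N" and b: "continuous_on {0..T} b"
    and start: "N 0 \<le> b 0"
    and push: "\<And>t. 0 \<le> t \<Longrightarrow> t < T \<Longrightarrow> N t \<le> b t \<Longrightarrow> eventually (\<lambda>s. N s \<le> b s) (at_right t)"
    and t: "t \<in> {0..T}"
  shows "N t \<le> b t"
proof (rule ccontr)
  assume above: "\<not> N t \<le> b t"
  let ?S = "{s \<in> {0..t}. N s - b s \<in> {..0}}"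
  have "compact ?S"
  proof -
    have "continuous_on {0..t} (\<lambda>s. N s - b s)"
      using N b t by (auto intro!: continuous_on_diff intro: continuous_on_subset)
    then have "closed ({0..t} \<inter> (\<lambda>s. N s - b s) -` {..0})"
      by (intro continuous_closed_preimage) auto
    moreover have "{0..t} \<inter> (\<lambda>s. N s - b s) -` {..0} = {0..t} \<inter> ?S" by auto
    ultimately have "compact ({0..t} \<inter> ?S)"
      by (metis compact_Icc compact_Int_closed inf.left_idem)
    moreover have "{0..t} \<inter> ?S = ?S" by auto
    ultimately show ?thesis by simp
  qed
  moreover have "0 \<in> ?S" using start t by auto
  ultimately obtain s where s: "s \<in> ?S" "\<And>r. r \<in> ?S \<Longrightarrow> r \<le> s"
    using compact_attains_sup[of ?S] by auto
  then have "s < t" using above by (auto simp: order.order_iff_strict)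
  with s t push[of s] have "eventually (\<lambda>r. N r \<le> b r) (at_right s)" by auto
  moreover have "eventually (\<lambda>r. r \<in> {s<..<t}) (at_right s)"
    using \<open>s < t\<close> by (rule eventually_at_right_real)
  ultimately have "eventually (\<lambda>r. N r \<le> b r \<and> r \<in> {s<..<t}) (at_right s)" by eventually_elim auto
  then obtain r where "N r \<le> b r" "s < r" "r < t"
    using eventually_happens[of _ "at_right s"] by (auto simp: trivial_limit_at_right_real)
  with s(1) s(2)[of r] show False by simp
qed

text \<open>\<open>N\<close> need not be a seminorm of the state: a norm of \<open>q = 1 + v\<close> is a seminorm of an affine
  function of the state, and then \<open>p\<close> is the seminorm of its linear part. The constant \<open>L\<close> weighs the error of the difference
  quotient, which tends to 0 in \<open>F\<close> along a differentiable curve.\<close>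

definition controlled :: "(state \<Rightarrow> real) \<Rightarrow> (state \<Rightarrow> real) \<Rightarrow> real \<Rightarrow> bool" where
  "controlled N p L \<longleftrightarrow> (\<forall>X\<in>F. \<forall>Y\<in>F. \<forall>Z\<in>F. \<forall>c. c \<noteq> 0 \<longrightarrow>
     \<bar>N X - N Y\<bar> \<le> \<bar>c\<bar> * (p Z + L * F_norm (F_minus (F_scale (1 / c) (F_minus X Y)) Z)))"

lemma controlledD:
  assumes "controlled N p L" "X \<in> F" "Y \<in> F" "Z \<in> F" "c \<noteq> 0"
  shows "\<bar>N X - N Y\<bar> \<le> \<bar>c\<bar> * (p Z + L * F_norm (F_minus (F_scale (1 / c) (F_minus X Y)) Z))"
  using assms unfolding controlled_def by blast

lemma controlled_add:
  assumes "controlled N p L" "controlled N' p' L'"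
  shows "controlled (\<lambda>Y. N Y + N' Y) (\<lambda>Y. p Y + p' Y) (L + L')"
  unfolding controlled_def
proof (intro ballI allI impI)
  fix X Y Z and c :: real
  assume "X \<in> F" "Y \<in> F" "Z \<in> F" "c \<noteq> 0"
  note bounds = controlledD[OF assms(1) this] controlledD[OF assms(2) this]
  have "\<bar>N X + N' X - (N Y + N' Y)\<bar> \<le> \<bar>N X - N Y\<bar> + \<bar>N' X - N' Y\<bar>" by linarith
  also note add_mono[OF bounds]
  finally show "\<bar>N X + N' X - (N Y + N' Y)\<bar> \<le> \<bar>c\<bar> * (p Z + p' Z +
      (L + L') * F_norm (F_minus (F_scale (1 / c) (F_minus X Y)) Z))"
    by (simp add: algebra_simps)
qed

text \<open>The Dini derivatives of \<open>N \<circ> Y\<close> are bounded by \<open>p (Y')\<close>. The later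
  estimates use differentiability only through this bound.\<close>

lemma controlled_increment_bound:
  assumes sol: "C1_F T Y Y'" and N: "controlled N p L" and L: "0 \<le> L" and t: "t \<in> {0..T}" and e: "0 < e"
  shows "eventually (\<lambda>s. \<bar>N (Y s) - N (Y t)\<bar> \<le> \<bar>s - t\<bar> * (p (Y' t) + e)) (at t within {0..T})"
proof -
  let ?D = "\<lambda>s. F_norm (F_minus (F_scale (1 / (s - t)) (F_minus (Y s) (Y t))) (Y' t))"
  have mem: "\<And>s. s \<in> {0..T} \<Longrightarrow> Y s \<in> F" "Y' t \<in> F" and lim: "(?D \<longlongrightarrow> 0) (at t within {0..T})"
    using sol t unfolding C1_F_def by auto
  have "((\<lambda>s. L * ?D s) \<longlongrightarrow> L * 0) (at t within {0..T})" by (intro tendsto_intros lim)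
  then have "eventually (\<lambda>s. L * ?D s < e) (at t within {0..T})" using e by (auto dest: order_tendstoD)
  moreover have "eventually (\<lambda>s. s \<in> {0..T} \<and> s \<noteq> t) (at t within {0..T})"
    by (auto simp: eventually_at_filter)
  ultimately show ?thesis
  proof eventually_elim
    case (elim s)
    have "\<bar>N (Y s) - N (Y t)\<bar> \<le> \<bar>s - t\<bar> * (p (Y' t) + L * ?D s)"
      by (rule controlledD[OF N]) (use elim mem t in auto)
    also have "\<dots> \<le> \<bar>s - t\<bar> * (p (Y' t) + e)" using elim by (intro mult_left_mono) auto
    finally show ?case .
  qed
qed

lemma controlled_continuous:
  assumes sol: "C1_F T Y Y'" and N: "controlled N p L" and L: "0 \<le> L"
  shows "continuous_on {0..T} (\<lambda>t. N (Y t))"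
  unfolding continuous_on_def
proof
  fix t assume t: "t \<in> {0..T}"
  have "((\<lambda>s. \<bar>s - t\<bar> * (p (Y' t) + 1)) \<longlongrightarrow> \<bar>t - t\<bar> * (p (Y' t) + 1)) (at t within {0..T})"
    by (intro tendsto_intros)
  then have "((\<lambda>s. \<bar>s - t\<bar> * (p (Y' t) + 1)) \<longlongrightarrow> 0) (at t within {0..T})" by simp
  moreover have "eventually (\<lambda>s. norm (N (Y s) - N (Y t)) \<le> \<bar>s - t\<bar> * (p (Y' t) + 1)) (at t within {0..T})"
    using controlled_increment_bound[OF sol N L t zero_less_one] unfolding real_norm_def .
  ultimately have "((\<lambda>s. N (Y s) - N (Y t)) \<longlongrightarrow> 0) (at t within {0..T})"
    by (rule Lim_null_comparison[rotated])
  then show "((\<lambda>s. N (Y s)) \<longlongrightarrow> N (Y t)) (at t within {0..T})" by (rule LIM_zero_cancel)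
qed

text \<open>A function \<open>b\<close> that grows strictly faster than \<open>N \<circ> Y\<close> whenever it lies on or above it cannot be crossed.\<close>

lemma controlled_barrier:
  assumes sol: "C1_F T Y Y'" and N: "controlled N p L" and L: "0 \<le> L"
    and b: "\<And>t. (b has_real_derivative b' t) (at t)"
    and start: "N (Y 0) \<le> b 0"
    and rate: "\<And>t. t \<in> {0..T} \<Longrightarrow> N (Y t) \<le> b t \<Longrightarrow> p (Y' t) < b' t"
    and t: "t \<in> {0..T}"
  shows "N (Y t) \<le> b t"
proof (rule barrier[where N = "\<lambda>t. N (Y t)", OF controlled_continuous[OF sol N L] _ _ _ t])
  show "N (Y 0) \<le> b 0" by (rule start)
  show "continuous_on {0..T} b"
    using b by (intro continuous_at_imp_continuous_on ballI) (rule DERIV_isCont)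
  fix t assume t: "0 \<le> t" "t < T" and le: "N (Y t) \<le> b t"
  \<comment> \<open>the gap between the two slopes is shared between \<open>N \<circ> Y\<close> and \<open>b\<close>\<close>
  define e where "e = (b' t - p (Y' t)) / 2"
  have e: "0 < e" using rate[of t] t le by (auto simp: e_def)
  have "at_right t = at t within {t..T}"
    using t by (simp add: at_within_Icc_at_right)
  also have "\<dots> \<le> at t within {0..T}" using t by (intro at_le) auto
  finally have filter: "at_right t \<le> at t within {0..T}" .
  have "eventually (\<lambda>s. \<bar>N (Y s) - N (Y t)\<bar> \<le> \<bar>s - t\<bar> * (p (Y' t) + e)) (at_right t)"
    using controlled_increment_bound[OF sol N L _ e, of t] t filter by (auto simp: filter_leD)
  moreover have "eventually (\<lambda>s. b t + (s - t) * (b' t - e) \<le> b s) (at_right t)"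
  proof -
    have "((\<lambda>s. (b s - b t) / (s - t)) \<longlongrightarrow> b' t) (at_right t)"
      using b[of t] by (auto simp: has_field_derivative_iff intro: tendsto_mono[rotated] at_le)
    then have "eventually (\<lambda>s. b' t - e < (b s - b t) / (s - t)) (at_right t)"
      by (rule order_tendstoD) (use e in simp)
    then show ?thesis
      using eventually_at_right_less[of t] by eventually_elim (simp add: field_simps)
  qed
  ultimately show "eventually (\<lambda>s. N (Y s) \<le> b s) (at_right t)"
    using eventually_at_right_less[of t]
  proof eventually_elim
    case (elim s)
    moreover have "p (Y' t) + e = b' t - e" by (simp add: e_def field_simps)
    ultimately have "N (Y s) - N (Y t) \<le> (s - t) * (b' t - e)" by auto
    then show ?case using elim le by linarith
  qed
qed

text \<open>The comparison function \<open>(N (Y 0) + D t + d (1 + t)) exp (C t)\<close> grows strictly faster than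
  the rate bound allows, for each \<open>d > 0\<close>; then \<open>d\<close> tends to 0.\<close>

lemma controlled_Gronwall:
  assumes sol: "C1_F T Y Y'" and N: "controlled N p L" and L: "0 \<le> L"
    and C: "0 \<le> C" and D: "0 \<le> D"
    and rate: "\<And>t. t \<in> {0..T} \<Longrightarrow> p (Y' t) \<le> C * N (Y t) + D"
    and t: "t \<in> {0..T}"
  shows "N (Y t) \<le> (N (Y 0) + D * t) * exp (C * t)"
proof (rule field_le_epsilon)
  fix \<epsilon> :: real assume "0 < \<epsilon>"
  define d where "d = \<epsilon> / ((1 + t) * exp (C * t))"
  have t0: "0 \<le> t" using t by auto
  have d: "0 < d" using \<open>0 < \<epsilon>\<close> t0 by (auto simp: d_def)
  let ?b = "\<lambda>t. (N (Y 0) + D * t + d * (1 + t)) * exp (C * t)"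
  have "N (Y t) \<le> ?b t"
  proof (rule controlled_barrier[OF sol N L _ _ _ t])
    show "(?b has_real_derivative C * ?b t + (D + d) * exp (C * t)) (at t)" for t
      by (auto intro!: derivative_eq_intros simp: algebra_simps)
    show "N (Y 0) \<le> ?b 0" using d by simp
    fix t assume t: "t \<in> {0..T}" and le: "N (Y t) \<le> ?b t"
    have "C * N (Y t) \<le> C * ?b t" using le C by (rule mult_left_mono)
    moreover have "1 \<le> exp (C * t)" using C t by simp
    then have "D + d \<le> (D + d) * exp (C * t)" using D d by simp
    ultimately show "p (Y' t) < C * ?b t + (D + d) * exp (C * t)"
      using rate[OF t] d by linarith
  qed
  also have "?b t = (N (Y 0) + D * t) * exp (C * t) + d * ((1 + t) * exp (C * t))"
    by (simp add: algebra_simps)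
  also have "d * ((1 + t) * exp (C * t)) = \<epsilon>"
    using t0 by (simp add: d_def)
  finally show "N (Y t) \<le> (N (Y 0) + D * t) * exp (C * t) + \<epsilon>" .
qed

section \<open>Seminorms of components of the state\<close>

lemma F_memD:
  assumes "Y \<in> F"
  shows "zeta_of Y \<in> Linf" "U_of Y \<in> Linf" "U_of Y \<in> L2" "H_of Y \<in> Linf"
    "v_of Y \<in> L2" "w_of Y \<in> L2" "h_of Y \<in> L2"
  using assms by (auto simp: F_def)

lemma F_norm_bounds:
  shows "0 \<le> F_norm Y" "Linf_norm (zeta_of Y) \<le> F_norm Y" "L2_norm (U_of Y) \<le> F_norm Y"
    "Linf_norm (U_of Y) \<le> F_norm Y" "Linf_norm (H_of Y) \<le> F_norm Y" "L2_norm (v_of Y) \<le> F_norm Y"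
    "L2_norm (w_of Y) \<le> F_norm Y" "L2_norm (h_of Y) \<le> F_norm Y"
  using Linf_norm_nonneg[of "zeta_of Y"] L2_norm_nonneg[of "U_of Y"] Linf_norm_nonneg[of "U_of Y"]
    Linf_norm_nonneg[of "H_of Y"] L2_norm_nonneg[of "v_of Y"] L2_norm_nonneg[of "w_of Y"]
    L2_norm_nonneg[of "h_of Y"]
  unfolding F_norm_def by linarith+

lemma controlled_F_norm: "controlled F_norm F_norm 1"
  unfolding controlled_def
proof (intro ballI allI impI)
  fix X Y Z and c :: real
  assume F: "X \<in> F" "Y \<in> F" "Z \<in> F" "c \<noteq> 0"
  note mem = F_memD[OF F(1)] F_memD[OF F(2)] F_memD[OF F(3)]
  note i = Linf_seminorm[THEN function_seminorm.increment_le, OF _ _ _ \<open>c \<noteq> 0\<close>]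
    and l = L2_seminorm[THEN function_seminorm.increment_le, OF _ _ _ \<open>c \<noteq> 0\<close>]
  have sum: "\<bar>(a + a') - (b + b')\<bar> \<le> d * ((z + z') + (e + e'))"
    if "\<bar>a - b\<bar> \<le> d * (z + e)" "\<bar>a' - b'\<bar> \<le> d * (z' + e')" for a a' b b' z z' e e' d :: real
    using that unfolding distrib_left by linarith
  show "\<bar>F_norm X - F_norm Y\<bar> \<le> \<bar>c\<bar> * (F_norm Z + 1 * F_norm (F_minus (F_scale (1 / c) (F_minus X Y)) Z))"
    unfolding F_norm_def F_minus_def F_scale_def state.simps mult_1
    by (intro sum i l mem)
qed

text \<open>Two maps occur because of \<open>q = 1 + v\<close>: the values are those of \<open>q\<close>, which is not square
  integrable on the line, and the increments are those of \<open>v\<close>.\<close>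

lemma controlled_component:
  assumes semi: "function_seminorm V p"
    and mem: "\<And>X. X \<in> F \<Longrightarrow> x X \<in> V" "\<And>X. X \<in> F \<Longrightarrow> x' X \<in> V"
    and diff: "\<And>X Y Z c. (\<lambda>\<xi>. c * (x X \<xi> - x Y \<xi>) - x' Z \<xi>) = x' (F_minus (F_scale c (F_minus X Y)) Z)"
    and dom: "\<And>X. X \<in> F \<Longrightarrow> p (x' X) \<le> L * F_norm X"
  shows "controlled (\<lambda>Y. p (x Y)) (\<lambda>Y. p (x' Y)) L"
  unfolding controlled_def
proof (intro ballI allI impI)
  fix X Y Z and c :: real
  assume F: "X \<in> F" "Y \<in> F" "Z \<in> F" and c: "c \<noteq> 0"
  let ?D = "F_minus (F_scale (1 / c) (F_minus X Y)) Z"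
  interpret i: function_seminorm Linf Linf_norm by (rule Linf_seminorm)
  interpret l: function_seminorm L2 L2_norm by (rule L2_seminorm)
  have D: "?D \<in> F"
    unfolding F_def F_minus_def F_scale_def mem_Collect_eq state.simps Int_iff
    by (intro conjI i.diff_mem i.scale_mem l.diff_mem l.scale_mem
        F_memD[OF F(1)] F_memD[OF F(2)] F_memD[OF F(3)])
  have "\<bar>p (x X) - p (x Y)\<bar> \<le> \<bar>c\<bar> * (p (x' Z) + p (x' ?D))"
    using function_seminorm.increment_le[OF semi mem(1)[OF F(1)] mem(1)[OF F(2)] mem(2)[OF F(3)] c]
    unfolding diff .
  also have "\<dots> \<le> \<bar>c\<bar> * (p (x' Z) + L * F_norm ?D)"
    using dom[OF D] by (intro mult_left_mono) auto
  finally show "\<bar>p (x X) - p (x Y)\<bar> \<le> \<bar>c\<bar> * (p (x' Z) + L * F_norm ?D)" .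
qed

section \<open>The nonlocal terms\<close>

definition source :: "real \<Rightarrow> state \<Rightarrow> real \<Rightarrow> real" where
  "source \<gamma> Y \<eta> = (3 - 2 * \<gamma>) / 2 * (U_of Y \<eta>)\<^sup>2 * q_of Y \<eta> + \<gamma> / 2 * h_of Y \<eta>"

definition exp_conv :: "(real \<Rightarrow> real) \<Rightarrow> real \<Rightarrow> real" where
  "exp_conv g \<xi> = (LINT \<eta>|lborel. exp (- \<bar>\<xi> - \<eta>\<bar>) * \<bar>g \<eta>\<bar>)"

lemma nn_integral_exp_abs:
  assumes "0 < a"
  shows "(\<integral>\<^sup>+\<eta>. ennreal (exp (- a * \<bar>\<xi> - \<eta>\<bar>)) \<partial>lborel) = ennreal (2 / a)"
proof -
  have half: "(\<integral>\<^sup>+x. ennreal (exp (- a * x)) * indicator {0..} x \<partial>lborel) = ennreal (1 / a)"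
  proof -
    have "((\<lambda>x. exp (- a * x)) \<longlongrightarrow> 0) at_top"
      using assms by real_asymp
    then have lim: "((\<lambda>x. - exp (- a * x) / a) \<longlongrightarrow> - 0 / a) at_top"
      by (intro tendsto_intros) (use assms in auto)
    have "(\<integral>\<^sup>+x. ennreal (exp (- a * x)) * indicator {0..} x \<partial>lborel) = ennreal (- 0 / a - (- exp (- a * 0) / a))"
      by (rule nn_integral_FTC_atLeast[OF _ _ _ lim])
         (use assms in \<open>auto intro!: derivative_eq_intros\<close>)
    then show ?thesis by simp
  qed
  \<comment> \<open>the negative half-line, by reflection\<close>
  have refl: "(\<integral>\<^sup>+x. ennreal (exp (a * x)) * indicator {..0} x \<partial>lborel) = ennreal (1 / a)"
    using half by (subst nn_integral_real_affine[where c = "-1" and t = 0]) (auto simp: indicator_def)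
  have "(\<integral>\<^sup>+\<eta>. ennreal (exp (- a * \<bar>\<xi> - \<eta>\<bar>)) \<partial>lborel) = (\<integral>\<^sup>+x. ennreal (exp (- a * \<bar>x\<bar>)) \<partial>lborel)"
    by (subst nn_integral_real_affine[where c = "-1" and t = \<xi>]) auto
  also have "\<dots> = (\<integral>\<^sup>+x. ennreal (exp (- a * x)) * indicator {0..} x + ennreal (exp (a * x)) * indicator {..0} x \<partial>lborel)"
    by (intro nn_integral_cong_AE AE_I[where N = "{0}"]) (auto simp: indicator_def)
  also have "\<dots> = ennreal (1 / a) + ennreal (1 / a)"
    by (subst nn_integral_add) (simp_all only: half refl, auto)
  also have "\<dots> = ennreal (2 / a)" using assms by (simp add: ennreal_plus[symmetric] del: ennreal_plus)
  finally show ?thesis .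
qed

lemma exp_conv_bound:
  assumes g: "g \<in> L2"
  shows "integrable lborel (\<lambda>\<eta>. exp (- \<bar>\<xi> - \<eta>\<bar>) * \<bar>g \<eta>\<bar>)" "exp_conv g \<xi> \<le> L2_norm g"
proof -
  have [measurable]: "g \<in> borel_measurable borel" using g by (rule L2_measurable)
  have "(\<integral>\<^sup>+\<eta>. ennreal ((exp (- \<bar>\<xi> - \<eta>\<bar>))\<^sup>2) \<partial>lborel) = ennreal (2 / 2)"
    by (subst nn_integral_exp_abs[of 2 \<xi>, symmetric]) (auto simp: exp_double[symmetric])
  then have k: "(\<lambda>\<eta>. exp (- \<bar>\<xi> - \<eta>\<bar>)) \<in> L2" "L2_norm (\<lambda>\<eta>. exp (- \<bar>\<xi> - \<eta>\<bar>)) \<le> 1"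
    by (auto intro!: L2_boundI[where c = 1])
  note cs = L2_Cauchy_Schwarz[OF k(1) L2_abs(1)[OF g]]
  show "integrable lborel (\<lambda>\<eta>. exp (- \<bar>\<xi> - \<eta>\<bar>) * \<bar>g \<eta>\<bar>)" using cs(1) by (simp add: L1_def)
  have "exp_conv g \<xi> \<le> L2_norm (\<lambda>\<eta>. exp (- \<bar>\<xi> - \<eta>\<bar>)) * L2_norm g"
    using cs(2) by (simp add: L1_norm_def exp_conv_def L2_abs(2)[OF g] abs_mult)
  also have "\<dots> \<le> 1 * L2_norm g" using k(2) by (intro mult_right_mono) auto
  finally show "exp_conv g \<xi> \<le> L2_norm g" by simp
qed

lemma exp_conv_nonneg: "0 \<le> exp_conv g \<xi>"
  by (simp add: exp_conv_def)

lemma exp_conv_measurable: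
  assumes [measurable]: "g \<in> borel_measurable borel"
  shows "exp_conv g \<in> borel_measurable borel"
  unfolding exp_conv_def[abs_def] by measurable

text \<open>Young's inequality with a weight. The growth condition moves the weight under the integral and
  replaces the kernel \<open>exp (-\<bar>x - y\<bar>)\<close> by \<open>k = exp (-\<bar>x - y\<bar>/2)\<close>, of integral 4. The
  Cauchy-Schwarz inequality with \<open>k = \<surd>k \<surd>k\<close> gives one factor 4, Tonelli's theorem the other.\<close>

lemma exp_conv_weighted:
  assumes g: "g \<in> L2" and \<phi>: "\<phi> \<in> borel_measurable borel" and \<phi>g: "(\<lambda>x. \<phi> x * g x) \<in> L2"
    and pos: "\<And>x. 0 \<le> \<phi> x" and K: "0 \<le> K"
    and \<phi>_le: "\<And>x y. \<phi> x \<le> K * \<phi> y * exp (\<bar>x - y\<bar> / 2)"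
  shows "(\<lambda>x. \<phi> x * exp_conv g x) \<in> L2" 
    "L2_norm (\<lambda>x. \<phi> x * exp_conv g x) \<le> 4 * K * L2_norm (\<lambda>x. \<phi> x * g x)"
proof -
  note [measurable] = L2_measurable[OF g] exp_conv_measurable[OF L2_measurable[OF g]] \<phi>
  let ?k = "\<lambda>x y. exp (- (\<bar>x - y\<bar> / 2)) :: real" and ?G = "\<lambda>y. \<bar>\<phi> y * g y\<bar>"
  have k: "(\<integral>\<^sup>+y. ennreal (?k x y) \<partial>lborel) = ennreal 4" for x
    using nn_integral_exp_abs[of "1/2" x] by simp
  have k': "(\<integral>\<^sup>+x. ennreal (?k x y) \<partial>lborel) = ennreal 4" for y
    using k[of y] by (simp add: abs_minus_commute)
  have pointwise: "ennreal ((\<phi> x * exp_conv g x)\<^sup>2)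
      \<le> ennreal (4 * K\<^sup>2) * (\<integral>\<^sup>+y. ennreal (?k x y) * ennreal ((?G y)\<^sup>2) \<partial>lborel)" for x
  proof -
    have "ennreal (\<phi> x * exp_conv g x) = ennreal (\<phi> x) * (\<integral>\<^sup>+y. ennreal (exp (- \<bar>x - y\<bar>) * \<bar>g y\<bar>) \<partial>lborel)"
      unfolding exp_conv_def using exp_conv_bound(1)[OF g, of x] pos
      by (subst nn_integral_eq_integral) (auto simp: ennreal_mult)
    also have "\<dots> = (\<integral>\<^sup>+y. ennreal (\<phi> x * (exp (- \<bar>x - y\<bar>) * \<bar>g y\<bar>)) \<partial>lborel)"
      using pos by (subst nn_integral_cmult[symmetric]) (auto simp: ennreal_mult)
    also have "\<dots> \<le> (\<integral>\<^sup>+y. ennreal K * (ennreal (sqrt (?k x y)) * ennreal (sqrt (?k x y) * ?G y)) \<partial>lborel)"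
    proof (intro nn_integral_mono)
      fix y
      have "\<phi> x * (exp (- \<bar>x - y\<bar>) * \<bar>g y\<bar>) \<le> (K * \<phi> y * exp (\<bar>x - y\<bar> / 2)) * (exp (- \<bar>x - y\<bar>) * \<bar>g y\<bar>)"
        by (intro mult_right_mono \<phi>_le) auto
      also have "\<dots> = K * (exp (\<bar>x - y\<bar> / 2) * exp (- \<bar>x - y\<bar>)) * ?G y"
        using pos[of y] by (simp add: abs_mult)
      also have "exp (\<bar>x - y\<bar> / 2) * exp (- \<bar>x - y\<bar>) = ?k x y"
        by (simp flip: exp_add)
      also have "K * ?k x y * ?G y = K * (sqrt (?k x y) * (sqrt (?k x y) * ?G y))"
        by (simp add: mult.assoc[symmetric])
      finally show "ennreal (\<phi> x * (exp (- \<bar>x - y\<bar>) * \<bar>g y\<bar>))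
          \<le> ennreal K * (ennreal (sqrt (?k x y)) * ennreal (sqrt (?k x y) * ?G y))"
        using K by (simp add: ennreal_mult[symmetric] ennreal_leI)
    qed
    also have "\<dots> = ennreal K * (\<integral>\<^sup>+y. ennreal (sqrt (?k x y)) * ennreal (sqrt (?k x y) * ?G y) \<partial>lborel)"
      by (rule nn_integral_cmult) measurable
    finally have "(ennreal (\<phi> x * exp_conv g x))\<^sup>2
      \<le> (ennreal K * (\<integral>\<^sup>+y. ennreal (sqrt (?k x y)) * ennreal (sqrt (?k x y) * ?G y) \<partial>lborel))\<^sup>2"
      by (intro power_mono) auto
    also have "\<dots> = ennreal (K\<^sup>2) * (\<integral>\<^sup>+y. ennreal (sqrt (?k x y)) * ennreal (sqrt (?k x y) * ?G y) \<partial>lborel)\<^sup>2"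
      using K by (simp add: power_mult_distrib ennreal_power)
    also have "\<dots> \<le> ennreal (K\<^sup>2) * ((\<integral>\<^sup>+y. (ennreal (sqrt (?k x y)))\<^sup>2 \<partial>lborel)
        * (\<integral>\<^sup>+y. (ennreal (sqrt (?k x y) * ?G y))\<^sup>2 \<partial>lborel))"
      by (intro mult_left_mono Cauchy_Schwarz_nn_integral) auto
    also have "(\<integral>\<^sup>+y. (ennreal (sqrt (?k x y)))\<^sup>2 \<partial>lborel) = ennreal 4"
      by (simp add: ennreal_power k)
    also have "(\<integral>\<^sup>+y. (ennreal (sqrt (?k x y) * ?G y))\<^sup>2 \<partial>lborel)
        = (\<integral>\<^sup>+y. ennreal (?k x y) * ennreal ((?G y)\<^sup>2) \<partial>lborel)"
      by (simp add: ennreal_power power_mult_distrib ennreal_mult)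
    finally have "(ennreal (\<phi> x * exp_conv g x))\<^sup>2
      \<le> ennreal (K\<^sup>2) * (ennreal 4 * (\<integral>\<^sup>+y. ennreal (?k x y) * ennreal ((?G y)\<^sup>2) \<partial>lborel))" .
    moreover have "ennreal ((\<phi> x * exp_conv g x)\<^sup>2) = (ennreal (\<phi> x * exp_conv g x))\<^sup>2"
      using pos exp_conv_nonneg[of g x] by (intro ennreal_power[symmetric]) simp
    moreover have "ennreal (4 * K\<^sup>2) = ennreal (K\<^sup>2) * ennreal 4"
      by (subst ennreal_mult[symmetric]) (simp_all add: mult.commute)
    ultimately show ?thesis by (simp only: mult.assoc)
  qed
  have "(\<integral>\<^sup>+x. ennreal ((\<phi> x * exp_conv g x)\<^sup>2) \<partial>lborel)
      \<le> (\<integral>\<^sup>+x. ennreal (4 * K\<^sup>2) * (\<integral>\<^sup>+y. ennreal (?k x y) * ennreal ((?G y)\<^sup>2) \<partial>lborel) \<partial>lborel)"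
    by (intro nn_integral_mono pointwise)
  also have "\<dots> = ennreal (4 * K\<^sup>2) * (\<integral>\<^sup>+x. (\<integral>\<^sup>+y. ennreal (?k x y) * ennreal ((?G y)\<^sup>2) \<partial>lborel) \<partial>lborel)"
    by (rule nn_integral_cmult) measurable
  also have "(\<integral>\<^sup>+x. (\<integral>\<^sup>+y. ennreal (?k x y) * ennreal ((?G y)\<^sup>2) \<partial>lborel) \<partial>lborel)
      = (\<integral>\<^sup>+y. (\<integral>\<^sup>+x. ennreal (?k x y) * ennreal ((?G y)\<^sup>2) \<partial>lborel) \<partial>lborel)"
    by (rule lborel_pair.Fubini') measurable
  also have "\<dots> = (\<integral>\<^sup>+y. ennreal 4 * ennreal ((?G y)\<^sup>2) \<partial>lborel)"
    by (subst nn_integral_multc) (measurable, simp add: k')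
  also have "\<dots> = ennreal 4 * (\<integral>\<^sup>+y. ennreal ((\<phi> y * g y)\<^sup>2) \<partial>lborel)"
    by (subst nn_integral_cmult) (auto simp: )
  also have "\<dots> = ennreal (4 * (L2_norm (\<lambda>x. \<phi> x * g x))\<^sup>2)"
    by (simp only: L2_nn_integral[OF \<phi>g]) (simp add: ennreal_mult)
  also have "ennreal (4 * K\<^sup>2) * \<dots> = ennreal ((4 * K * L2_norm (\<lambda>x. \<phi> x * g x))\<^sup>2)"
    by (subst ennreal_mult[symmetric]) (auto simp: power_mult_distrib)
  finally show "(\<lambda>x. \<phi> x * exp_conv g x) \<in> L2" 
    "L2_norm (\<lambda>x. \<phi> x * exp_conv g x) \<le> 4 * K * L2_norm (\<lambda>x. \<phi> x * g x)"
    using K by (auto intro!: L2_boundI)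
qed

lemma PQ_measurable:
  assumes "Y \<in> F"
  shows "P \<gamma> Y \<in> borel_measurable borel" "Q \<gamma> Y \<in> borel_measurable borel"
proof -
  note [measurable] = F_memD(3,5-7)[OF assms, THEN L2_measurable] F_memD(1,4)[OF assms, THEN Linf_measurable]
  have [measurable]: "y_of Y \<in> borel_measurable borel" "q_of Y \<in> borel_measurable borel"
    unfolding y_of_def[abs_def] q_of_def[abs_def] by measurable
  show "P \<gamma> Y \<in> borel_measurable borel" unfolding P_def[abs_def] by measurable
  show "Q \<gamma> Y \<in> borel_measurable borel" unfolding Q_def[abs_def] by measurable
qed

text \<open>Since \<open>\<bar>\<zeta>\<bar> \<le> Z\<close>, the exponent \<open>-sgn (\<xi> - \<eta>) (y \<xi> - y \<eta>)\<close> of the kernel differs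
  from \<open>-\<bar>\<xi> - \<eta>\<bar>\<close> by at most \<open>2 Z\<close>.\<close>

lemma PQ_le_exp_conv:
  assumes Y: "Y \<in> F" and src: "source \<gamma> Y \<in> L2" and Z: "AE \<xi> in lborel. \<bar>zeta_of Y \<xi>\<bar> \<le> Z"
  shows "AE \<xi> in lborel. \<bar>P \<gamma> Y \<xi>\<bar> \<le> exp (2 * Z) * exp_conv (source \<gamma> Y) \<xi> \<and>
     \<bar>Q \<gamma> Y \<xi>\<bar> \<le> exp (2 * Z) * exp_conv (source \<gamma> Y) \<xi>"
  using Z
proof eventually_elim
  case (elim \<xi>)
  note I = exp_conv_bound(1)[OF src, of \<xi>]
  have kernel: "AE \<eta> in lborel. exp (- (sgn (\<xi> - \<eta>) * (y_of Y \<xi> - y_of Y \<eta>))) \<le> exp (2 * Z) * exp (- \<bar>\<xi> - \<eta>\<bar>)"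
    using Z
  proof eventually_elim
    case (elim \<eta>)
    have "- (sgn (\<xi> - \<eta>) * (y_of Y \<xi> - y_of Y \<eta>)) \<le> 2 * Z - \<bar>\<xi> - \<eta>\<bar>"
      using elim \<open>\<bar>zeta_of Y \<xi>\<bar> \<le> Z\<close> by (auto simp: y_of_def sgn_if)
    then show ?case by (simp flip: exp_add)
  qed
  have bound: "\<bar>LINT \<eta>|lborel. f \<eta>\<bar> \<le> exp (2 * Z) * exp_conv (source \<gamma> Y) \<xi>"
    if f: "\<And>\<eta>. \<bar>f \<eta>\<bar> \<le> exp (- (sgn (\<xi> - \<eta>) * (y_of Y \<xi> - y_of Y \<eta>))) * \<bar>source \<gamma> Y \<eta>\<bar>" for f
  proof -
    have "\<bar>LINT \<eta>|lborel. f \<eta>\<bar> \<le> (LINT \<eta>|lborel. \<bar>f \<eta>\<bar>)" by (rule integral_abs_bound)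
    also have "\<dots> \<le> (LINT \<eta>|lborel. exp (2 * Z) * (exp (- \<bar>\<xi> - \<eta>\<bar>) * \<bar>source \<gamma> Y \<eta>\<bar>))"
    proof (rule integral_mono_AE')
      show "integrable lborel (\<lambda>\<eta>. exp (2 * Z) * (exp (- \<bar>\<xi> - \<eta>\<bar>) * \<bar>source \<gamma> Y \<eta>\<bar>))"
        using I by simp
      show "AE \<eta> in lborel. \<bar>f \<eta>\<bar> \<le> exp (2 * Z) * (exp (- \<bar>\<xi> - \<eta>\<bar>) * \<bar>source \<gamma> Y \<eta>\<bar>)"
        using kernel
      proof eventually_elim
        case (elim \<eta>)
        from mult_right_mono[OF this, of "\<bar>source \<gamma> Y \<eta>\<bar>"] f[of \<eta>] show ?case
          by (simp add: mult.assoc)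
      qed
    qed auto
    also have "\<dots> = exp (2 * Z) * exp_conv (source \<gamma> Y) \<xi>" by (simp add: exp_conv_def)
    finally show ?thesis .
  qed
  have half: "\<bar>c * x\<bar> \<le> b" if "\<bar>x\<bar> \<le> b" "\<bar>c\<bar> = 1 / 2" for b c x :: real
    using that(1) unfolding abs_mult that(2) by simp
  show ?case
    unfolding P_def Q_def source_def[symmetric]
    by (intro conjI half[OF bound]) (auto simp: abs_mult abs_sgn_eq)
qed

section \<open>Boundedness of G on bounded sets\<close>

definition nonlocal_bounds :: "real \<Rightarrow> real \<Rightarrow> real \<Rightarrow> state \<Rightarrow> bool" where
  "nonlocal_bounds \<gamma> M B Y \<longleftrightarrow>
       source \<gamma> Y \<in> L2 \<and> L2_norm (source \<gamma> Y) \<le> B \<and>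
       P \<gamma> Y \<in> L2 \<and> L2_norm (P \<gamma> Y) \<le> B \<and> Q \<gamma> Y \<in> L2 \<and> L2_norm (Q \<gamma> Y) \<le> B \<and>
       (AE \<xi> in lborel. \<bar>U_of Y \<xi>\<bar> \<le> M \<and> \<bar>P \<gamma> Y \<xi>\<bar> \<le> B \<and> \<bar>Q \<gamma> Y \<xi>\<bar> \<le> B)"

text \<open>In \<open>U\<^sup>2 q = U\<^sup>2 + U\<^sup>2 v\<close> the bound on \<open>U\<close> leaves one factor \<open>U\<close>, or the factor \<open>v\<close>, in \<open>L\<^sup>2\<close>. So the
  source is in \<open>L\<^sup>2\<close>, and so are its convolutions; these are also bounded, as the kernel is in \<open>L\<^sup>2\<close>.\<close>

lemma bounded_state:
  assumes M: "0 \<le> M"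
  obtains B where "0 \<le> B" "\<And>Y. Y \<in> F \<Longrightarrow> F_norm Y \<le> M \<Longrightarrow> nonlocal_bounds \<gamma> M B Y"
proof
  let ?a = "\<bar>3 - 2 * \<gamma>\<bar> / 2" and ?b = "\<bar>\<gamma>\<bar> / 2"
  define S where "S = ?a * M * M + ?a * M\<^sup>2 * M + ?b * M"
  define B where "B = S + 4 * exp (2 * M) * S"
  have S: "0 \<le> S" using M by (simp add: S_def)
  then show "0 \<le> B" by (simp add: B_def)
  fix Y assume Y: "Y \<in> F" and YM: "F_norm Y \<le> M"
  note mem = F_memD[OF Y] and le = order_trans[OF F_norm_bounds(2) YM] order_trans[OF F_norm_bounds(3) YM]
    order_trans[OF F_norm_bounds(4) YM] order_trans[OF F_norm_bounds(6) YM] order_trans[OF F_norm_bounds(8) YM]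
  note [measurable] = mem(3,5-7)[THEN L2_measurable] mem(1,4)[THEN Linf_measurable]
  note [measurable] = PQ_measurable[OF Y]
  have U: "AE \<xi> in lborel. \<bar>U_of Y \<xi>\<bar> \<le> M" and zeta: "AE \<xi> in lborel. \<bar>zeta_of Y \<xi>\<bar> \<le> M"
    using AE_le_Linf_norm[OF mem(2)] AE_le_Linf_norm[OF mem(1)] le(1,3) by auto
  have dom: "AE \<xi> in lborel. \<bar>source \<gamma> Y \<xi>\<bar>
      \<le> ?a * M * \<bar>U_of Y \<xi>\<bar> + ?a * M\<^sup>2 * \<bar>v_of Y \<xi>\<bar> + ?b * \<bar>h_of Y \<xi>\<bar>"
    using U
  proof eventually_elim
    case (elim \<xi>)
    have sq: "(U_of Y \<xi>)\<^sup>2 \<le> M * \<bar>U_of Y \<xi>\<bar>" "(U_of Y \<xi>)\<^sup>2 \<le> M\<^sup>2"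
      using elim mult_right_mono[OF elim, of "\<bar>U_of Y \<xi>\<bar>"] power_mono[OF elim, of 2]
      by (auto simp: power2_eq_square)
    have "(U_of Y \<xi>)\<^sup>2 * \<bar>1 + v_of Y \<xi>\<bar> \<le> (U_of Y \<xi>)\<^sup>2 * (1 + \<bar>v_of Y \<xi>\<bar>)"
      by (intro mult_left_mono) auto
    also have "\<dots> \<le> M * \<bar>U_of Y \<xi>\<bar> + M\<^sup>2 * \<bar>v_of Y \<xi>\<bar>"
      using sq(1) mult_right_mono[OF sq(2), of "\<bar>v_of Y \<xi>\<bar>"] by (simp add: algebra_simps)
    finally have U2q: "(U_of Y \<xi>)\<^sup>2 * \<bar>1 + v_of Y \<xi>\<bar> \<le> M * \<bar>U_of Y \<xi>\<bar> + M\<^sup>2 * \<bar>v_of Y \<xi>\<bar>" .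
    have "\<bar>source \<gamma> Y \<xi>\<bar> \<le> ?a * ((U_of Y \<xi>)\<^sup>2 * \<bar>1 + v_of Y \<xi>\<bar>) + ?b * \<bar>h_of Y \<xi>\<bar>"
      unfolding source_def q_of_def by (intro order_trans[OF abs_triangle_ineq]) (simp add: abs_mult)
    also have "\<dots> \<le> ?a * (M * \<bar>U_of Y \<xi>\<bar> + M\<^sup>2 * \<bar>v_of Y \<xi>\<bar>) + ?b * \<bar>h_of Y \<xi>\<bar>"
      by (intro add_right_mono mult_left_mono U2q) simp
    finally show ?case by (simp add: algebra_simps)
  qed
  have meas: "source \<gamma> Y \<in> borel_measurable borel"
    unfolding source_def[abs_def] q_of_def by measurable
  have pos: "0 \<le> ?a * M" "0 \<le> ?a * M\<^sup>2" "0 \<le> ?b" using M by auto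
  note src = L2_dominated_sum[OF mem(3,5,7) meas dom pos]
  have "L2_norm (source \<gamma> Y) \<le> ?a * M * L2_norm (U_of Y) + ?a * M\<^sup>2 * L2_norm (v_of Y) + ?b * L2_norm (h_of Y)"
    by (rule src)
  also have "\<dots> \<le> S"
    unfolding S_def by (intro add_mono mult_left_mono le pos)
  finally have src_le: "L2_norm (source \<gamma> Y) \<le> S" .
  have conv: "exp_conv (source \<gamma> Y) \<in> L2" "L2_norm (exp_conv (source \<gamma> Y)) \<le> 4 * S"
    using exp_conv_weighted[OF src(1), of "\<lambda>_. 1" 1] src src_le by auto
  note sc = L2_scale[OF conv(1), of "exp (2 * M)"]
  note PQ = PQ_le_exp_conv[OF Y src(1) zeta]
  have PQ': "f \<in> L2 \<and> L2_norm f \<le> B"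
    if f: "f \<in> borel_measurable borel"
      "AE \<xi> in lborel. \<bar>f \<xi>\<bar> \<le> exp (2 * M) * exp_conv (source \<gamma> Y) \<xi>" for f
  proof -
    have "AE \<xi> in lborel. \<bar>f \<xi>\<bar> \<le> \<bar>exp (2 * M) * exp_conv (source \<gamma> Y) \<xi>\<bar>"
      using f(2) by eventually_elim (simp add: exp_conv_nonneg abs_mult)
    note d = L2_dominated[OF sc(1) f(1) this]
    have "L2_norm f \<le> exp (2 * M) * (4 * S)"
      using d(2) sc(2) mult_left_mono[OF conv(2), of "exp (2 * M)"]
      by (metis abs_exp_cancel exp_ge_zero order_trans)
    then show ?thesis using d(1) S by (simp add: B_def)
  qed
  have "AE \<xi> in lborel. \<bar>U_of Y \<xi>\<bar> \<le> M \<and> \<bar>P \<gamma> Y \<xi>\<bar> \<le> B \<and> \<bar>Q \<gamma> Y \<xi>\<bar> \<le> B"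
    using U PQ
  proof eventually_elim
    case (elim \<xi>)
    have "exp (2 * M) * exp_conv (source \<gamma> Y) \<xi> \<le> exp (2 * M) * S"
      using exp_conv_bound(2)[OF src(1), of \<xi>] src_le by (intro mult_left_mono) auto
    also have "\<dots> \<le> B" using S by (simp add: B_def)
    finally show ?case using elim by auto
  qed
  moreover have "L2_norm (source \<gamma> Y) \<le> B" using src_le S by (simp add: B_def add_increasing2)
  ultimately show "nonlocal_bounds \<gamma> M B Y"
    unfolding nonlocal_bounds_def using src(1) PQ'[of "P \<gamma> Y"] PQ'[of "Q \<gamma> Y"] PQ by auto
qed

lemma state_measurable:
  assumes "Y \<in> F"
  shows "zeta_of Y \<in> borel_measurable borel" "U_of Y \<in> borel_measurable borel"
    "H_of Y \<in> borel_measurable borel" "v_of Y \<in> borel_measurable borel"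
    "w_of Y \<in> borel_measurable borel" "h_of Y \<in> borel_measurable borel"
    "q_of Y \<in> borel_measurable borel" "source \<gamma> Y \<in> borel_measurable borel"
proof -
  note m = F_memD(3,5-7)[OF assms, THEN L2_measurable] F_memD(1,4)[OF assms, THEN Linf_measurable]
  note [measurable] = m
  show "zeta_of Y \<in> borel_measurable borel" "U_of Y \<in> borel_measurable borel"
    "H_of Y \<in> borel_measurable borel" "v_of Y \<in> borel_measurable borel"
    "w_of Y \<in> borel_measurable borel" "h_of Y \<in> borel_measurable borel" by (fact m)+
  show "q_of Y \<in> borel_measurable borel" "source \<gamma> Y \<in> borel_measurable borel"
    unfolding source_def[abs_def] q_of_def[abs_def] by measurable
qed

text \<open>The component \<open>w\<close> is written with the source: \<open>\<gamma>/2 h + ((3 - 2\<gamma>)/2 U\<^sup>2 - P) q\<close> is the source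
  minus \<open>P q\<close>. In the component \<open>U\<close>, the factor \<open>-1\<close> makes the scaling law of seminorms applicable.\<close>

lemma G_components:
  "zeta_of (G \<gamma> Y) = (\<lambda>\<xi>. \<gamma> * U_of Y \<xi>)"
  "U_of (G \<gamma> Y) = (\<lambda>\<xi>. - 1 * Q \<gamma> Y \<xi>)"
  "H_of (G \<gamma> Y) = (\<lambda>\<xi>. (U_of Y \<xi>) ^ 3 - 2 * P \<gamma> Y \<xi> * U_of Y \<xi>)"
  "v_of (G \<gamma> Y) = (\<lambda>\<xi>. \<gamma> * w_of Y \<xi>)"
  "w_of (G \<gamma> Y) = (\<lambda>\<xi>. source \<gamma> Y \<xi> - P \<gamma> Y \<xi> * q_of Y \<xi>)"
  "h_of (G \<gamma> Y) = (\<lambda>\<xi>. - 2 * Q \<gamma> Y \<xi> * U_of Y \<xi> * q_of Y \<xi> + (3 * (U_of Y \<xi>)\<^sup>2 - 2 * P \<gamma> Y \<xi>) * w_of Y \<xi>)"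
  by (auto simp: G_def source_def algebra_simps)

lemma G_measurable:
  assumes "Y \<in> F"
  shows "U_of (G \<gamma> Y) \<in> borel_measurable borel" "H_of (G \<gamma> Y) \<in> borel_measurable borel"
    "v_of (G \<gamma> Y) \<in> borel_measurable borel"
    "w_of (G \<gamma> Y) \<in> borel_measurable borel" "h_of (G \<gamma> Y) \<in> borel_measurable borel"
proof -
  note [measurable] = state_measurable[OF assms] PQ_measurable[OF assms]
  show "U_of (G \<gamma> Y) \<in> borel_measurable borel" "H_of (G \<gamma> Y) \<in> borel_measurable borel"
    "v_of (G \<gamma> Y) \<in> borel_measurable borel"
    "w_of (G \<gamma> Y) \<in> borel_measurable borel" "h_of (G \<gamma> Y) \<in> borel_measurable borel"
    unfolding G_components by measurable
qed

lemma G_pointwise: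
  assumes U: "\<bar>U_of Y \<xi>\<bar> \<le> M" and P: "\<bar>P \<gamma> Y \<xi>\<bar> \<le> B"
  shows "\<bar>H_of (G \<gamma> Y) \<xi>\<bar> \<le> M ^ 3 + 2 * B * M"
    "\<bar>w_of (G \<gamma> Y) \<xi>\<bar> \<le> \<bar>source \<gamma> Y \<xi>\<bar> + \<bar>P \<gamma> Y \<xi>\<bar> * \<bar>q_of Y \<xi>\<bar>"
    "\<bar>h_of (G \<gamma> Y) \<xi>\<bar> \<le> 2 * M * (\<bar>Q \<gamma> Y \<xi>\<bar> * \<bar>q_of Y \<xi>\<bar>) + (3 * M\<^sup>2 + 2 * B) * \<bar>w_of Y \<xi>\<bar>"
proof -
  let ?U = "\<bar>U_of Y \<xi>\<bar>" and ?P = "\<bar>P \<gamma> Y \<xi>\<bar>" and ?Q = "\<bar>Q \<gamma> Y \<xi>\<bar>"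
  have M: "0 \<le> M" and B: "0 \<le> B" using U P by linarith+
  have "\<bar>H_of (G \<gamma> Y) \<xi>\<bar> \<le> ?U ^ 3 + 2 * (?P * ?U)"
    unfolding G_components by (intro order_trans[OF abs_triangle_ineq4]) (simp add: abs_mult power_abs)
  also have "\<dots> \<le> M ^ 3 + 2 * (B * M)" using U P B by (intro add_mono mult_left_mono power_mono mult_mono) auto
  finally show "\<bar>H_of (G \<gamma> Y) \<xi>\<bar> \<le> M ^ 3 + 2 * B * M" by simp
  show "\<bar>w_of (G \<gamma> Y) \<xi>\<bar> \<le> \<bar>source \<gamma> Y \<xi>\<bar> + ?P * \<bar>q_of Y \<xi>\<bar>"
    unfolding G_components by (intro order_trans[OF abs_triangle_ineq4]) (simp add: abs_mult)
  have "\<bar>h_of (G \<gamma> Y) \<xi>\<bar> \<le> 2 * ?U * (?Q * \<bar>q_of Y \<xi>\<bar>) + \<bar>3 * (U_of Y \<xi>)\<^sup>2 - 2 * P \<gamma> Y \<xi>\<bar> * \<bar>w_of Y \<xi>\<bar>"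
    unfolding G_components by (intro order_trans[OF abs_triangle_ineq]) (simp add: abs_mult ac_simps)
  also have "\<bar>3 * (U_of Y \<xi>)\<^sup>2 - 2 * P \<gamma> Y \<xi>\<bar> \<le> 3 * ?U\<^sup>2 + 2 * ?P"
    by (intro order_trans[OF abs_triangle_ineq4]) (simp add: abs_mult)
  also have "\<dots> \<le> 3 * M\<^sup>2 + 2 * B" using U P by (intro add_mono mult_left_mono power_mono) auto
  also have "2 * ?U * (?Q * \<bar>q_of Y \<xi>\<bar>) \<le> 2 * M * (?Q * \<bar>q_of Y \<xi>\<bar>)"
    using U by (intro mult_right_mono) auto
  finally show "\<bar>h_of (G \<gamma> Y) \<xi>\<bar> \<le> 2 * M * (?Q * \<bar>q_of Y \<xi>\<bar>) + (3 * M\<^sup>2 + 2 * B) * \<bar>w_of Y \<xi>\<bar>"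
    by (simp add: mult_right_mono)
qed

text \<open>As \<open>q\<close> itself is not in \<open>L\<^sup>2\<close>, each product with \<open>q = 1 + v\<close> is split: \<open>P\<close> and \<open>Q\<close> are in \<open>L\<^sup>2\<close>, while
  \<open>P v\<close> and \<open>Q v\<close> are products of a bounded and a square integrable function.\<close>

lemma G_bounded:
  assumes M: "0 \<le> M"
  obtains K where "0 \<le> K" "\<And>Y. Y \<in> F \<Longrightarrow> F_norm Y \<le> M \<Longrightarrow> F_norm (G \<gamma> Y) \<le> K"
proof -
  obtain B where B: "0 \<le> B" and bnd: "\<And>Y. Y \<in> F \<Longrightarrow> F_norm Y \<le> M \<Longrightarrow> nonlocal_bounds \<gamma> M B Y"
    using bounded_state[OF M, of \<gamma>] by blast
  define K where "K = \<bar>\<gamma>\<bar> * M + B + B + (M ^ 3 + 2 * B * M) + \<bar>\<gamma>\<bar> * M + (1 * B + 1 * B + B * M)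
    + (2 * M * B + 2 * M * B * M + (3 * M\<^sup>2 + 2 * B) * M)"
  have "0 \<le> K" using M B by (simp add: K_def)
  moreover have "F_norm (G \<gamma> Y) \<le> K" if Y: "Y \<in> F" and YM: "F_norm Y \<le> M" for Y
  proof -
    have src: "source \<gamma> Y \<in> L2" "L2_norm (source \<gamma> Y) \<le> B"
      and P: "P \<gamma> Y \<in> L2" "L2_norm (P \<gamma> Y) \<le> B" and Q: "Q \<gamma> Y \<in> L2" "L2_norm (Q \<gamma> Y) \<le> B"
      and ae: "AE \<xi> in lborel. \<bar>U_of Y \<xi>\<bar> \<le> M \<and> \<bar>P \<gamma> Y \<xi>\<bar> \<le> B \<and> \<bar>Q \<gamma> Y \<xi>\<bar> \<le> B"
      using bnd[OF Y YM] by (auto simp: nonlocal_bounds_def)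
    note mem = F_memD[OF Y] and le = F_norm_bounds[of Y, THEN order_trans, OF YM]
    note meas = G_measurable[OF Y, of \<gamma>]
    have zeta: "Linf_norm (zeta_of (G \<gamma> Y)) \<le> \<bar>\<gamma>\<bar> * M"
      unfolding G_components function_seminorm.homogeneous[OF Linf_seminorm mem(2)]
      using le by (intro mult_left_mono) auto
    have U2: "L2_norm (U_of (G \<gamma> Y)) \<le> B"
      unfolding G_components L2_scale(2)[OF Q(1)] using Q(2) by simp
    have Uinf: "Linf_norm (U_of (G \<gamma> Y)) \<le> B"
      using ae B by (intro Linf_boundI meas) (auto simp: G_components)
    have "AE \<xi> in lborel. \<bar>H_of (G \<gamma> Y) \<xi>\<bar> \<le> M ^ 3 + 2 * B * M"
      using ae by eventually_elim (simp add: G_pointwise(1))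
    then have H: "Linf_norm (H_of (G \<gamma> Y)) \<le> M ^ 3 + 2 * B * M"
      using B M by (intro Linf_boundI meas) simp_all
    have v: "L2_norm (v_of (G \<gamma> Y)) \<le> \<bar>\<gamma>\<bar> * M"
      unfolding G_components L2_scale(2)[OF mem(6)] using le by (intro mult_left_mono) auto
    have w: "L2_norm (w_of (G \<gamma> Y)) \<le> 1 * B + 1 * B + B * M"
    proof -
      have "AE \<xi> in lborel. \<bar>w_of (G \<gamma> Y) \<xi>\<bar> \<le> 1 * \<bar>source \<gamma> Y \<xi>\<bar> + 1 * \<bar>P \<gamma> Y \<xi>\<bar> + B * \<bar>v_of Y \<xi>\<bar>"
        using ae
      proof eventually_elim
        case (elim \<xi>)
        have "\<bar>w_of (G \<gamma> Y) \<xi>\<bar> \<le> \<bar>source \<gamma> Y \<xi>\<bar> + \<bar>P \<gamma> Y \<xi>\<bar> * \<bar>q_of Y \<xi>\<bar>"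
          using elim by (intro G_pointwise) auto
        also have "\<bar>P \<gamma> Y \<xi>\<bar> * \<bar>q_of Y \<xi>\<bar> \<le> \<bar>P \<gamma> Y \<xi>\<bar> * (1 + \<bar>v_of Y \<xi>\<bar>)"
          unfolding q_of_def by (intro mult_left_mono) auto
        also have "\<dots> \<le> \<bar>P \<gamma> Y \<xi>\<bar> + B * \<bar>v_of Y \<xi>\<bar>"
          using elim by (simp add: distrib_left mult_right_mono)
        finally show ?case by simp
      qed
      note d = L2_dominated_sum(2)[OF src(1) P(1) mem(5) meas(4) this zero_le_one zero_le_one B]
      show ?thesis by (rule order_trans[OF d]) (intro add_mono mult_left_mono src P le, simp_all add: B)
    qed
    have h: "L2_norm (h_of (G \<gamma> Y)) \<le> 2 * M * B + 2 * M * B * M + (3 * M\<^sup>2 + 2 * B) * M"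
    proof -
      have "AE \<xi> in lborel. \<bar>h_of (G \<gamma> Y) \<xi>\<bar>
          \<le> 2 * M * \<bar>Q \<gamma> Y \<xi>\<bar> + 2 * M * B * \<bar>v_of Y \<xi>\<bar> + (3 * M\<^sup>2 + 2 * B) * \<bar>w_of Y \<xi>\<bar>"
        using ae
      proof eventually_elim
        case (elim \<xi>)
        have "\<bar>Q \<gamma> Y \<xi>\<bar> * \<bar>q_of Y \<xi>\<bar> \<le> \<bar>Q \<gamma> Y \<xi>\<bar> * (1 + \<bar>v_of Y \<xi>\<bar>)"
          unfolding q_of_def by (intro mult_left_mono) auto
        also have "\<dots> \<le> \<bar>Q \<gamma> Y \<xi>\<bar> + B * \<bar>v_of Y \<xi>\<bar>"
          using elim by (simp add: distrib_left mult_right_mono)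
        finally have Qq: "\<bar>Q \<gamma> Y \<xi>\<bar> * \<bar>q_of Y \<xi>\<bar> \<le> \<bar>Q \<gamma> Y \<xi>\<bar> + B * \<bar>v_of Y \<xi>\<bar>" .
        have "\<bar>h_of (G \<gamma> Y) \<xi>\<bar> \<le> 2 * M * (\<bar>Q \<gamma> Y \<xi>\<bar> * \<bar>q_of Y \<xi>\<bar>) + (3 * M\<^sup>2 + 2 * B) * \<bar>w_of Y \<xi>\<bar>"
          using elim by (intro G_pointwise) auto
        also have "\<dots> \<le> 2 * M * (\<bar>Q \<gamma> Y \<xi>\<bar> + B * \<bar>v_of Y \<xi>\<bar>) + (3 * M\<^sup>2 + 2 * B) * \<bar>w_of Y \<xi>\<bar>"
          using M by (intro add_right_mono mult_left_mono Qq) simp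
        finally show ?case by (simp add: algebra_simps)
      qed
      moreover have pos: "0 \<le> 2 * M" "0 \<le> 2 * M * B" "0 \<le> 3 * M\<^sup>2 + 2 * B" using M B by auto
      ultimately have d: "L2_norm (h_of (G \<gamma> Y))
          \<le> 2 * M * L2_norm (Q \<gamma> Y) + 2 * M * B * L2_norm (v_of Y) + (3 * M\<^sup>2 + 2 * B) * L2_norm (w_of Y)"
        by (intro L2_dominated_sum(2)[OF Q(1) mem(5,6) meas(5)])
      show ?thesis by (rule order_trans[OF d]) (intro add_mono mult_left_mono Q le pos)
    qed
    show ?thesis unfolding F_norm_def K_def by (intro add_mono zeta U2 Uinf H v w h)
  qed
  ultimately show ?thesis using that by blast
qed

text \<open>If \<open>G\<close> is bounded by \<open>K r\<close> on the ball of radius \<open>r + 1\<close>, a solution that starts at norm \<open>r\<close>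
  cannot leave this ball before the time \<open>1 / (K r + 1)\<close>.\<close>

lemma short_time_exists: "\<exists>\<tau>. short_time \<gamma> \<tau>"
proof -
  have "\<forall>r. \<exists>K. 0 \<le> r \<longrightarrow> 0 \<le> K \<and> (\<forall>Y\<in>F. F_norm Y \<le> r + 1 \<longrightarrow> F_norm (G \<gamma> Y) \<le> K)"
    using G_bounded[of "_ + 1" \<gamma>] by (metis add_nonneg_nonneg zero_le_one)
  then obtain K where K: "\<And>r. 0 \<le> r \<Longrightarrow> 0 \<le> K r"
    "\<And>r Y. 0 \<le> r \<Longrightarrow> Y \<in> F \<Longrightarrow> F_norm Y \<le> r + 1 \<Longrightarrow> F_norm (G \<gamma> Y) \<le> K r"
    by metis
  define \<tau> where "\<tau> r = 1 / (K r + 1)" for r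
  have "F_norm (Y t) \<le> F_norm Y0 + 1"
    if T: "T \<le> \<tau> (F_norm Y0)" and sol: "solution \<gamma> T Y0 Y" and t: "t \<in> {0..T}" for Y0 T Y t
  proof -
    let ?r = "F_norm Y0"
    have r: "0 \<le> ?r" by (rule F_norm_bounds)
    have Kr: "0 < K ?r + 1" using K(1)[OF r] by simp
    have C1: "C1_F T Y (\<lambda>t. G \<gamma> (Y t))" and Y0: "Y 0 = Y0" using sol by (auto simp: solution_def)
    let ?b = "\<lambda>t. ?r + t * (K ?r + 1)"
    have b: "?b t \<le> ?r + 1" if "t \<in> {0..T}" for t
    proof -
      have "t * (K ?r + 1) \<le> \<tau> ?r * (K ?r + 1)" using that T Kr by (intro mult_right_mono) auto
      also have "\<dots> = 1" using Kr by (simp add: \<tau>_def)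
      finally show ?thesis by simp
    qed
    have "F_norm (Y t) \<le> ?b t"
    proof (rule controlled_barrier[OF C1 controlled_F_norm zero_le_one _ _ _ t])
      show "(?b has_real_derivative K ?r + 1) (at t)" for t
        by (auto intro!: derivative_eq_intros)
      show "F_norm (Y 0) \<le> ?b 0" by (simp add: Y0)
      fix t assume t: "t \<in> {0..T}" and "F_norm (Y t) \<le> ?b t"
      then have "F_norm (Y t) \<le> ?r + 1" using b[OF t] by simp
      moreover have "Y t \<in> F" using C1 t by (simp add: C1_F_def)
      ultimately show "F_norm (G \<gamma> (Y t)) < K ?r + 1" using K(2)[OF r] by fastforce
    qed
    then show ?thesis using b[OF t] by simp
  qed
  note bound = this
  have "short_time \<gamma> \<tau>"
    unfolding short_time_def
  proof (intro conjI allI impI exI)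
    show "0 < \<tau> r" if "0 \<le> r" for r using K(1)[OF that] by (simp add: \<tau>_def)
    show "\<forall>t\<in>{0..T}. F_norm (Y t) \<le> R + 1"
      if "Y0 \<in> F \<and> F_norm Y0 \<le> R \<and> 0 < T \<and> T \<le> \<tau> (F_norm Y0) \<and> solution \<gamma> T Y0 Y" for R Y0 T Y
    proof
      fix t assume "t \<in> {0..T}"
      with that bound[of T Y0 Y t] show "F_norm (Y t) \<le> R + 1" by linarith
    qed
  qed
  then show ?thesis by blast
qed

section \<open>Propagation of bounds on q, w and h\<close>

definition local_norm :: "(real \<Rightarrow> real) \<Rightarrow> state \<Rightarrow> real" where
  "local_norm \<phi> Y = L2_norm (\<lambda>\<xi>. \<phi> \<xi> * q_of Y \<xi>) + L2_norm (\<lambda>\<xi>. \<phi> \<xi> * w_of Y \<xi>)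
     + L2_norm (\<lambda>\<xi>. \<phi> \<xi> * h_of Y \<xi>)"

text \<open>The linear part of \<open>local_norm\<close>: the derivative of \<open>q\<close> is that of \<open>v\<close>.\<close>

definition local_rate :: "(real \<Rightarrow> real) \<Rightarrow> state \<Rightarrow> real" where
  "local_rate \<phi> Z = L2_norm (\<lambda>\<xi>. \<phi> \<xi> * v_of Z \<xi>) + L2_norm (\<lambda>\<xi>. \<phi> \<xi> * w_of Z \<xi>)
     + L2_norm (\<lambda>\<xi>. \<phi> \<xi> * h_of Z \<xi>)"

lemma L2_mult_bounded:
  assumes f: "f \<in> L2" and \<phi>: "\<phi> \<in> borel_measurable borel" and le: "\<And>x. \<bar>\<phi> x\<bar> \<le> b" and b: "0 \<le> b"
  shows "(\<lambda>x. \<phi> x * f x) \<in> L2" "L2_norm (\<lambda>x. \<phi> x * f x) \<le> b * L2_norm f"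
proof -
  note [measurable] = L2_measurable[OF f] \<phi>
  have "AE x in lborel. \<bar>\<phi> x * f x\<bar> \<le> \<bar>b * f x\<bar>"
    using le b by (auto simp: abs_mult intro!: mult_right_mono)
  note d = L2_dominated[OF L2_scale(1)[OF f, of b] _ this]
  show "(\<lambda>x. \<phi> x * f x) \<in> L2" by (rule d) measurable
  have "L2_norm (\<lambda>x. \<phi> x * f x) \<le> L2_norm (\<lambda>x. b * f x)" by (rule d) measurable
  then show "L2_norm (\<lambda>x. \<phi> x * f x) \<le> b * L2_norm f" using b by (simp add: L2_scale(2)[OF f])
qed

lemma controlled_L2_component:
  assumes \<phi>: "\<phi> \<in> borel_measurable borel" "\<And>x. \<bar>\<phi> x\<bar> \<le> b" "0 \<le> b"
    and c: "c \<in> {U_of, v_of, w_of, h_of}"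
  shows "controlled (\<lambda>Y. L2_norm (\<lambda>\<xi>. \<phi> \<xi> * c Y \<xi>)) (\<lambda>Y. L2_norm (\<lambda>\<xi>. \<phi> \<xi> * c Y \<xi>)) b"
proof (rule controlled_component[OF L2_weighted_seminorm, of c \<phi> c])
  have c_L2: "c X \<in> L2" "L2_norm (c X) \<le> F_norm X" if "X \<in> F" for X
    using c F_memD[OF that] F_norm_bounds[of X] by auto
  show "c X \<in> {f. (\<lambda>x. \<phi> x * f x) \<in> L2}" "c X \<in> {f. (\<lambda>x. \<phi> x * f x) \<in> L2}" if "X \<in> F" for X
    using L2_mult_bounded(1)[OF c_L2(1)[OF that] \<phi>] by auto
  show "(\<lambda>\<xi>. d * (c X \<xi> - c Y \<xi>) - c Z \<xi>) = c (F_minus (F_scale d (F_minus X Y)) Z)" for X Y Z d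
    using c by (auto simp: F_minus_def F_scale_def)
  show "L2_norm (\<lambda>x. \<phi> x * c X x) \<le> b * F_norm X" if "X \<in> F" for X
    using L2_mult_bounded(2)[OF c_L2(1)[OF that] \<phi>] mult_left_mono[OF c_L2(2)[OF that] \<phi>(3)] by linarith
qed

lemma q_of_local_L2:
  assumes \<phi>: "\<phi> \<in> L2" "\<And>x. \<bar>\<phi> x\<bar> \<le> b" "0 \<le> b" and X: "X \<in> F"
  shows "(\<lambda>x. \<phi> x * q_of X x) \<in> L2"
  using L2_add(1)[OF \<phi>(1) L2_mult_bounded(1)[OF F_memD(5)[OF X] L2_measurable[OF \<phi>(1)] \<phi>(2,3)]]
  by (simp add: q_of_def distrib_left)

lemma controlled_q:
  assumes \<phi>: "\<phi> \<in> L2" "\<And>x. \<bar>\<phi> x\<bar> \<le> b" "0 \<le> b"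
  shows "controlled (\<lambda>Y. L2_norm (\<lambda>\<xi>. \<phi> \<xi> * q_of Y \<xi>)) (\<lambda>Y. L2_norm (\<lambda>\<xi>. \<phi> \<xi> * v_of Y \<xi>)) b"
proof (rule controlled_component[OF L2_weighted_seminorm, of q_of \<phi> v_of])
  fix X assume X: "X \<in> F"
  note v = L2_mult_bounded[OF F_memD(5)[OF X] L2_measurable[OF \<phi>(1)] \<phi>(2,3)]
  show "v_of X \<in> {f. (\<lambda>x. \<phi> x * f x) \<in> L2}" using v(1) by simp
  show "q_of X \<in> {f. (\<lambda>x. \<phi> x * f x) \<in> L2}" using q_of_local_L2[OF \<phi> X] by simp
  show "L2_norm (\<lambda>x. \<phi> x * v_of X x) \<le> b * F_norm X"
    using v(2) mult_left_mono[OF F_norm_bounds(6)[of X] \<phi>(3)] by linarith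
qed (auto simp: F_minus_def F_scale_def q_of_def)

lemma controlled_local_norm:
  assumes \<phi>: "\<phi> \<in> L2" "\<And>x. \<bar>\<phi> x\<bar> \<le> b" "0 \<le> b"
  shows "controlled (local_norm \<phi>) (local_rate \<phi>) (b + b + b)"
  unfolding local_norm_def[abs_def] local_rate_def[abs_def]
  by (intro controlled_add controlled_q[OF \<phi>] controlled_L2_component[OF L2_measurable[OF \<phi>(1)] \<phi>(2,3)]) auto

text \<open>The bounded functions \<open>U\<close>, \<open>P\<close>, \<open>Q\<close> are coefficients of a linear system for \<open>(q, w, h)\<close> that acts
  pointwise in \<open>\<xi>\<close>. Hence the constant is the same for all cut-off functions \<open>\<phi>\<close>.\<close>

lemma local_rate_G:
  assumes M: "0 \<le> M"
  obtains C where "0 \<le> C" "\<And>Y \<phi> b. Y \<in> F \<Longrightarrow> F_norm Y \<le> M \<Longrightarrow> \<phi> \<in> L2 \<Longrightarrow> (\<And>x. \<bar>\<phi> x\<bar> \<le> b) \<Longrightarrow>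
    local_rate \<phi> (G \<gamma> Y) \<le> C * local_norm \<phi> Y"
proof -
  obtain B where B: "0 \<le> B" and bnd: "\<And>Y. Y \<in> F \<Longrightarrow> F_norm Y \<le> M \<Longrightarrow> nonlocal_bounds \<gamma> M B Y"
    using bounded_state[OF M, of \<gamma>] by blast
  define c1 where "c1 = \<bar>3 - 2 * \<gamma>\<bar> / 2 * M\<^sup>2 + B"
  define c2 where "c2 = \<bar>\<gamma>\<bar> / 2"
  define c3 where "c3 = 2 * M * B"
  define c4 where "c4 = 3 * M\<^sup>2 + 2 * B"
  have pos: "0 \<le> c1" "0 \<le> c2" "0 \<le> c3" "0 \<le> c4" using M B by (auto simp: c1_def c2_def c3_def c4_def)
  define C where "C = \<bar>\<gamma>\<bar> + c1 + c2 + c3 + c4"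
  have C: "0 \<le> C" using pos by (simp add: C_def)
  moreover have "local_rate \<phi> (G \<gamma> Y) \<le> C * local_norm \<phi> Y"
    if Y: "Y \<in> F" and YM: "F_norm Y \<le> M" and \<phi>: "\<phi> \<in> L2" "\<And>x. \<bar>\<phi> x\<bar> \<le> b" for Y \<phi> b
  proof -
    have b: "0 \<le> b" using \<phi>(2)[of 0] by linarith
    have ae: "AE \<xi> in lborel. \<bar>U_of Y \<xi>\<bar> \<le> M \<and> \<bar>P \<gamma> Y \<xi>\<bar> \<le> B \<and> \<bar>Q \<gamma> Y \<xi>\<bar> \<le> B"
      using bnd[OF Y YM] by (simp add: nonlocal_bounds_def)
    note [measurable] = L2_measurable[OF \<phi>(1)] state_measurable[OF Y] G_measurable[OF Y, of \<gamma>]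
    note bounded = L2_mult_bounded(1)[OF _ L2_measurable[OF \<phi>(1)] \<phi>(2) b]
    have q: "(\<lambda>\<xi>. \<phi> \<xi> * q_of Y \<xi>) \<in> L2" by (rule q_of_local_L2[OF \<phi> b Y])
    have w: "(\<lambda>\<xi>. \<phi> \<xi> * w_of Y \<xi>) \<in> L2" and h: "(\<lambda>\<xi>. \<phi> \<xi> * h_of Y \<xi>) \<in> L2"
      using bounded F_memD[OF Y] by auto
    have eq: "(\<lambda>\<xi>. \<phi> \<xi> * (\<gamma> * w_of Y \<xi>)) = (\<lambda>\<xi>. \<gamma> * (\<phi> \<xi> * w_of Y \<xi>))" by auto
    have v': "L2_norm (\<lambda>\<xi>. \<phi> \<xi> * v_of (G \<gamma> Y) \<xi>) = \<bar>\<gamma>\<bar> * L2_norm (\<lambda>\<xi>. \<phi> \<xi> * w_of Y \<xi>)"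
      unfolding G_components eq by (rule L2_scale[OF w])
    have w': "L2_norm (\<lambda>\<xi>. \<phi> \<xi> * w_of (G \<gamma> Y) \<xi>) \<le> c1 * L2_norm (\<lambda>\<xi>. \<phi> \<xi> * q_of Y \<xi>)
        + 0 * L2_norm (\<lambda>\<xi>. \<phi> \<xi> * w_of Y \<xi>) + c2 * L2_norm (\<lambda>\<xi>. \<phi> \<xi> * h_of Y \<xi>)"
    proof (rule L2_dominated_sum(2)[OF q w h])
      show "AE \<xi> in lborel. \<bar>\<phi> \<xi> * w_of (G \<gamma> Y) \<xi>\<bar> \<le> c1 * \<bar>\<phi> \<xi> * q_of Y \<xi>\<bar>
          + 0 * \<bar>\<phi> \<xi> * w_of Y \<xi>\<bar> + c2 * \<bar>\<phi> \<xi> * h_of Y \<xi>\<bar>"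
        using ae
      proof eventually_elim
        case (elim \<xi>)
        have "\<bar>source \<gamma> Y \<xi>\<bar> \<le> \<bar>3 - 2 * \<gamma>\<bar> / 2 * (U_of Y \<xi>)\<^sup>2 * \<bar>q_of Y \<xi>\<bar> + c2 * \<bar>h_of Y \<xi>\<bar>"
          unfolding source_def c2_def by (intro order_trans[OF abs_triangle_ineq]) (simp add: abs_mult)
        also have "\<dots> \<le> \<bar>3 - 2 * \<gamma>\<bar> / 2 * M\<^sup>2 * \<bar>q_of Y \<xi>\<bar> + c2 * \<bar>h_of Y \<xi>\<bar>"
          using elim by (intro add_right_mono mult_right_mono mult_left_mono) (auto simp: abs_le_square_iff[symmetric])
        finally have "\<bar>w_of (G \<gamma> Y) \<xi>\<bar> \<le> c1 * \<bar>q_of Y \<xi>\<bar> + c2 * \<bar>h_of Y \<xi>\<bar>"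
          using G_pointwise(2)[of Y \<xi> M \<gamma> B] elim mult_right_mono[of "\<bar>P \<gamma> Y \<xi>\<bar>" B "\<bar>q_of Y \<xi>\<bar>"]
          by (simp add: c1_def distrib_right)
        from mult_left_mono[OF this, of "\<bar>\<phi> \<xi>\<bar>"] show ?case
          by (simp add: abs_mult algebra_simps)
      qed
    qed (use pos in auto)
    have h': "L2_norm (\<lambda>\<xi>. \<phi> \<xi> * h_of (G \<gamma> Y) \<xi>) \<le> c3 * L2_norm (\<lambda>\<xi>. \<phi> \<xi> * q_of Y \<xi>)
        + c4 * L2_norm (\<lambda>\<xi>. \<phi> \<xi> * w_of Y \<xi>) + 0 * L2_norm (\<lambda>\<xi>. \<phi> \<xi> * h_of Y \<xi>)"
    proof (rule L2_dominated_sum(2)[OF q w h])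
      show "AE \<xi> in lborel. \<bar>\<phi> \<xi> * h_of (G \<gamma> Y) \<xi>\<bar> \<le> c3 * \<bar>\<phi> \<xi> * q_of Y \<xi>\<bar>
          + c4 * \<bar>\<phi> \<xi> * w_of Y \<xi>\<bar> + 0 * \<bar>\<phi> \<xi> * h_of Y \<xi>\<bar>"
        using ae
      proof eventually_elim
        case (elim \<xi>)
        have "2 * M * (\<bar>Q \<gamma> Y \<xi>\<bar> * \<bar>q_of Y \<xi>\<bar>) \<le> 2 * M * (B * \<bar>q_of Y \<xi>\<bar>)"
          using elim M by (intro mult_left_mono mult_right_mono) auto
        then have "\<bar>h_of (G \<gamma> Y) \<xi>\<bar> \<le> c3 * \<bar>q_of Y \<xi>\<bar> + c4 * \<bar>w_of Y \<xi>\<bar>"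
          using G_pointwise(3)[of Y \<xi> M \<gamma> B] elim by (simp add: c3_def c4_def)
        from mult_left_mono[OF this, of "\<bar>\<phi> \<xi>\<bar>"] show ?case
          by (simp add: abs_mult algebra_simps)
      qed
    qed (use pos in auto)
    let ?q = "L2_norm (\<lambda>\<xi>. \<phi> \<xi> * q_of Y \<xi>)" and ?w = "L2_norm (\<lambda>\<xi>. \<phi> \<xi> * w_of Y \<xi>)"
      and ?h = "L2_norm (\<lambda>\<xi>. \<phi> \<xi> * h_of Y \<xi>)"
    have "local_rate \<phi> (G \<gamma> Y) \<le> (c1 + c3) * ?q + (\<bar>\<gamma>\<bar> + c4) * ?w + c2 * ?h"
      unfolding local_rate_def using v' w' h' by (simp add: distrib_right)
    also have "\<dots> \<le> C * ?q + C * ?w + C * ?h"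
      using pos by (intro add_mono mult_right_mono) (auto simp: C_def)
    also have "\<dots> = C * local_norm \<phi> Y" by (simp add: local_norm_def distrib_left)
    finally show ?thesis .
  qed
  ultimately show ?thesis using that by blast
qed

text \<open>On a set of finite measure where \<open>\<bar>f\<bar> > c\<close>, the hypothesis gives \<open>\<integral> (f\<^sup>2 - c\<^sup>2) \<le> 0\<close>
  with a positive integrand, so the set is null.\<close>

lemma AE_bound_from_local_L2:
  assumes [measurable]: "f \<in> borel_measurable borel" and c: "0 \<le> c"
    and le: "\<And>A. A \<in> sets borel \<Longrightarrow> emeasure lborel A < \<infinity> \<Longrightarrow>
      (\<lambda>x. indicator A x * f x) \<in> L2 \<and> L2_norm (\<lambda>x. indicator A x * f x) \<le> c * sqrt (measure lborel A)"
  shows "AE x in lborel. \<bar>f x\<bar> \<le> c"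
proof -
  \<comment> \<open>the exceptional set, cut into pieces of finite measure\<close>
  define A where "A n = {x. c < \<bar>f x\<bar>} \<inter> {- real n..real n}" for n
  have A [measurable]: "A n \<in> sets borel" for n unfolding A_def by measurable
  have fin: "emeasure lborel (A n) < \<infinity>" for n
  proof -
    have "emeasure lborel (A n) \<le> emeasure lborel {- real n..real n}"
      by (intro emeasure_mono) (auto simp: A_def)
    also have "\<dots> < \<infinity>" by simp
    finally show ?thesis .
  qed
  have null: "AE x in lborel. x \<notin> A n" for n
  proof -
    note L = le[OF A fin, of n]
    let ?g = "\<lambda>x. indicator (A n) x * ((f x)\<^sup>2 - c\<^sup>2)"
    have i1: "integrable lborel (\<lambda>x. (indicator (A n) x * f x)\<^sup>2)" using L by (simp add: L2_def)
    have i2: "integrable lborel (\<lambda>x. indicator (A n) x * c\<^sup>2)" using A fin by auto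
    have g_eq: "?g = (\<lambda>x. (indicator (A n) x * f x)\<^sup>2 - indicator (A n) x * c\<^sup>2)"
      by (auto simp: indicator_def fun_eq_iff)
    have int: "integrable lborel ?g" unfolding g_eq using i1 i2 by auto
    have nonneg: "0 \<le> ?g x" for x
      using c by (auto simp: A_def indicator_def abs_le_square_iff[symmetric])
    have "(L2_norm (\<lambda>x. indicator (A n) x * f x))\<^sup>2 \<le> (c * sqrt (measure lborel (A n)))\<^sup>2"
      using L by (intro power_mono) auto
    then have "(LINT x|lborel. (indicator (A n) x * f x)\<^sup>2) \<le> c\<^sup>2 * measure lborel (A n)"
      by (simp add: L2_norm_def power_mult_distrib)
    then have "(LINT x|lborel. ?g x) \<le> 0"
      unfolding g_eq using i1 i2 A fin by (subst Bochner_Integration.integral_diff) (auto simp: mult.commute)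
    then have "(LINT x|lborel. ?g x) = 0"
      using nonneg by (intro antisym integral_nonneg) auto
    then have "AE x in lborel. ?g x = 0"
      using integral_nonneg_eq_0_iff_AE[OF int] nonneg by auto
    then show ?thesis
    proof eventually_elim
      case (elim x)
      have "c\<^sup>2 < (f x)\<^sup>2" if "x \<in> A n"
        using that c power_strict_mono[of c "\<bar>f x\<bar>" 2] by (simp add: A_def)
      then show ?case using elim by (auto simp: indicator_def split: if_splits)
    qed
  qed
  have "AE x in lborel. \<forall>n. x \<notin> A n" using null by (simp add: AE_all_countable)
  then show ?thesis
  proof eventually_elim
    case (elim x)
    obtain n where "\<bar>x\<bar> \<le> real n" using real_arch_simple by blast
    then show ?case using elim[rule_format, of n] by (auto simp: A_def)
  qed
qed

lemma indicator_L2: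
  assumes "A \<in> sets borel" "emeasure lborel A < \<infinity>"
  shows "indicator A \<in> L2" "L2_norm (indicator A) = sqrt (measure lborel A)"
proof -
  have eq: "(indicator A x :: real)\<^sup>2 = indicator A x" for x by (simp add: indicator_def)
  show "indicator A \<in> L2" "L2_norm (indicator A) = sqrt (measure lborel A)"
    using assms by (auto simp: L2_def L2_norm_def eq)
qed

text \<open>The Gronwall inequality on an arbitrary set \<open>A\<close> of finite measure bounds the \<open>L\<^sup>2\<close> norms on \<open>A\<close>
  by \<open>3 R exp (C T)\<close> times the square root of the measure of \<open>A\<close>, which is a pointwise bound.\<close>

lemma qwh_bounded:
  assumes M: "0 \<le> M" and T: "0 \<le> T" and R: "0 \<le> R"
  obtains B where "0 \<le> B"
    "\<And>Y. C1_F T Y (\<lambda>t. G \<gamma> (Y t)) \<Longrightarrow> (\<And>t. t \<in> {0..T} \<Longrightarrow> F_norm (Y t) \<le> M) \<Longrightarrow>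
       (\<forall>f\<in>{q_of, w_of, h_of}. f (Y 0) \<in> Linf \<and> Linf_norm (f (Y 0)) \<le> R) \<Longrightarrow>
       (\<forall>t\<in>{0..T}. \<forall>f\<in>{q_of, w_of, h_of}. f (Y t) \<in> Linf \<and> Linf_norm (f (Y t)) \<le> B)"
proof -
  obtain C where C: "0 \<le> C" "\<And>Y \<phi> b. Y \<in> F \<Longrightarrow> F_norm Y \<le> M \<Longrightarrow> \<phi> \<in> L2 \<Longrightarrow> (\<And>x. \<bar>\<phi> x\<bar> \<le> b) \<Longrightarrow>
    local_rate \<phi> (G \<gamma> Y) \<le> C * local_norm \<phi> Y"
    using local_rate_G[OF M, of \<gamma>] by metis
  define B where "B = 3 * R * exp (C * T)"
  have B: "0 \<le> B" using R by (simp add: B_def)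
  moreover have "f (Y t) \<in> Linf \<and> Linf_norm (f (Y t)) \<le> B"
    if sol: "C1_F T Y (\<lambda>t. G \<gamma> (Y t))" and YM: "\<And>t. t \<in> {0..T} \<Longrightarrow> F_norm (Y t) \<le> M"
      and init: "\<forall>f\<in>{q_of, w_of, h_of}. f (Y 0) \<in> Linf \<and> Linf_norm (f (Y 0)) \<le> R"
      and t: "t \<in> {0..T}" and f: "f \<in> {q_of, w_of, h_of}" for Y t f
  proof -
    have YF: "Y s \<in> F" if "s \<in> {0..T}" for s using sol that by (auto simp: C1_F_def)
    have Yt: "Y t \<in> F" by (rule YF[OF t])
    have meas: "f (Y t) \<in> borel_measurable borel" using state_measurable[OF Yt] f by auto
    have "AE x in lborel. \<bar>f (Y t) x\<bar> \<le> B"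
    proof (rule AE_bound_from_local_L2[OF meas B])
      fix A :: "real set" assume A: "A \<in> sets borel" "emeasure lborel A < \<infinity>"
      let ?\<phi> = "indicator A :: real \<Rightarrow> real"
      note \<phi> = indicator_L2(1)[OF A]
      have le1: "\<bar>?\<phi> x\<bar> \<le> 1" for x by (simp add: indicator_def)
      have "L2_norm (\<lambda>\<xi>. ?\<phi> \<xi> * g (Y 0) \<xi>) \<le> R * sqrt (measure lborel A)"
        if g: "g \<in> {q_of, w_of, h_of}" for g
      proof -
        have gL: "g (Y 0) \<in> Linf" "Linf_norm (g (Y 0)) \<le> R" using init g by auto
        have "AE \<xi> in lborel. \<bar>?\<phi> \<xi> * g (Y 0) \<xi>\<bar> \<le> \<bar>R * ?\<phi> \<xi>\<bar>"
          using AE_le_Linf_norm[OF gL(1)]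
          by eventually_elim (use gL(2) in \<open>auto simp: indicator_def\<close>)
        moreover have "(\<lambda>\<xi>. ?\<phi> \<xi> * g (Y 0) \<xi>) \<in> borel_measurable borel"
          using A Linf_measurable[OF gL(1)] by measurable
        ultimately have "L2_norm (\<lambda>\<xi>. ?\<phi> \<xi> * g (Y 0) \<xi>) \<le> L2_norm (\<lambda>\<xi>. R * ?\<phi> \<xi>)"
          by (intro L2_dominated(2) L2_scale(1)[OF \<phi>])
        then show ?thesis
          using R by (simp add: L2_scale(2)[OF \<phi>] indicator_L2(2)[OF A])
      qed
      from this[of q_of] this[of w_of] this[of h_of]
      have start: "local_norm ?\<phi> (Y 0) \<le> 3 * R * sqrt (measure lborel A)"
        unfolding local_norm_def by simp
      have "local_norm ?\<phi> (Y t) \<le> (local_norm ?\<phi> (Y 0) + 0 * t) * exp (C * t)"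
      proof (rule controlled_Gronwall[OF sol controlled_local_norm[OF \<phi> le1 zero_le_one] _ C(1) _ _ t])
        show "local_rate ?\<phi> (G \<gamma> (Y s)) \<le> C * local_norm ?\<phi> (Y s) + 0" if "s \<in> {0..T}" for s
          using C(2)[OF YF[OF that] YM[OF that] \<phi> le1] by simp
      qed auto
      also have "\<dots> \<le> (3 * R * sqrt (measure lborel A)) * exp (C * T)"
        using start t C(1) R by (intro mult_mono) (auto intro: mult_left_mono)
      finally have "local_norm ?\<phi> (Y t) \<le> B * sqrt (measure lborel A)"
        by (simp add: B_def mult_ac)
      moreover have "L2_norm (\<lambda>x. ?\<phi> x * f (Y t) x) \<le> local_norm ?\<phi> (Y t)"
        using f by (auto simp: local_norm_def)
      moreover have "(\<lambda>x. ?\<phi> x * f (Y t) x) \<in> L2"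
        using f q_of_local_L2[OF \<phi> le1 zero_le_one Yt]
          L2_mult_bounded(1)[OF _ L2_measurable[OF \<phi>] le1 zero_le_one] F_memD[OF Yt] by auto
      ultimately show "(\<lambda>x. indicator A x * f (Y t) x) \<in> L2 \<and>
          L2_norm (\<lambda>x. indicator A x * f (Y t) x) \<le> B * sqrt (measure lborel A)" by simp
    qed
    from Linf_boundI[OF meas this B] show ?thesis by simp
  qed
  ultimately show ?thesis using that by blast
qed

section \<open>Propagation of weighted square integrability\<close>

definition admissible_weight :: "(real \<Rightarrow> real) \<Rightarrow> real \<Rightarrow> bool" where
  "admissible_weight \<rho> K \<longleftrightarrow> \<rho> \<in> borel_measurable borel \<and> (\<forall>x. 1 \<le> \<rho> x) \<and> 1 \<le> K \<and>
     (\<forall>x y. \<rho> x \<le> K * \<rho> y * exp (\<bar>x - y\<bar> / 2))"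

lemma admissible_weightD:
  assumes "admissible_weight \<rho> K"
  shows "\<rho> \<in> borel_measurable borel" "1 \<le> \<rho> x" "0 \<le> \<rho> x" "1 \<le> K" "0 \<le> K" "\<rho> x \<le> K * \<rho> y * exp (\<bar>x - y\<bar> / 2)"
proof -
  have "1 \<le> \<rho> x" "1 \<le> K" using assms by (auto simp: admissible_weight_def)
  then show "1 \<le> \<rho> x" "0 \<le> \<rho> x" "1 \<le> K" "0 \<le> K" by linarith+
  show "\<rho> \<in> borel_measurable borel" "\<rho> x \<le> K * \<rho> y * exp (\<bar>x - y\<bar> / 2)"
    using assms by (auto simp: admissible_weight_def)
qed

lemma admissible_weight_min:
  assumes \<rho>: "admissible_weight \<rho> K" and n: "1 \<le> n"
  shows "admissible_weight (\<lambda>x. min (\<rho> x) n) K"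
  unfolding admissible_weight_def
proof (intro conjI allI)
  note [measurable] = admissible_weightD(1)[OF \<rho>]
  show "(\<lambda>x. min (\<rho> x) n) \<in> borel_measurable borel" by measurable
  show "1 \<le> min (\<rho> x) n" for x using admissible_weightD(2)[OF \<rho>] n by simp
  show K: "1 \<le> K" by (rule admissible_weightD(4)[OF \<rho>])
  fix x y
  have "1 \<le> K * exp (\<bar>x - y\<bar> / 2)" using mult_mono[of 1 K 1 "exp (\<bar>x - y\<bar> / 2)"] K by simp
  then have "n \<le> K * exp (\<bar>x - y\<bar> / 2) * n" using n mult_right_mono[of 1 _ n] by fastforce
  then show "min (\<rho> x) n \<le> K * min (\<rho> y) n * exp (\<bar>x - y\<bar> / 2)"
    using admissible_weightD(6)[OF \<rho>, of x y] by (auto simp: min_def ac_simps)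
qed

text \<open>Monotone convergence. The norms with the full weight may be infinite a priori, so the Gronwall inequality
  is applied with truncated weights, for which the seminorms are dominated by the \<open>F\<close> norm.\<close>

lemma nn_integral_le_of_truncations:
  fixes g :: "nat \<Rightarrow> real \<Rightarrow> ennreal"
  assumes [measurable]: "\<And>n. g n \<in> borel_measurable borel" and inc: "\<And>n x. g n x \<le> g (Suc n) x"
    and ev: "\<And>x. eventually (\<lambda>n. g n x = f x) sequentially"
    and le: "\<And>n. (\<integral>\<^sup>+x. g n x \<partial>lborel) \<le> c"
  shows "(\<integral>\<^sup>+x. f x \<partial>lborel) \<le> c"
proof -
  have "(\<lambda>n. \<integral>\<^sup>+x. g n x \<partial>lborel) \<longlonglongrightarrow> (\<integral>\<^sup>+x. f x \<partial>lborel)"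
  proof (rule nn_integral_LIMSEQ)
    show "incseq g" using inc by (auto simp: incseq_Suc_iff le_fun_def)
    show "(\<lambda>n. g n x) \<longlonglongrightarrow> f x" for x using ev by (rule tendsto_eventually)
  qed simp
  then show ?thesis using le by (intro LIMSEQ_le_const2) auto
qed

lemma weighted_L2_of_truncations:
  assumes \<rho>: "admissible_weight \<rho> K" and f: "f \<in> borel_measurable borel" and c: "0 \<le> c"
    and le: "\<And>n::nat. (\<lambda>x. min (\<rho> x) (1 + real n) * f x) \<in> L2 \<and>
      L2_norm (\<lambda>x. min (\<rho> x) (1 + real n) * f x) \<le> c"
  shows "(\<lambda>x. \<rho> x * f x) \<in> L2" "L2_norm (\<lambda>x. \<rho> x * f x) \<le> c"
proof -
  note [measurable] = admissible_weightD(1)[OF \<rho>] f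
  have "(\<integral>\<^sup>+x. ennreal ((\<rho> x * f x)\<^sup>2) \<partial>lborel) \<le> ennreal (c\<^sup>2)"
  proof (rule nn_integral_le_of_truncations)
    fix n :: nat and x
    show "ennreal ((min (\<rho> x) (1 + real n) * f x)\<^sup>2) \<le> ennreal ((min (\<rho> x) (1 + real (Suc n)) * f x)\<^sup>2)"
      using admissible_weightD(3)[OF \<rho>, of x]
      by (intro ennreal_leI) (auto simp: power_mult_distrib intro!: mult_right_mono power_mono)
    obtain m where "\<rho> x \<le> real m" using real_arch_simple by blast
    then show "eventually (\<lambda>n. ennreal ((min (\<rho> x) (1 + real n) * f x)\<^sup>2) = ennreal ((\<rho> x * f x)\<^sup>2)) sequentially"
      by (intro eventually_sequentiallyI[of m]) (simp add: min_def)
    show "(\<integral>\<^sup>+x. ennreal ((min (\<rho> x) (1 + real n) * f x)\<^sup>2) \<partial>lborel) \<le> ennreal (c\<^sup>2)"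
      using le[of n] by (subst L2_nn_integral) (auto intro!: ennreal_leI power_mono)
  qed measurable
  then show "(\<lambda>x. \<rho> x * f x) \<in> L2" "L2_norm (\<lambda>x. \<rho> x * f x) \<le> c"
    using c by (auto intro!: L2_boundI)
qed

definition weighted_part :: "(real \<Rightarrow> real) \<Rightarrow> state \<Rightarrow> real" where
  "weighted_part \<phi> Y = L2_norm (\<lambda>\<xi>. \<phi> \<xi> * U_of Y \<xi>) + L2_norm (\<lambda>\<xi>. \<phi> \<xi> * w_of Y \<xi>)
     + L2_norm (\<lambda>\<xi>. \<phi> \<xi> * h_of Y \<xi>)"

lemma weighted_part_nonneg: "0 \<le> weighted_part \<phi> Y"
  by (simp add: weighted_part_def)

lemma controlled_weighted_part:
  assumes "\<phi> \<in> borel_measurable borel" "\<And>x. \<bar>\<phi> x\<bar> \<le> b" "0 \<le> b"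
  shows "controlled (weighted_part \<phi>) (weighted_part \<phi>) (b + b + b)"
  unfolding weighted_part_def[abs_def]
  by (intro controlled_add controlled_L2_component[OF assms]) auto

text \<open>One factor of \<open>U\<^sup>2 q\<close> and the function \<open>q\<close> are bounded, the other factor \<open>U\<close> carries the weight. So the
  weighted source, and with it the weighted \<open>P\<close> and \<open>Q\<close>, are linearly bounded by the weighted \<open>U\<close>
  and \<open>h\<close>. The constant depends on the weight through \<open>K\<close> only, hence not on truncations.\<close>

lemma weighted_nonlocal:
  assumes M: "0 \<le> M" and R: "0 \<le> R" and K: "0 \<le> K"
  obtains D where "0 \<le> D"
    "\<And>Y \<phi> f. Y \<in> F \<Longrightarrow> F_norm Y \<le> M \<Longrightarrow> q_of Y \<in> Linf \<Longrightarrow> Linf_norm (q_of Y) \<le> R \<Longrightarrow>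
      admissible_weight \<phi> K \<Longrightarrow> (\<lambda>\<xi>. \<phi> \<xi> * U_of Y \<xi>) \<in> L2 \<Longrightarrow> (\<lambda>\<xi>. \<phi> \<xi> * h_of Y \<xi>) \<in> L2 \<Longrightarrow>
      f \<in> {source \<gamma> Y, P \<gamma> Y, Q \<gamma> Y} \<Longrightarrow>
      (\<lambda>\<xi>. \<phi> \<xi> * f \<xi>) \<in> L2 \<and> L2_norm (\<lambda>\<xi>. \<phi> \<xi> * f \<xi>) \<le> D * weighted_part \<phi> Y"
proof -
  obtain B where B: "0 \<le> B" and bnd: "\<And>Y. Y \<in> F \<Longrightarrow> F_norm Y \<le> M \<Longrightarrow> nonlocal_bounds \<gamma> M B Y"
    using bounded_state[OF M, of \<gamma>] by blast
  let ?a = "\<bar>3 - 2 * \<gamma>\<bar> / 2 * M * R" and ?b = "\<bar>\<gamma>\<bar> / 2"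
  define S where "S = ?a + ?b"
  have S: "0 \<le> S" using M R by (simp add: S_def)
  define D where "D = S + exp (2 * M) * (4 * K * S)"
  have D: "0 \<le> D" using S K by (simp add: D_def)
  moreover have "(\<lambda>\<xi>. \<phi> \<xi> * f \<xi>) \<in> L2 \<and> L2_norm (\<lambda>\<xi>. \<phi> \<xi> * f \<xi>) \<le> D * weighted_part \<phi> Y"
    if Y: "Y \<in> F" and YM: "F_norm Y \<le> M" and q: "q_of Y \<in> Linf" "Linf_norm (q_of Y) \<le> R"
      and \<phi>: "admissible_weight \<phi> K" and \<phi>U: "(\<lambda>\<xi>. \<phi> \<xi> * U_of Y \<xi>) \<in> L2"
      and \<phi>h: "(\<lambda>\<xi>. \<phi> \<xi> * h_of Y \<xi>) \<in> L2" and f: "f \<in> {source \<gamma> Y, P \<gamma> Y, Q \<gamma> Y}" for Y \<phi> f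
  proof -
    let ?W = "weighted_part \<phi> Y"
    note W = weighted_part_nonneg[of \<phi> Y]
    have src: "source \<gamma> Y \<in> L2" and U: "AE \<xi> in lborel. \<bar>U_of Y \<xi>\<bar> \<le> M"
      using bnd[OF Y YM] by (auto simp: nonlocal_bounds_def)
    note [measurable] = admissible_weightD(1)[OF \<phi>] state_measurable[OF Y] PQ_measurable[OF Y, of \<gamma>]
    have "AE \<xi> in lborel. \<bar>\<phi> \<xi> * source \<gamma> Y \<xi>\<bar>
        \<le> ?a * \<bar>\<phi> \<xi> * U_of Y \<xi>\<bar> + ?b * \<bar>\<phi> \<xi> * h_of Y \<xi>\<bar> + 0 * \<bar>\<phi> \<xi> * h_of Y \<xi>\<bar>"
      using U AE_le_Linf_norm[OF q(1)]
    proof eventually_elim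
      case (elim \<xi>)
      let ?u = "\<bar>U_of Y \<xi>\<bar>"
      have "?u * ?u * \<bar>q_of Y \<xi>\<bar> \<le> (M * ?u) * R"
        using elim q(2) M by (intro mult_mono) auto
      then have "\<bar>3 - 2 * \<gamma>\<bar> / 2 * ((U_of Y \<xi>)\<^sup>2 * \<bar>q_of Y \<xi>\<bar>) \<le> \<bar>3 - 2 * \<gamma>\<bar> / 2 * (M * ?u * R)"
        by (intro mult_left_mono) (auto simp: power2_eq_square)
      moreover have "\<bar>source \<gamma> Y \<xi>\<bar> \<le> \<bar>3 - 2 * \<gamma>\<bar> / 2 * ((U_of Y \<xi>)\<^sup>2 * \<bar>q_of Y \<xi>\<bar>) + ?b * \<bar>h_of Y \<xi>\<bar>"
        unfolding source_def by (intro order_trans[OF abs_triangle_ineq]) (simp add: abs_mult)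
      ultimately have "\<bar>source \<gamma> Y \<xi>\<bar> \<le> ?a * ?u + ?b * \<bar>h_of Y \<xi>\<bar>" by (simp add: mult_ac)
      from mult_left_mono[OF this, of "\<bar>\<phi> \<xi>\<bar>"] show ?case
        unfolding abs_mult distrib_left by (simp add: mult_ac)
    qed
    moreover have "0 \<le> ?a" "0 \<le> ?b" using M R by auto
    ultimately have \<phi>s: "(\<lambda>\<xi>. \<phi> \<xi> * source \<gamma> Y \<xi>) \<in> L2"
      and "L2_norm (\<lambda>\<xi>. \<phi> \<xi> * source \<gamma> Y \<xi>) \<le> ?a * L2_norm (\<lambda>\<xi>. \<phi> \<xi> * U_of Y \<xi>)
        + ?b * L2_norm (\<lambda>\<xi>. \<phi> \<xi> * h_of Y \<xi>) + 0 * L2_norm (\<lambda>\<xi>. \<phi> \<xi> * h_of Y \<xi>)"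
      using L2_dominated_sum[OF \<phi>U \<phi>h \<phi>h, of "\<lambda>\<xi>. \<phi> \<xi> * source \<gamma> Y \<xi>" ?a ?b 0] by auto
    note this(2)
    also have "\<dots> \<le> ?a * ?W + ?b * ?W + 0 * ?W"
      using M R by (intro add_mono mult_left_mono) (auto simp: weighted_part_def)
    finally have \<phi>s_le: "L2_norm (\<lambda>\<xi>. \<phi> \<xi> * source \<gamma> Y \<xi>) \<le> S * ?W" by (simp add: S_def distrib_right)
    have zeta: "AE \<xi> in lborel. \<bar>zeta_of Y \<xi>\<bar> \<le> M"
      using AE_le_Linf_norm[OF F_memD(1)[OF Y]]
      by eventually_elim (use F_norm_bounds(2)[of Y] YM in linarith)
    note PQ = PQ_le_exp_conv[OF Y src zeta]
    note conv = exp_conv_weighted[OF src admissible_weightD(1)[OF \<phi>] \<phi>s admissible_weightD(3)[OF \<phi>] K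
        admissible_weightD(6)[OF \<phi>]]
    note sc = L2_scale[OF conv(1), of "exp (2 * M)"]
    have conv_le: "L2_norm (\<lambda>\<xi>. \<phi> \<xi> * exp_conv (source \<gamma> Y) \<xi>) \<le> 4 * K * (S * ?W)"
      using conv(2) mult_left_mono[OF \<phi>s_le, of "4 * K"] K by linarith
    show ?thesis
    proof (cases "f = source \<gamma> Y")
      case True
      have "S * ?W \<le> D * ?W" using W K S by (intro mult_right_mono) (auto simp: D_def)
      then show ?thesis using True \<phi>s \<phi>s_le by auto
    next
      case False
      then have PQf: "f = P \<gamma> Y \<or> f = Q \<gamma> Y" using f by simp
      then have fm: "f \<in> borel_measurable borel" using PQ_measurable[OF Y, of \<gamma>] by auto
      have "AE \<xi> in lborel. \<bar>f \<xi>\<bar> \<le> exp (2 * M) * exp_conv (source \<gamma> Y) \<xi>"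
        using PQ by eventually_elim (use PQf in auto)
      then have dom: "AE \<xi> in lborel. \<bar>\<phi> \<xi> * f \<xi>\<bar> \<le> \<bar>exp (2 * M) * (\<phi> \<xi> * exp_conv (source \<gamma> Y) \<xi>)\<bar>"
      proof eventually_elim
        case (elim \<xi>)
        from mult_left_mono[OF this, of "\<bar>\<phi> \<xi>\<bar>"] show ?case
          by (simp add: abs_mult exp_conv_nonneg mult_ac)
      qed
      have "(\<lambda>\<xi>. \<phi> \<xi> * f \<xi>) \<in> borel_measurable borel" using fm by measurable
      note d = L2_dominated[OF sc(1) this dom]
      note d(2)
      also have "L2_norm (\<lambda>\<xi>. exp (2 * M) * (\<phi> \<xi> * exp_conv (source \<gamma> Y) \<xi>)) \<le> exp (2 * M) * (4 * K * (S * ?W))"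
        unfolding sc(2) abs_exp_cancel by (intro mult_left_mono conv_le) simp
      also have "\<dots> \<le> D * ?W"
      proof -
        have "D * ?W = S * ?W + exp (2 * M) * (4 * K * (S * ?W))" by (simp add: D_def algebra_simps)
        moreover have "0 \<le> S * ?W" using W S by simp
        ultimately show ?thesis by linarith
      qed
      finally show ?thesis using d(1) by simp
    qed
  qed
  ultimately show ?thesis using that by blast
qed

text \<open>Each term of \<open>U\<^sub>t\<close>, \<open>w\<^sub>t\<close>, \<open>h\<^sub>t\<close> is a bounded function times one of the source, \<open>P\<close>, \<open>Q\<close>, \<open>w\<close>; the weight
  goes to this last factor.\<close>

lemma weighted_rate_G:
  assumes M: "0 \<le> M" and R: "0 \<le> R" and K: "0 \<le> K"
  obtains C where "0 \<le> C"
    "\<And>Y \<phi>. Y \<in> F \<Longrightarrow> F_norm Y \<le> M \<Longrightarrow> q_of Y \<in> Linf \<Longrightarrow> Linf_norm (q_of Y) \<le> R \<Longrightarrow>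
      admissible_weight \<phi> K \<Longrightarrow> (\<lambda>\<xi>. \<phi> \<xi> * U_of Y \<xi>) \<in> L2 \<Longrightarrow> (\<lambda>\<xi>. \<phi> \<xi> * w_of Y \<xi>) \<in> L2 \<Longrightarrow>
      (\<lambda>\<xi>. \<phi> \<xi> * h_of Y \<xi>) \<in> L2 \<Longrightarrow> weighted_part \<phi> (G \<gamma> Y) \<le> C * weighted_part \<phi> Y"
proof -
  obtain B where B: "0 \<le> B" and bnd: "\<And>Y. Y \<in> F \<Longrightarrow> F_norm Y \<le> M \<Longrightarrow> nonlocal_bounds \<gamma> M B Y"
    using bounded_state[OF M, of \<gamma>] by blast
  obtain D where D: "0 \<le> D" and nl: "\<And>Y \<phi> f. Y \<in> F \<Longrightarrow> F_norm Y \<le> M \<Longrightarrow> q_of Y \<in> Linf \<Longrightarrow> Linf_norm (q_of Y) \<le> R \<Longrightarrow>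
      admissible_weight \<phi> K \<Longrightarrow> (\<lambda>\<xi>. \<phi> \<xi> * U_of Y \<xi>) \<in> L2 \<Longrightarrow> (\<lambda>\<xi>. \<phi> \<xi> * h_of Y \<xi>) \<in> L2 \<Longrightarrow>
      f \<in> {source \<gamma> Y, P \<gamma> Y, Q \<gamma> Y} \<Longrightarrow>
      (\<lambda>\<xi>. \<phi> \<xi> * f \<xi>) \<in> L2 \<and> L2_norm (\<lambda>\<xi>. \<phi> \<xi> * f \<xi>) \<le> D * weighted_part \<phi> Y"
    using weighted_nonlocal[OF M R K, of \<gamma>] by blast
  define c where "c = 3 * M\<^sup>2 + 2 * B"
  have c: "0 \<le> c" using B by (simp add: c_def)
  define C where "C = D + (D + R * D) + (2 * M * R * D + c)"
  have "0 \<le> C" using D M R c by (simp add: C_def)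
  moreover have "weighted_part \<phi> (G \<gamma> Y) \<le> C * weighted_part \<phi> Y"
    if Y: "Y \<in> F" and YM: "F_norm Y \<le> M" and q: "q_of Y \<in> Linf" "Linf_norm (q_of Y) \<le> R"
      and \<phi>: "admissible_weight \<phi> K" and \<phi>U: "(\<lambda>\<xi>. \<phi> \<xi> * U_of Y \<xi>) \<in> L2"
      and \<phi>w: "(\<lambda>\<xi>. \<phi> \<xi> * w_of Y \<xi>) \<in> L2" and \<phi>h: "(\<lambda>\<xi>. \<phi> \<xi> * h_of Y \<xi>) \<in> L2" for Y \<phi>
  proof -
    let ?W = "weighted_part \<phi> Y"
    have ae: "AE \<xi> in lborel. \<bar>U_of Y \<xi>\<bar> \<le> M \<and> \<bar>P \<gamma> Y \<xi>\<bar> \<le> B \<and> \<bar>q_of Y \<xi>\<bar> \<le> R"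
    proof -
      have "AE \<xi> in lborel. \<bar>U_of Y \<xi>\<bar> \<le> M \<and> \<bar>P \<gamma> Y \<xi>\<bar> \<le> B"
        using bnd[OF Y YM] by (auto simp: nonlocal_bounds_def)
      then show ?thesis
        using AE_le_Linf_norm[OF q(1)] by eventually_elim (use q(2) in auto)
    qed
    note [measurable] = admissible_weightD(1)[OF \<phi>] G_measurable[OF Y, of \<gamma>]
    note nl' = nl[OF Y YM q \<phi> \<phi>U \<phi>h]
    have s: "(\<lambda>\<xi>. \<phi> \<xi> * source \<gamma> Y \<xi>) \<in> L2" "L2_norm (\<lambda>\<xi>. \<phi> \<xi> * source \<gamma> Y \<xi>) \<le> D * ?W"
      and P: "(\<lambda>\<xi>. \<phi> \<xi> * P \<gamma> Y \<xi>) \<in> L2" "L2_norm (\<lambda>\<xi>. \<phi> \<xi> * P \<gamma> Y \<xi>) \<le> D * ?W"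
      and Q: "(\<lambda>\<xi>. \<phi> \<xi> * Q \<gamma> Y \<xi>) \<in> L2" "L2_norm (\<lambda>\<xi>. \<phi> \<xi> * Q \<gamma> Y \<xi>) \<le> D * ?W"
      using nl'[of "source \<gamma> Y"] nl'[of "P \<gamma> Y"] nl'[of "Q \<gamma> Y"] by auto
    have eq: "(\<lambda>\<xi>. \<phi> \<xi> * (- 1 * Q \<gamma> Y \<xi>)) = (\<lambda>\<xi>. - 1 * (\<phi> \<xi> * Q \<gamma> Y \<xi>))" by auto
    have U': "L2_norm (\<lambda>\<xi>. \<phi> \<xi> * U_of (G \<gamma> Y) \<xi>) \<le> D * ?W"
      unfolding G_components eq L2_scale(2)[OF Q(1)] using Q(2) by simp
    have w': "L2_norm (\<lambda>\<xi>. \<phi> \<xi> * w_of (G \<gamma> Y) \<xi>) \<le> (D + R * D) * ?W"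
    proof -
      have "AE \<xi> in lborel. \<bar>\<phi> \<xi> * w_of (G \<gamma> Y) \<xi>\<bar>
          \<le> 1 * \<bar>\<phi> \<xi> * source \<gamma> Y \<xi>\<bar> + R * \<bar>\<phi> \<xi> * P \<gamma> Y \<xi>\<bar> + 0 * \<bar>\<phi> \<xi> * P \<gamma> Y \<xi>\<bar>"
        using ae
      proof eventually_elim
        case (elim \<xi>)
        have "\<bar>w_of (G \<gamma> Y) \<xi>\<bar> \<le> \<bar>source \<gamma> Y \<xi>\<bar> + \<bar>P \<gamma> Y \<xi>\<bar> * R"
          using G_pointwise(2)[of Y \<xi> M \<gamma> B] elim mult_left_mono[of "\<bar>q_of Y \<xi>\<bar>" R "\<bar>P \<gamma> Y \<xi>\<bar>"] by auto
        from mult_left_mono[OF this, of "\<bar>\<phi> \<xi>\<bar>"] show ?case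
          unfolding abs_mult distrib_left by (simp add: mult_ac)
      qed
      then have "L2_norm (\<lambda>\<xi>. \<phi> \<xi> * w_of (G \<gamma> Y) \<xi>) \<le> 1 * L2_norm (\<lambda>\<xi>. \<phi> \<xi> * source \<gamma> Y \<xi>)
          + R * L2_norm (\<lambda>\<xi>. \<phi> \<xi> * P \<gamma> Y \<xi>) + 0 * L2_norm (\<lambda>\<xi>. \<phi> \<xi> * P \<gamma> Y \<xi>)"
        by (rule L2_dominated_sum(2)[OF s(1) P(1) P(1), rotated]) (use R in auto)
      also have "\<dots> \<le> 1 * (D * ?W) + R * (D * ?W) + 0"
        using s(2) P(2) R by (intro add_mono mult_left_mono) auto
      finally show ?thesis by (simp add: distrib_right mult.assoc)
    qed
    have h': "L2_norm (\<lambda>\<xi>. \<phi> \<xi> * h_of (G \<gamma> Y) \<xi>) \<le> (2 * M * R * D + c) * ?W"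
    proof -
      have "AE \<xi> in lborel. \<bar>\<phi> \<xi> * h_of (G \<gamma> Y) \<xi>\<bar>
          \<le> 2 * M * R * \<bar>\<phi> \<xi> * Q \<gamma> Y \<xi>\<bar> + c * \<bar>\<phi> \<xi> * w_of Y \<xi>\<bar> + 0 * \<bar>\<phi> \<xi> * w_of Y \<xi>\<bar>"
        using ae
      proof eventually_elim
        case (elim \<xi>)
        have "2 * M * (\<bar>Q \<gamma> Y \<xi>\<bar> * \<bar>q_of Y \<xi>\<bar>) \<le> 2 * M * (\<bar>Q \<gamma> Y \<xi>\<bar> * R)"
          using elim M by (intro mult_left_mono) auto
        then have "\<bar>h_of (G \<gamma> Y) \<xi>\<bar> \<le> 2 * M * (\<bar>Q \<gamma> Y \<xi>\<bar> * R) + c * \<bar>w_of Y \<xi>\<bar>"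
          using G_pointwise(3)[of Y \<xi> M \<gamma> B] elim by (auto simp: c_def)
        from mult_left_mono[OF this, of "\<bar>\<phi> \<xi>\<bar>"] show ?case
          unfolding abs_mult distrib_left by (simp add: mult_ac)
      qed
      then have "L2_norm (\<lambda>\<xi>. \<phi> \<xi> * h_of (G \<gamma> Y) \<xi>) \<le> 2 * M * R * L2_norm (\<lambda>\<xi>. \<phi> \<xi> * Q \<gamma> Y \<xi>)
          + c * L2_norm (\<lambda>\<xi>. \<phi> \<xi> * w_of Y \<xi>) + 0 * L2_norm (\<lambda>\<xi>. \<phi> \<xi> * w_of Y \<xi>)"
        by (rule L2_dominated_sum(2)[OF Q(1) \<phi>w \<phi>w, rotated]) (use M R c in auto)
      also have "\<dots> \<le> 2 * M * R * (D * ?W) + c * ?W + 0"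
        using Q(2) M R c by (intro add_mono mult_left_mono) (auto simp: weighted_part_def)
      finally show ?thesis by (simp add: distrib_right mult.assoc)
    qed
    show ?thesis
      using U' w' h' unfolding weighted_part_def[of \<phi> "G \<gamma> Y"] C_def distrib_right by linarith
  qed
  ultimately show ?thesis using that by blast
qed

text \<open>The bound \<open>W exp (C T)\<close> from the Gronwall inequality is uniform in the truncations of the weight.\<close>

lemma weighted_L2_propagation:
  assumes M: "0 \<le> M" and T: "0 \<le> T" and R: "0 \<le> R" and W: "0 \<le> W" and K: "0 \<le> K"
  obtains B where "0 \<le> B"
    "\<And>Y \<rho> t f. C1_F T Y (\<lambda>t. G \<gamma> (Y t)) \<Longrightarrow>
       (\<forall>t\<in>{0..T}. F_norm (Y t) \<le> M \<and> q_of (Y t) \<in> Linf \<and> Linf_norm (q_of (Y t)) \<le> R) \<Longrightarrow>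
       admissible_weight \<rho> K \<Longrightarrow>
       (\<forall>f\<in>{U_of, w_of, h_of}. (\<lambda>\<xi>. \<rho> \<xi> * f (Y 0) \<xi>) \<in> L2) \<Longrightarrow> weighted_part \<rho> (Y 0) \<le> W \<Longrightarrow>
       t \<in> {0..T} \<Longrightarrow> f \<in> {U_of, w_of, h_of} \<Longrightarrow>
       (\<lambda>\<xi>. \<rho> \<xi> * f (Y t) \<xi>) \<in> L2 \<and> L2_norm (\<lambda>\<xi>. \<rho> \<xi> * f (Y t) \<xi>) \<le> B"
proof -
  obtain C where C: "0 \<le> C" and rate: "\<And>Y \<phi>. Y \<in> F \<Longrightarrow> F_norm Y \<le> M \<Longrightarrow> q_of Y \<in> Linf \<Longrightarrow> Linf_norm (q_of Y) \<le> R \<Longrightarrow>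
      admissible_weight \<phi> K \<Longrightarrow> (\<lambda>\<xi>. \<phi> \<xi> * U_of Y \<xi>) \<in> L2 \<Longrightarrow> (\<lambda>\<xi>. \<phi> \<xi> * w_of Y \<xi>) \<in> L2 \<Longrightarrow>
      (\<lambda>\<xi>. \<phi> \<xi> * h_of Y \<xi>) \<in> L2 \<Longrightarrow> weighted_part \<phi> (G \<gamma> Y) \<le> C * weighted_part \<phi> Y"
    using weighted_rate_G[OF M R K, of \<gamma>] by blast
  define B where "B = W * exp (C * T)"
  have B: "0 \<le> B" using W by (simp add: B_def)
  moreover have "(\<lambda>\<xi>. \<rho> \<xi> * f (Y t) \<xi>) \<in> L2 \<and> L2_norm (\<lambda>\<xi>. \<rho> \<xi> * f (Y t) \<xi>) \<le> B"
    if sol: "C1_F T Y (\<lambda>t. G \<gamma> (Y t))"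
      and YM: "\<forall>t\<in>{0..T}. F_norm (Y t) \<le> M \<and> q_of (Y t) \<in> Linf \<and> Linf_norm (q_of (Y t)) \<le> R"
      and \<rho>: "admissible_weight \<rho> K" and init: "\<forall>f\<in>{U_of, w_of, h_of}. (\<lambda>\<xi>. \<rho> \<xi> * f (Y 0) \<xi>) \<in> L2"
      and init_le: "weighted_part \<rho> (Y 0) \<le> W"
      and t: "t \<in> {0..T}" and f: "f \<in> {U_of, w_of, h_of}" for Y \<rho> t f
  proof -
    have YF: "Y s \<in> F" if "s \<in> {0..T}" for s using sol that by (auto simp: C1_F_def)
    note [measurable] = admissible_weightD(1)[OF \<rho>]
    have meas: "f (Y s) \<in> borel_measurable borel" if "s \<in> {0..T}" "f \<in> {U_of, w_of, h_of}" for s f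
      using state_measurable[OF YF[OF that(1)]] that(2) by auto
    have trunc: "(\<lambda>x. min (\<rho> x) (1 + real n) * f (Y t) x) \<in> L2 \<and>
      L2_norm (\<lambda>x. min (\<rho> x) (1 + real n) * f (Y t) x) \<le> B" for n :: nat
    proof -
      let ?\<phi> = "\<lambda>x. min (\<rho> x) (1 + real n)"
      have \<phi>: "admissible_weight ?\<phi> K" by (rule admissible_weight_min[OF \<rho>]) simp
      have \<phi>b: "\<bar>?\<phi> x\<bar> \<le> 1 + real n" for x using admissible_weightD(3)[OF \<rho>, of x] by auto
      have mem: "(\<lambda>x. ?\<phi> x * f (Y s) x) \<in> L2" if "s \<in> {0..T}" "f \<in> {U_of, w_of, h_of}" for s f
        using F_memD[OF YF[OF that(1)]] that(2)
        by (intro L2_mult_bounded(1)[OF _ admissible_weightD(1)[OF \<phi>] \<phi>b]) auto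
      have t0: "0 \<in> {0..T}" using T by simp
      have "L2_norm (\<lambda>x. ?\<phi> x * f (Y 0) x) \<le> L2_norm (\<lambda>x. \<rho> x * f (Y 0) x)" if f: "f \<in> {U_of, w_of, h_of}" for f
      proof (rule L2_dominated(2))
        show "(\<lambda>x. \<rho> x * f (Y 0) x) \<in> L2" using init f by blast
        show "(\<lambda>x. ?\<phi> x * f (Y 0) x) \<in> borel_measurable borel" by (rule L2_measurable[OF mem[OF t0 f]])
        show "AE x in lborel. \<bar>?\<phi> x * f (Y 0) x\<bar> \<le> \<bar>\<rho> x * f (Y 0) x\<bar>"
          using admissible_weightD(3)[OF \<rho>] by (auto simp: abs_mult intro!: mult_right_mono)
      qed
      from this[of U_of] this[of w_of] this[of h_of] init_le
      have start: "weighted_part ?\<phi> (Y 0) \<le> W" by (simp add: weighted_part_def)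
      have "weighted_part ?\<phi> (Y t) \<le> (weighted_part ?\<phi> (Y 0) + 0 * t) * exp (C * t)"
      proof (rule controlled_Gronwall[OF sol controlled_weighted_part[OF admissible_weightD(1)[OF \<phi>] \<phi>b] _ C _ _ t])
        show "weighted_part ?\<phi> (G \<gamma> (Y s)) \<le> C * weighted_part ?\<phi> (Y s) + 0" if s: "s \<in> {0..T}" for s
          using rate[OF YF[OF s] _ _ _ \<phi>] YM s mem[OF s] by auto
      qed auto
      also have "\<dots> \<le> W * exp (C * T)"
        using start t C W by (intro mult_mono) (auto intro: mult_left_mono)
      finally have "weighted_part ?\<phi> (Y t) \<le> B" by (simp add: B_def)
      moreover have "L2_norm (\<lambda>x. ?\<phi> x * f (Y t) x) \<le> weighted_part ?\<phi> (Y t)"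
        using f by (auto simp: weighted_part_def)
      ultimately show ?thesis using mem[OF t f] by simp
    qed
    from weighted_L2_of_truncations[OF \<rho> meas[OF t f] B trunc] show ?thesis by simp
  qed
  ultimately show ?thesis using that by blast
qed

section \<open>Propagation of the weighted integrability of h\<close>

lemma controlled_L1_h:
  assumes "\<phi> \<in> L2"
  shows "controlled (\<lambda>Y. L1_norm (\<lambda>\<xi>. \<phi> \<xi> * h_of Y \<xi>)) (\<lambda>Y. L1_norm (\<lambda>\<xi>. \<phi> \<xi> * h_of Y \<xi>)) (L2_norm \<phi>)"
proof (rule controlled_component[OF L1_weighted_seminorm[OF assms], of h_of h_of])
  fix X assume X: "X \<in> F"
  show "h_of X \<in> L2" "h_of X \<in> L2" using F_memD[OF X] by auto
  have "L1_norm (\<lambda>x. \<phi> x * h_of X x) \<le> L2_norm \<phi> * L2_norm (h_of X)"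
    by (rule L2_Cauchy_Schwarz(2)[OF assms F_memD(7)[OF X]])
  also have "\<dots> \<le> L2_norm \<phi> * F_norm X" by (intro mult_left_mono F_norm_bounds) simp
  finally show "L1_norm (\<lambda>x. \<phi> x * h_of X x) \<le> L2_norm \<phi> * F_norm X" .
qed (auto simp: F_minus_def F_scale_def)

text \<open>By the Cauchy-Schwarz inequality: up to bounded factors, \<open>\<rho>\<^sup>2 h\<^sub>t\<close> is a sum of the products
  \<open>\<rho>Q \<rho>U\<close>, \<open>\<rho>U \<rho>w\<close> and \<open>\<rho>P \<rho>w\<close>.\<close>

lemma h_rate_L1:
  assumes Y: "Y \<in> F" and R: "0 \<le> R" and M: "0 \<le> M"
    and U: "AE \<xi> in lborel. \<bar>U_of Y \<xi>\<bar> \<le> M" and q: "AE \<xi> in lborel. \<bar>q_of Y \<xi>\<bar> \<le> R"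
    and L2: "\<And>f. f \<in> {U_of Y, w_of Y, P \<gamma> Y, Q \<gamma> Y} \<Longrightarrow> (\<lambda>\<xi>. \<rho> \<xi> * f \<xi>) \<in> L2 \<and> L2_norm (\<lambda>\<xi>. \<rho> \<xi> * f \<xi>) \<le> W"
    and \<phi>: "\<And>\<xi>. \<bar>\<phi> \<xi>\<bar> \<le> (\<rho> \<xi>)\<^sup>2"
  shows "L1_norm (\<lambda>\<xi>. \<phi> \<xi> * h_of (G \<gamma> Y) \<xi>) \<le> (2 * R + 3 * M + 2) * W\<^sup>2"
proof -
  let ?U = "\<lambda>\<xi>. \<rho> \<xi> * U_of Y \<xi>" and ?w = "\<lambda>\<xi>. \<rho> \<xi> * w_of Y \<xi>"
    and ?P = "\<lambda>\<xi>. \<rho> \<xi> * P \<gamma> Y \<xi>" and ?Q = "\<lambda>\<xi>. \<rho> \<xi> * Q \<gamma> Y \<xi>"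
  have W: "0 \<le> W" using L2[of "U_of Y"] order_trans[OF L2_norm_nonneg[of ?U]] by blast
  have pair: "integrable lborel (\<lambda>\<xi>. \<bar>(\<rho> \<xi> * f \<xi>) * (\<rho> \<xi> * g \<xi>)\<bar>)"
    "(LINT \<xi>|lborel. \<bar>(\<rho> \<xi> * f \<xi>) * (\<rho> \<xi> * g \<xi>)\<bar>) \<le> W\<^sup>2"
    if "f \<in> {U_of Y, w_of Y, P \<gamma> Y, Q \<gamma> Y}" "g \<in> {U_of Y, w_of Y, P \<gamma> Y, Q \<gamma> Y}" for f g
  proof -
    note f = L2[OF that(1)] and g = L2[OF that(2)]
    note cs = L2_Cauchy_Schwarz[OF conjunct1[OF f] conjunct1[OF g]]
    show "integrable lborel (\<lambda>\<xi>. \<bar>(\<rho> \<xi> * f \<xi>) * (\<rho> \<xi> * g \<xi>)\<bar>)"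
      using cs(1) unfolding L1_def mem_Collect_eq by (rule integrable_abs)
    have "L1_norm (\<lambda>\<xi>. (\<rho> \<xi> * f \<xi>) * (\<rho> \<xi> * g \<xi>)) \<le> W * W"
      using f g W by (intro order_trans[OF cs(2)] mult_mono) auto
    then show "(LINT \<xi>|lborel. \<bar>(\<rho> \<xi> * f \<xi>) * (\<rho> \<xi> * g \<xi>)\<bar>) \<le> W\<^sup>2"
      unfolding L1_norm_def power2_eq_square .
  qed
  note QU = pair[of "Q \<gamma> Y" "U_of Y"] and Uw = pair[of "U_of Y" "w_of Y"] and Pw = pair[of "P \<gamma> Y" "w_of Y"]
  let ?B = "\<lambda>\<xi>. 2 * R * \<bar>?Q \<xi> * ?U \<xi>\<bar> + 3 * M * \<bar>?U \<xi> * ?w \<xi>\<bar> + 2 * \<bar>?P \<xi> * ?w \<xi>\<bar>"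
  have "AE \<xi> in lborel. \<bar>\<phi> \<xi> * h_of (G \<gamma> Y) \<xi>\<bar> \<le> ?B \<xi>"
    using U q
  proof eventually_elim
    case (elim \<xi>)
    let ?u = "\<bar>U_of Y \<xi>\<bar>"
    have "\<bar>h_of (G \<gamma> Y) \<xi>\<bar> \<le> 2 * (\<bar>Q \<gamma> Y \<xi>\<bar> * ?u * \<bar>q_of Y \<xi>\<bar>) + \<bar>3 * (U_of Y \<xi>)\<^sup>2 - 2 * P \<gamma> Y \<xi>\<bar> * \<bar>w_of Y \<xi>\<bar>"
      unfolding G_components by (intro order_trans[OF abs_triangle_ineq]) (simp add: abs_mult)
    moreover have "\<bar>Q \<gamma> Y \<xi>\<bar> * ?u * \<bar>q_of Y \<xi>\<bar> \<le> \<bar>Q \<gamma> Y \<xi>\<bar> * ?u * R"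
      using elim by (intro mult_left_mono) auto
    moreover have "\<bar>3 * (U_of Y \<xi>)\<^sup>2 - 2 * P \<gamma> Y \<xi>\<bar> * \<bar>w_of Y \<xi>\<bar> \<le> (3 * (M * ?u) + 2 * \<bar>P \<gamma> Y \<xi>\<bar>) * \<bar>w_of Y \<xi>\<bar>"
    proof (rule mult_right_mono)
      have "(U_of Y \<xi>)\<^sup>2 \<le> M * ?u" using mult_right_mono[OF elim(1), of ?u] by (simp add: power2_eq_square)
      moreover have "0 \<le> (U_of Y \<xi>)\<^sup>2" by simp
      ultimately show "\<bar>3 * (U_of Y \<xi>)\<^sup>2 - 2 * P \<gamma> Y \<xi>\<bar> \<le> 3 * (M * ?u) + 2 * \<bar>P \<gamma> Y \<xi>\<bar>" by linarith
    qed simp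
    ultimately have h: "\<bar>h_of (G \<gamma> Y) \<xi>\<bar> \<le> 2 * (\<bar>Q \<gamma> Y \<xi>\<bar> * ?u * R)
        + (3 * (M * ?u) + 2 * \<bar>P \<gamma> Y \<xi>\<bar>) * \<bar>w_of Y \<xi>\<bar>" by linarith
    have "\<bar>\<phi> \<xi> * h_of (G \<gamma> Y) \<xi>\<bar> \<le> (\<rho> \<xi>)\<^sup>2 * (2 * (\<bar>Q \<gamma> Y \<xi>\<bar> * ?u * R)
        + (3 * (M * ?u) + 2 * \<bar>P \<gamma> Y \<xi>\<bar>) * \<bar>w_of Y \<xi>\<bar>)"
      unfolding abs_mult by (intro mult_mono \<phi> h) auto
    also have "\<dots> = ?B \<xi>"
      by (simp add: abs_mult power2_eq_square abs_mult_self_eq[of "\<rho> \<xi>", symmetric] algebra_simps del: abs_mult_self_eq)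
    finally show ?case .
  qed
  moreover have "integrable lborel ?B"
    using QU(1) Uw(1) Pw(1) by (intro Bochner_Integration.integrable_add integrable_mult_right) auto
  ultimately have "L1_norm (\<lambda>\<xi>. \<phi> \<xi> * h_of (G \<gamma> Y) \<xi>) \<le> (LINT \<xi>|lborel. ?B \<xi>)"
    unfolding L1_norm_def by (intro integral_mono_AE') auto
  also have "\<dots> = 2 * R * (LINT \<xi>|lborel. \<bar>?Q \<xi> * ?U \<xi>\<bar>) + 3 * M * (LINT \<xi>|lborel. \<bar>?U \<xi> * ?w \<xi>\<bar>)
      + 2 * (LINT \<xi>|lborel. \<bar>?P \<xi> * ?w \<xi>\<bar>)"
    using QU(1) Uw(1) Pw(1) by simp
  also have "\<dots> \<le> 2 * R * W\<^sup>2 + 3 * M * W\<^sup>2 + 2 * W\<^sup>2"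
    using QU(2) Uw(2) Pw(2) R M by (intro add_mono mult_left_mono) auto
  finally show ?thesis by (simp add: distrib_right)
qed

text \<open>The weight is truncated both in height and to a bounded interval, because only square
  integrability of \<open>h\<close> is known a priori.\<close>

lemma weighted_L1_propagation:
  assumes \<rho>: "admissible_weight \<rho> K" and sol: "C1_F T Y (\<lambda>t. G \<gamma> (Y t))" and T: "0 \<le> T"
    and rate: "\<And>t \<phi>. t \<in> {0..T} \<Longrightarrow> (\<And>\<xi>. \<bar>\<phi> \<xi>\<bar> \<le> (\<rho> \<xi>)\<^sup>2) \<Longrightarrow>
       L1_norm (\<lambda>\<xi>. \<phi> \<xi> * h_of (G \<gamma> (Y t)) \<xi>) \<le> D" and D: "0 \<le> D"
    and init: "(\<lambda>\<xi>. (\<rho> \<xi>)\<^sup>2 * h_of (Y 0) \<xi>) \<in> L1" and t: "t \<in> {0..T}"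
  shows "(\<lambda>\<xi>. (\<rho> \<xi>)\<^sup>2 * h_of (Y t) \<xi>) \<in> L1"
    "L1_norm (\<lambda>\<xi>. (\<rho> \<xi>)\<^sup>2 * h_of (Y t) \<xi>) \<le> L1_norm (\<lambda>\<xi>. (\<rho> \<xi>)\<^sup>2 * h_of (Y 0) \<xi>) + D * T"
proof -
  let ?H = "L1_norm (\<lambda>\<xi>. (\<rho> \<xi>)\<^sup>2 * h_of (Y 0) \<xi>)"
  have YF: "Y s \<in> F" if "s \<in> {0..T}" for s using sol that by (auto simp: C1_F_def)
  note h = F_memD(7)[OF YF]
  have t0: "0 \<in> {0..T}" using T by simp
  note [measurable] = admissible_weightD(1)[OF \<rho>] L2_measurable[OF h[OF t]] L2_measurable[OF h[OF t0]]
  define \<phi> :: "nat \<Rightarrow> real \<Rightarrow> real"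
    where "\<phi> n x = (min (\<rho> x) (1 + real n))\<^sup>2 * indicator {- real n..real n} x" for n x
  have [measurable]: "\<phi> n \<in> borel_measurable borel" for n unfolding \<phi>_def[abs_def] by measurable
  have \<phi>_pos: "0 \<le> \<phi> n x" for n x by (simp add: \<phi>_def)
  have \<phi>_le: "\<bar>\<phi> n x\<bar> \<le> (\<rho> x)\<^sup>2" for n x
    using admissible_weightD(3)[OF \<rho>, of x] by (auto simp: \<phi>_def indicator_def intro!: power_mono)
  have \<phi>_L2: "\<phi> n \<in> L2" for n
    unfolding \<phi>_def[abs_def]
  proof (rule L2_mult_bounded(1))
    show "\<bar>(min (\<rho> x) (1 + real n))\<^sup>2\<bar> \<le> (1 + real n)\<^sup>2" for x
      using admissible_weightD(3)[OF \<rho>, of x] by (auto intro!: power_mono)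
  qed (auto intro: indicator_L2)
  have trunc: "(\<integral>\<^sup>+x. ennreal \<bar>\<phi> n x * h_of (Y t) x\<bar> \<partial>lborel) \<le> ennreal (?H + D * T)" for n
  proof -
    have int: "integrable lborel (\<lambda>x. \<phi> n x * h_of (Y s) x)" if "s \<in> {0..T}" for s
      using L2_Cauchy_Schwarz(1)[OF \<phi>_L2 h[OF that]] by (simp add: L1_def)
    have "L1_norm (\<lambda>x. \<phi> n x * h_of (Y t) x) \<le> (L1_norm (\<lambda>x. \<phi> n x * h_of (Y 0) x) + D * t) * exp (0 * t)"
      by (rule controlled_Gronwall[OF sol controlled_L1_h[OF \<phi>_L2] _ _ D _ t]) (auto intro: rate \<phi>_le)
    also have "L1_norm (\<lambda>x. \<phi> n x * h_of (Y 0) x) \<le> ?H"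
      unfolding L1_norm_def
    proof (intro integral_mono integrable_abs int t0)
      show "integrable lborel (\<lambda>\<xi>. (\<rho> \<xi>)\<^sup>2 * h_of (Y 0) \<xi>)" using init by (simp add: L1_def)
      show "\<bar>\<phi> n x * h_of (Y 0) x\<bar> \<le> \<bar>(\<rho> x)\<^sup>2 * h_of (Y 0) x\<bar>" for x
        using \<phi>_le[of n x] by (simp add: abs_mult mult_right_mono)
    qed
    also have "D * t \<le> D * T" using t D by (intro mult_left_mono) auto
    finally have "L1_norm (\<lambda>x. \<phi> n x * h_of (Y t) x) \<le> ?H + D * T" by simp
    then show ?thesis
      unfolding L1_norm_def using int[OF t] by (subst nn_integral_eq_integral) (auto intro: ennreal_leI)
  qed
  have "(\<integral>\<^sup>+x. ennreal \<bar>(\<rho> x)\<^sup>2 * h_of (Y t) x\<bar> \<partial>lborel) \<le> ennreal (?H + D * T)"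
  proof (rule nn_integral_le_of_truncations[OF _ _ _ trunc])
    fix n :: nat and x
    have "\<phi> n x \<le> \<phi> (Suc n) x"
      using admissible_weightD(3)[OF \<rho>, of x]
      by (auto simp: \<phi>_def indicator_def intro!: power_mono)
    then show "ennreal \<bar>\<phi> n x * h_of (Y t) x\<bar> \<le> ennreal \<bar>\<phi> (Suc n) x * h_of (Y t) x\<bar>"
      using \<phi>_pos by (auto simp: abs_mult intro!: ennreal_leI mult_right_mono)
    obtain m where "max (\<rho> x) \<bar>x\<bar> \<le> real m" using real_arch_simple by blast
    then show "eventually (\<lambda>n. ennreal \<bar>\<phi> n x * h_of (Y t) x\<bar> = ennreal \<bar>(\<rho> x)\<^sup>2 * h_of (Y t) x\<bar>) sequentially"
      by (intro eventually_sequentiallyI[of m]) (auto simp: \<phi>_def min_def indicator_def)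
  qed measurable
  note L1_boundI[OF _ this]
  then show "(\<lambda>\<xi>. (\<rho> \<xi>)\<^sup>2 * h_of (Y t) \<xi>) \<in> L1"
    "L1_norm (\<lambda>\<xi>. (\<rho> \<xi>)\<^sup>2 * h_of (Y t) \<xi>) \<le> ?H + D * T"
    using D T by simp_all
qed

section \<open>The weighted spaces\<close>

definition weighted_space :: "(real \<Rightarrow> real) \<Rightarrow> state set" where
  "weighted_space \<rho> = {Y \<in> F. q_of Y \<in> Linf \<and> w_of Y \<in> Linf \<and> h_of Y \<in> Linf \<and>
     (\<lambda>\<xi>. \<rho> \<xi> * U_of Y \<xi>) \<in> L2 \<and> (\<lambda>\<xi>. \<rho> \<xi> * w_of Y \<xi>) \<in> L2 \<and> (\<lambda>\<xi>. (\<rho> \<xi>)\<^sup>2 * h_of Y \<xi>) \<in> L1}"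

definition weighted_norm :: "(real \<Rightarrow> real) \<Rightarrow> state \<Rightarrow> real" where
  "weighted_norm \<rho> Y = F_norm Y + Linf_norm (q_of Y) + Linf_norm (w_of Y) + Linf_norm (h_of Y)
     + L2_norm (\<lambda>\<xi>. \<rho> \<xi> * U_of Y \<xi>) + L2_norm (\<lambda>\<xi>. \<rho> \<xi> * w_of Y \<xi>) + L1_norm (\<lambda>\<xi>. (\<rho> \<xi>)\<^sup>2 * h_of Y \<xi>)"

text \<open>Since \<open>(\<rho> f)\<^sup>2 \<le> \<parallel>f\<parallel> \<rho>\<^sup>2 \<bar>f\<bar>\<close> with the supremum norm of \<open>f\<close>. This provides the initial weighted
  \<open>L\<^sup>2\<close> norm of \<open>h\<close>.\<close>

lemma weighted_L2_interpolation:
  assumes f: "f \<in> Linf" "Linf_norm f \<le> r" and \<rho>: "\<rho> \<in> borel_measurable borel"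
    and L1: "(\<lambda>x. (\<rho> x)\<^sup>2 * f x) \<in> L1" "L1_norm (\<lambda>x. (\<rho> x)\<^sup>2 * f x) \<le> r"
  shows "(\<lambda>x. \<rho> x * f x) \<in> L2" "L2_norm (\<lambda>x. \<rho> x * f x) \<le> r"
proof -
  note [measurable] = \<rho> Linf_measurable[OF f(1)]
  have r: "0 \<le> r" using f(2) Linf_norm_nonneg[of f] by linarith
  have int: "integrable lborel (\<lambda>x. (\<rho> x)\<^sup>2 * f x)" using L1(1) by (simp add: L1_def)
  have "(\<integral>\<^sup>+x. ennreal ((\<rho> x * f x)\<^sup>2) \<partial>lborel) \<le> (\<integral>\<^sup>+x. ennreal (r * \<bar>(\<rho> x)\<^sup>2 * f x\<bar>) \<partial>lborel)"
  proof (rule nn_integral_mono_AE)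
    show "AE x in lborel. ennreal ((\<rho> x * f x)\<^sup>2) \<le> ennreal (r * \<bar>(\<rho> x)\<^sup>2 * f x\<bar>)"
      using AE_le_Linf_norm[OF f(1)]
    proof eventually_elim
      case (elim x)
      have "\<bar>f x\<bar> * ((\<rho> x)\<^sup>2 * \<bar>f x\<bar>) \<le> r * ((\<rho> x)\<^sup>2 * \<bar>f x\<bar>)"
        using elim f(2) by (intro mult_right_mono) auto
      then show ?case by (intro ennreal_leI) (simp add: abs_mult power2_eq_square mult_ac)
    qed
  qed
  also have "\<dots> = ennreal (r * L1_norm (\<lambda>x. (\<rho> x)\<^sup>2 * f x))"
    unfolding L1_norm_def using int r by (subst nn_integral_eq_integral) auto
  also have "\<dots> \<le> ennreal (r\<^sup>2)"
    unfolding power2_eq_square[of r] using L1(2) r by (intro ennreal_leI mult_left_mono)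
  finally show "(\<lambda>x. \<rho> x * f x) \<in> L2" "L2_norm (\<lambda>x. \<rho> x * f x) \<le> r"
    using r by (auto intro!: L2_boundI)
qed

lemma weighted_norm_bounds:
  "F_norm Y \<le> weighted_norm \<rho> Y" "Linf_norm (q_of Y) \<le> weighted_norm \<rho> Y"
  "Linf_norm (w_of Y) \<le> weighted_norm \<rho> Y" "Linf_norm (h_of Y) \<le> weighted_norm \<rho> Y"
  "L2_norm (\<lambda>\<xi>. \<rho> \<xi> * U_of Y \<xi>) \<le> weighted_norm \<rho> Y" "L2_norm (\<lambda>\<xi>. \<rho> \<xi> * w_of Y \<xi>) \<le> weighted_norm \<rho> Y"
  "L1_norm (\<lambda>\<xi>. (\<rho> \<xi>)\<^sup>2 * h_of Y \<xi>) \<le> weighted_norm \<rho> Y"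
  using F_norm_bounds(1)[of Y] Linf_norm_nonneg[of "q_of Y"] Linf_norm_nonneg[of "w_of Y"]
    Linf_norm_nonneg[of "h_of Y"] L2_norm_nonneg[of "\<lambda>\<xi>. \<rho> \<xi> * U_of Y \<xi>"]
    L2_norm_nonneg[of "\<lambda>\<xi>. \<rho> \<xi> * w_of Y \<xi>"] L1_norm_nonneg[of "\<lambda>\<xi>. (\<rho> \<xi>)\<^sup>2 * h_of Y \<xi>"]
  unfolding weighted_norm_def by linarith+

text \<open>The short existence time enters only through the bound \<open>M\<close> on the \<open>F\<close> norm of the solution. All further
  constants are built from \<open>M\<close>, \<open>T\<close>, \<open>r\<close>, \<open>\<gamma>\<close> and \<open>K\<close>, before a solution is chosen.\<close>

lemma weighted_space_bound:
  assumes \<tau>: "short_time \<gamma> \<tau>" and \<rho>: "admissible_weight \<rho> K" and T: "0 < T"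
  shows "\<exists>C. \<forall>Y0 Y. Y0 \<in> weighted_space \<rho> \<and> weighted_norm \<rho> Y0 = r \<and> T \<le> \<tau> (F_norm Y0) \<and> solution \<gamma> T Y0 Y \<longrightarrow>
     (\<forall>t\<in>{0..T}. Y t \<in> weighted_space \<rho> \<and> weighted_norm \<rho> (Y t) \<le> C)"
proof (cases "0 \<le> r")
  case False
  then show ?thesis using weighted_norm_bounds(1) F_norm_bounds(1) by (metis order_trans)
next
  case r: True
  obtain M' where M': "\<And>Y0 T Y. Y0 \<in> F \<and> F_norm Y0 \<le> r \<and> 0 < T \<and> T \<le> \<tau> (F_norm Y0) \<and>
        solution \<gamma> T Y0 Y \<Longrightarrow> (\<forall>t\<in>{0..T}. F_norm (Y t) \<le> M')"
    using \<tau> unfolding short_time_def by meson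
  define M where "M = max 0 M'"
  have M: "0 \<le> M" by (simp add: M_def)
  have T0: "0 \<le> T" using T by simp
  note K = admissible_weightD(5)[OF \<rho>]
  obtain R where R: "0 \<le> R" and qwh: "\<And>Y. C1_F T Y (\<lambda>t. G \<gamma> (Y t)) \<Longrightarrow>
       (\<And>t. t \<in> {0..T} \<Longrightarrow> F_norm (Y t) \<le> M) \<Longrightarrow>
       (\<forall>f\<in>{q_of, w_of, h_of}. f (Y 0) \<in> Linf \<and> Linf_norm (f (Y 0)) \<le> r) \<Longrightarrow>
       (\<forall>t\<in>{0..T}. \<forall>f\<in>{q_of, w_of, h_of}. f (Y t) \<in> Linf \<and> Linf_norm (f (Y t)) \<le> R)"
    using qwh_bounded[OF M T0 r, of \<gamma>] by blast
  have r3: "0 \<le> 3 * r" using r by simp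
  obtain W where W: "0 \<le> W" and wL2: "\<And>Y \<rho> t f. C1_F T Y (\<lambda>t. G \<gamma> (Y t)) \<Longrightarrow>
       (\<forall>t\<in>{0..T}. F_norm (Y t) \<le> M \<and> q_of (Y t) \<in> Linf \<and> Linf_norm (q_of (Y t)) \<le> R) \<Longrightarrow>
       admissible_weight \<rho> K \<Longrightarrow>
       (\<forall>f\<in>{U_of, w_of, h_of}. (\<lambda>\<xi>. \<rho> \<xi> * f (Y 0) \<xi>) \<in> L2) \<Longrightarrow> weighted_part \<rho> (Y 0) \<le> 3 * r \<Longrightarrow>
       t \<in> {0..T} \<Longrightarrow> f \<in> {U_of, w_of, h_of} \<Longrightarrow>
       (\<lambda>\<xi>. \<rho> \<xi> * f (Y t) \<xi>) \<in> L2 \<and> L2_norm (\<lambda>\<xi>. \<rho> \<xi> * f (Y t) \<xi>) \<le> W"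
    using weighted_L2_propagation[OF M T0 R r3 K, of \<gamma>] by blast
  obtain E where E: "0 \<le> E" and nl: "\<And>Y \<phi> f. Y \<in> F \<Longrightarrow> F_norm Y \<le> M \<Longrightarrow> q_of Y \<in> Linf \<Longrightarrow> Linf_norm (q_of Y) \<le> R \<Longrightarrow>
      admissible_weight \<phi> K \<Longrightarrow> (\<lambda>\<xi>. \<phi> \<xi> * U_of Y \<xi>) \<in> L2 \<Longrightarrow> (\<lambda>\<xi>. \<phi> \<xi> * h_of Y \<xi>) \<in> L2 \<Longrightarrow>
      f \<in> {source \<gamma> Y, P \<gamma> Y, Q \<gamma> Y} \<Longrightarrow>
      (\<lambda>\<xi>. \<phi> \<xi> * f \<xi>) \<in> L2 \<and> L2_norm (\<lambda>\<xi>. \<phi> \<xi> * f \<xi>) \<le> E * weighted_part \<phi> Y"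
    using weighted_nonlocal[OF M R K, of \<gamma>] by blast
  \<comment> \<open>a common bound for the weighted \<open>L\<^sup>2\<close> norms of \<open>U\<close>, \<open>w\<close>, \<open>P\<close> and \<open>Q\<close>\<close>
  define V where "V = W + E * (3 * W)"
  define D where "D = (2 * R + 3 * M + 2) * V\<^sup>2"
  have D: "0 \<le> D" using R M by (simp add: D_def)
  define C where "C = M + R + R + R + W + W + (r + D * T)"
  have "Y t \<in> weighted_space \<rho> \<and> weighted_norm \<rho> (Y t) \<le> C"
    if Y0: "Y0 \<in> weighted_space \<rho>" "weighted_norm \<rho> Y0 = r" and small: "T \<le> \<tau> (F_norm Y0)"
      and sol: "solution \<gamma> T Y0 Y" and t: "t \<in> {0..T}" for Y0 Y t
  proof -
    have C1: "C1_F T Y (\<lambda>t. G \<gamma> (Y t))" and start: "Y 0 = Y0" using sol by (auto simp: solution_def)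
    have YF: "Y s \<in> F" if "s \<in> {0..T}" for s using C1 that by (auto simp: C1_F_def)
    note bounds = weighted_norm_bounds[where Y = Y0 and \<rho> = \<rho>, unfolded Y0(2)]
    have mem: "Y0 \<in> F" "q_of Y0 \<in> Linf" "w_of Y0 \<in> Linf" "h_of Y0 \<in> Linf"
      "(\<lambda>\<xi>. \<rho> \<xi> * U_of Y0 \<xi>) \<in> L2" "(\<lambda>\<xi>. \<rho> \<xi> * w_of Y0 \<xi>) \<in> L2" "(\<lambda>\<xi>. (\<rho> \<xi>)\<^sup>2 * h_of Y0 \<xi>) \<in> L1"
      using Y0(1) by (auto simp: weighted_space_def)
    have YM: "F_norm (Y s) \<le> M" if "s \<in> {0..T}" for s
      using M'[of Y0 T Y] mem(1) bounds(1) T small sol that by (auto simp: M_def le_max_iff_disj)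
    have Linf: "f (Y s) \<in> Linf" "Linf_norm (f (Y s)) \<le> R" if "s \<in> {0..T}" "f \<in> {q_of, w_of, h_of}" for s f
      using qwh[OF C1 YM] mem(2-4) bounds(2-4) start that by auto
    have \<rho>h: "(\<lambda>x. \<rho> x * h_of Y0 x) \<in> L2" "L2_norm (\<lambda>x. \<rho> x * h_of Y0 x) \<le> r"
      by (rule weighted_L2_interpolation[OF mem(4) bounds(4) admissible_weightD(1)[OF \<rho>] mem(7) bounds(7)])+
    have \<rho>L2: "(\<lambda>\<xi>. \<rho> \<xi> * f (Y s) \<xi>) \<in> L2 \<and> L2_norm (\<lambda>\<xi>. \<rho> \<xi> * f (Y s) \<xi>) \<le> W"
      if "s \<in> {0..T}" "f \<in> {U_of, w_of, h_of}" for s f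
    proof (rule wL2[OF C1 _ \<rho> _ _ that])
      show "\<forall>t\<in>{0..T}. F_norm (Y t) \<le> M \<and> q_of (Y t) \<in> Linf \<and> Linf_norm (q_of (Y t)) \<le> R"
        using YM Linf by auto
      show "\<forall>f\<in>{U_of, w_of, h_of}. (\<lambda>\<xi>. \<rho> \<xi> * f (Y 0) \<xi>) \<in> L2"
        using mem \<rho>h by (auto simp: start)
      show "weighted_part \<rho> (Y 0) \<le> 3 * r"
        using bounds(5,6) \<rho>h(2) by (simp add: weighted_part_def start)
    qed
    have rate: "L1_norm (\<lambda>\<xi>. \<phi> \<xi> * h_of (G \<gamma> (Y s)) \<xi>) \<le> D"
      if s: "s \<in> {0..T}" and \<phi>: "\<And>\<xi>. \<bar>\<phi> \<xi>\<bar> \<le> (\<rho> \<xi>)\<^sup>2" for s \<phi>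
      unfolding D_def
    proof (rule h_rate_L1[OF YF[OF s] R M _ _ _ \<phi>])
      show "AE \<xi> in lborel. \<bar>U_of (Y s) \<xi>\<bar> \<le> M"
        using AE_le_Linf_norm[OF F_memD(2)[OF YF[OF s]]]
        by eventually_elim (use F_norm_bounds(4)[of "Y s"] YM[OF s] in linarith)
      show "AE \<xi> in lborel. \<bar>q_of (Y s) \<xi>\<bar> \<le> R"
        using AE_le_Linf_norm[OF Linf(1)[OF s, of q_of]] Linf(2)[OF s, of q_of] by auto
      have part: "weighted_part \<rho> (Y s) \<le> 3 * W"
        using \<rho>L2[OF s, of U_of] \<rho>L2[OF s, of w_of] \<rho>L2[OF s, of h_of] by (simp add: weighted_part_def)
      fix f assume f: "f \<in> {U_of (Y s), w_of (Y s), P \<gamma> (Y s), Q \<gamma> (Y s)}"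
      show "(\<lambda>\<xi>. \<rho> \<xi> * f \<xi>) \<in> L2 \<and> L2_norm (\<lambda>\<xi>. \<rho> \<xi> * f \<xi>) \<le> V"
      proof (cases "f \<in> {U_of (Y s), w_of (Y s)}")
        case True
        have "W \<le> V" using E W by (simp add: V_def)
        then show ?thesis using True \<rho>L2[OF s, of U_of] \<rho>L2[OF s, of w_of] by auto
      next
        case False
        have "(\<lambda>\<xi>. \<rho> \<xi> * f \<xi>) \<in> L2 \<and> L2_norm (\<lambda>\<xi>. \<rho> \<xi> * f \<xi>) \<le> E * weighted_part \<rho> (Y s)"
          using False f Linf[OF s, of q_of] \<rho>L2[OF s] by (intro nl[OF YF[OF s] YM[OF s] _ _ \<rho>]) auto
        moreover have "E * weighted_part \<rho> (Y s) \<le> V"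
          using mult_left_mono[OF part E] W by (simp add: V_def)
        ultimately show ?thesis by auto
      qed
    qed
    have init: "(\<lambda>\<xi>. (\<rho> \<xi>)\<^sup>2 * h_of (Y 0) \<xi>) \<in> L1" using mem(7) by (simp add: start)
    note L1 = weighted_L1_propagation[OF \<rho> C1 T0 rate D init t]
    have "Y t \<in> weighted_space \<rho>"
      unfolding weighted_space_def using YF[OF t] Linf(1)[OF t] \<rho>L2[OF t] L1(1) by auto
    moreover have "weighted_norm \<rho> (Y t) \<le> C"
      unfolding weighted_norm_def C_def
      using YM[OF t] Linf(2)[OF t] \<rho>L2[OF t] L1(2) bounds(7) by (intro add_mono) (auto simp: start)
    ultimately show ?thesis ..
  qed
  then show ?thesis by blast
qed

lemma weighted_space_preserved:
  assumes "short_time \<gamma> \<tau>" and "admissible_weight \<rho> K"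
  shows "\<exists>C :: real \<Rightarrow> real \<Rightarrow> real. \<forall>Y0 T Y.
     Y0 \<in> weighted_space \<rho> \<and> 0 < T \<and> T \<le> \<tau> (F_norm Y0) \<and> solution \<gamma> T Y0 Y \<longrightarrow>
     (\<forall>t\<in>{0..T}. Y t \<in> weighted_space \<rho> \<and> weighted_norm \<rho> (Y t) \<le> C T (weighted_norm \<rho> Y0))"
proof -
  have "\<forall>T r. \<exists>C. 0 < T \<longrightarrow> (\<forall>Y0 Y. Y0 \<in> weighted_space \<rho> \<and> weighted_norm \<rho> Y0 = r \<and>
     T \<le> \<tau> (F_norm Y0) \<and> solution \<gamma> T Y0 Y \<longrightarrow>
     (\<forall>t\<in>{0..T}. Y t \<in> weighted_space \<rho> \<and> weighted_norm \<rho> (Y t) \<le> C))"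
    using weighted_space_bound[OF assms] by blast
  from this[unfolded choice_iff] obtain C where "\<forall>T r. 0 < T \<longrightarrow> (\<forall>Y0 Y. Y0 \<in> weighted_space \<rho> \<and> weighted_norm \<rho> Y0 = r \<and>
     T \<le> \<tau> (F_norm Y0) \<and> solution \<gamma> T Y0 Y \<longrightarrow>
     (\<forall>t\<in>{0..T}. Y t \<in> weighted_space \<rho> \<and> weighted_norm \<rho> (Y t) \<le> C T r))" ..
  then show ?thesis by (intro exI[of _ C]) blast
qed

lemma admissible_exp: "admissible_weight (\<lambda>x. exp (\<bar>x\<bar> / 2)) 1"
  unfolding admissible_weight_def by (auto simp flip: exp_add)

text \<open>With \<open>s = 1 + \<bar>x - y\<bar>\<close>, one has \<open>1 + \<bar>x\<bar> \<le> (1 + \<bar>y\<bar>) s\<close>, and \<open>s / \<alpha> \<le> exp (s / \<alpha>)\<close> gives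
  \<open>s powr (\<alpha>/2) \<le> \<alpha> powr (\<alpha>/2) exp (s/2)\<close>.\<close>

lemma admissible_powr:
  assumes \<alpha>: "1 < \<alpha>"
  shows "admissible_weight (\<lambda>x. (1 + \<bar>x\<bar>) powr (\<alpha> / 2)) (\<alpha> powr (\<alpha> / 2) * exp (1 / 2))"
  unfolding admissible_weight_def
proof (intro conjI allI)
  show "1 \<le> (1 + \<bar>x\<bar>) powr (\<alpha> / 2)" for x using \<alpha> by (intro ge_one_powr_ge_zero) auto
  have "1 * 1 \<le> \<alpha> powr (\<alpha> / 2) * exp (1 / 2)" using \<alpha> by (intro mult_mono ge_one_powr_ge_zero) auto
  then show "1 \<le> \<alpha> powr (\<alpha> / 2) * exp (1 / 2)" by simp
  fix x y :: real
  define s where "s = 1 + \<bar>x - y\<bar>"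
  have "s powr (\<alpha> / 2) \<le> (\<alpha> * exp (s / \<alpha>)) powr (\<alpha> / 2)"
  proof (rule powr_mono2)
    have "s / \<alpha> \<le> exp (s / \<alpha>)" using exp_ge_add_one_self[of "s / \<alpha>"] by linarith
    then show "s \<le> \<alpha> * exp (s / \<alpha>)" using \<alpha> by (simp add: field_simps)
  qed (use \<alpha> in \<open>auto simp: s_def\<close>)
  also have "\<dots> = \<alpha> powr (\<alpha> / 2) * exp (s / 2)"
    using \<alpha> by (simp add: powr_mult exp_powr_real)
  also have "exp (s / 2) = exp (1 / 2) * exp (\<bar>x - y\<bar> / 2)"
    by (simp add: s_def add_divide_distrib flip: exp_add)
  finally have s_le: "s powr (\<alpha> / 2) \<le> \<alpha> powr (\<alpha> / 2) * (exp (1 / 2) * exp (\<bar>x - y\<bar> / 2))" .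
  have "\<bar>x\<bar> \<le> \<bar>y\<bar> + \<bar>x - y\<bar>" "0 \<le> \<bar>y\<bar> * \<bar>x - y\<bar>" by auto
  then have "1 + \<bar>x\<bar> \<le> (1 + \<bar>y\<bar>) * s" unfolding s_def distrib_right distrib_left by linarith
  then have "(1 + \<bar>x\<bar>) powr (\<alpha> / 2) \<le> ((1 + \<bar>y\<bar>) * s) powr (\<alpha> / 2)"
    using \<alpha> by (intro powr_mono2) auto
  also have "\<dots> = (1 + \<bar>y\<bar>) powr (\<alpha> / 2) * s powr (\<alpha> / 2)"
    by (rule powr_mult)
  also have "\<dots> \<le> (1 + \<bar>y\<bar>) powr (\<alpha> / 2) * (\<alpha> powr (\<alpha> / 2) * (exp (1 / 2) * exp (\<bar>x - y\<bar> / 2)))"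
    by (intro mult_left_mono s_le) simp
  finally show "(1 + \<bar>x\<bar>) powr (\<alpha> / 2) \<le>
      \<alpha> powr (\<alpha> / 2) * exp (1 / 2) * (1 + \<bar>y\<bar>) powr (\<alpha> / 2) * exp (\<bar>x - y\<bar> / 2)"
    by (simp add: mult_ac)
qed measurable

lemma Fe_weighted:
  "Fe = weighted_space (\<lambda>x. exp (\<bar>x\<bar> / 2))" "Fe_norm = weighted_norm (\<lambda>x. exp (\<bar>x\<bar> / 2))"
proof -
  have sq: "(exp (\<bar>x\<bar> / 2))\<^sup>2 = exp \<bar>x\<bar>" for x :: real by (simp flip: exp_double)
  show "Fe = weighted_space (\<lambda>x. exp (\<bar>x\<bar> / 2))" unfolding Fe_def weighted_space_def sq ..
  show "Fe_norm = weighted_norm (\<lambda>x. exp (\<bar>x\<bar> / 2))"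
    by (rule ext) (simp only: Fe_norm_def weighted_norm_def sq)
qed

lemma Falpha_weighted:
  "Falpha \<alpha> = weighted_space (\<lambda>x. (1 + \<bar>x\<bar>) powr (\<alpha> / 2))"
  "Falpha_norm \<alpha> = weighted_norm (\<lambda>x. (1 + \<bar>x\<bar>) powr (\<alpha> / 2))"
proof -
  have sq: "((1 + \<bar>x\<bar>) powr (\<alpha> / 2))\<^sup>2 = (1 + \<bar>x\<bar>) powr \<alpha>" for x :: real
    by (simp add: power2_eq_square flip: powr_add)
  show "Falpha \<alpha> = weighted_space (\<lambda>x. (1 + \<bar>x\<bar>) powr (\<alpha> / 2))" unfolding Falpha_def weighted_space_def sq ..
  show "Falpha_norm \<alpha> = weighted_norm (\<lambda>x. (1 + \<bar>x\<bar>) powr (\<alpha> / 2))"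
    by (rule ext) (simp only: Falpha_norm_def weighted_norm_def sq)
qed

theorem theorem4p1:
  fixes \<gamma> :: real
  shows "(\<exists>\<tau>. short_time \<gamma> \<tau>) \<and>
    (\<forall>\<tau>. short_time \<gamma> \<tau> \<longrightarrow>
      (\<exists>C :: real \<Rightarrow> real \<Rightarrow> real. \<forall>Y0 T Y.
         Y0 \<in> Fe \<and> 0 < T \<and> T \<le> \<tau> (F_norm Y0) \<and> solution \<gamma> T Y0 Y \<longrightarrow>
         (\<forall>t\<in>{0..T}. Y t \<in> Fe \<and> Fe_norm (Y t) \<le> C T (Fe_norm Y0))) \<and>
      (\<forall>\<alpha>>1. \<exists>C :: real \<Rightarrow> real \<Rightarrow> real. \<forall>Y0 T Y.
         Y0 \<in> Falpha \<alpha> \<and> 0 < T \<and> T \<le> \<tau> (F_norm Y0) \<and> solution \<gamma> T Y0 Y \<longrightarrow>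
         (\<forall>t\<in>{0..T}. Y t \<in> Falpha \<alpha> \<and> Falpha_norm \<alpha> (Y t) \<le> C T (Falpha_norm \<alpha> Y0))))"
  unfolding Fe_weighted Falpha_weighted
  by (intro conjI allI impI short_time_exists)
     (erule weighted_space_preserved, rule admissible_exp, erule weighted_space_preserved, erule admissible_powr)

end
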